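(* Let $V,W$ be real vector spaces of dimensions $m,n\ge2$. Then: (1) The algebraic boundary of $\mathrm{Hom}_{\mathcal{AC}}(S_+(V),S_+(W^* ))$ (i.e. the Zariski closure of its boundary) is the irreducible hypersurface dual to $\mathbb{P}(V)\times\mathbb{P}(W)$ in its Segre-Veronese embedding in $\mathbb{P}(\mathrm{Sym}^2(V)\otimes\mathrm{Sym}^2(W))$. (2) The strictly positive polynomial $r:=(x_1^2+\cdots+x_m^2)(y_1^2+\cdots+y_n^2)$ belongs to the interior of $\mathrm{Hom}_{\mathcal{AC}}(S_+(V),S_+(W^* ))$ and to its algebraic boundary. (3) The cone $\mathrm{Hom}_{\mathcal{AC}}(S_+(V),S_+(W^* ))$ is not a basic closed semialgebraic set and in particular is not a spectrahedron.
   Context: For a finite-dimensional real vector space $U$, $S_+(U)\subseteq\mathrm{Sym}^2(U)$ is the cone of sums of squares of elements of $U$. For cones $C_i\subseteq LC_i$, $\mathrm{Hom}_{\mathcal{AC}}(C_1,C_2)$ is the cone of linear maps $f:LC_1\to LC_2$ with $f(C_1)\subseteq C_2$. The cone $\mathrm{Hom}_{\mathcal{AC}}(S_+(V),S_+(W^* ))$ is canonically identified with the cone $P_{(2,2)}(V^*,W^* )$ of polynomials in $\mathrm{Sym}^2(V^* )\otimes\mathrm{Sym}^2(W^* )$ (bi-homogeneous of bidegree $(2,2)$ on $V\times W$) that are nonnegative on $V\times W$: a map $f$ corresponds to the polynomial $(v,w)\mapsto f(v^2)(w)$, where $f(v^2)\in\mathrm{Sym}^2(W^* )$ is viewed as a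 quadratic form on $W$. Here $x_1,\dots,x_m$ and $y_1,\dots,y_n$ denote linear coordinates on $V$ and $W$ (bases of $V^*$ and $W^*$). The Segre-Veronese embedding sends $(v,w)$ to $v^2\otimes w^2$. For an irreducible projective variety $X\subseteq\mathbb{P}(U)$ (over the complex numbers), a hyperplane $H\in\mathbb{P}(U^* )$ is tangent to $X$ if it contains the tangent space to $X$ at some smooth point $x\in X$ (equivalently the equation of $H$ restricted to $X$ vanishes to order at least two at $x$); the dual variety $X^\vee$ is the closure in $\mathbb{P}(U^* )$ of the set of hyperplanes tangent to $X$. In (1) the dual hypersurface is identified with its affine cone in $\mathrm{Sym}^2(V^* )\otimes\mathrm{Sym}^2(W^* )$. A basic closed semialgebraic set is one of the form $\{g_1\ge0,\dots,g_s\ge0\}$ for finitely many real polynomials $g_i$. A spectrahedron is a set $\{x:M_0+\sum x_iM_i\succeq0\}$ with $M_i$ symmetric matrices. *)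

theory Defs
  imports "HOL-Analysis.Analysis" "HOL-Library.Uprod"
begin

text \<open>
  Conventions. \<open>V\<close> is the space of vectors \<open>k^'m\<close> with standard basis \<open>e\<^sub>i\<close>, and \<open>V*\<close> is again \<open>k^'m\<close>, in the
  dual basis: a covector \<open>a\<close> takes the value \<open>\<Sum>i. a $ i * v $ i\<close> at \<open>v\<close>. Here \<open>k\<close> is \<open>real\<close> or \<open>complex\<close>.
  The symmetric square of \<open>k^'m\<close> is \<open>k^('m uprod)\<close>, in the basis of the products \<open>e\<^sub>i \<sqdot> e\<^sub>j\<close>,
  indexed by unordered pairs. The basis products of \<open>Sym\<^sup>2(W*)\<close> are the monomials \<open>y\<^sub>k y\<^sub>l\<close>.
\<close>

instance uprod :: (finite) finite
  by standard simp


section \<open>Symmetric squares and the cone of sums of squares\<close>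

definition sym_mult :: "'k::comm_semiring_1 ^ 'm \<Rightarrow> 'k ^ 'm \<Rightarrow> 'k ^ ('m::finite uprod)" where
  "sym_mult u v = (\<chi> p. \<Sum>(i, j) | Upair i j = p. u $ i * v $ j)"

definition S_plus :: "(real ^ ('m::finite uprod)) set" where
  "S_plus = {A. \<exists>(N::nat) u. A = (\<Sum>k<N. sym_mult (u k) (u k))}"

lift_definition entry_product :: "'k::comm_semiring_1 ^ 'm \<Rightarrow> ('m, 'k) commute"
  is "\<lambda>v i j. v $ i * v $ j"
  by (simp add: mult.commute)

definition mono2 :: "'k::comm_semiring_1 ^ 'm \<Rightarrow> 'm::finite uprod \<Rightarrow> 'k" where
  "mono2 v p = case_uprod (entry_product v) p"

lemma mono2_Upair [simp]: "mono2 v (Upair i j) = v $ i * v $ j"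
  by (simp add: mono2_def entry_product.rep_eq)

definition quad_form :: "'k::comm_semiring_1 ^ ('n::finite uprod) \<Rightarrow> 'k ^ 'n \<Rightarrow> 'k" where
  "quad_form c w = (\<Sum>q\<in>UNIV. c $ q * mono2 w q)"


section \<open>Linear maps and the cone \<open>Hom\<^sub>A\<^sub>C\<close>\<close>

text \<open>
  A linear map \<open>k^'a \<rightarrow> k^'b\<close> is given by its matrix, stored as a vector indexed by
  (source, target) pairs; see \<open>linear_imp_lin_app\<close>.
\<close>

definition lin_app :: "'k::comm_semiring_1 ^ ('a::finite \<times> 'b::finite) \<Rightarrow> 'k ^ 'a \<Rightarrow> 'k ^ 'b" where
  "lin_app T A = (\<chi> q. \<Sum>p\<in>UNIV. T $ (p, q) * A $ p)"

definition Hom_AC :: "(real ^ 'a) set \<Rightarrow> (real ^ 'b) set \<Rightarrow> (real ^ ('a::finite \<times> 'b::finite)) set" where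
  "Hom_AC C1 C2 = {T. \<forall>A\<in>C1. lin_app T A \<in> C2}"

text \<open>The biquadratic polynomial \<open>(v, w) \<mapsto> f(v\<^sup>2)(w)\<close> of a map \<open>f : Sym\<^sup>2(V) \<rightarrow> Sym\<^sup>2(W*)\<close>.\<close>

definition biquad_form ::
  "'k::comm_semiring_1 ^ ('m::finite uprod \<times> 'n::finite uprod) \<Rightarrow> 'k ^ 'm \<Rightarrow> 'k ^ 'n \<Rightarrow> 'k" where
  "biquad_form T v w = quad_form (lin_app T (sym_mult v v)) w"

text \<open>
  The element \<open>(\<Sum>\<^sub>a x\<^sub>a\<^sup>2) \<otimes> (\<Sum>\<^sub>b y\<^sub>b\<^sup>2)\<close> of \<open>Sym\<^sup>2(V*) \<otimes> Sym\<^sup>2(W*)\<close>, as a map \<open>Sym\<^sup>2(V) \<rightarrow> Sym\<^sup>2(W*)\<close>;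
  as a functional on \<open>Sym\<^sup>2(V)\<close>, \<open>x\<^sub>a\<^sup>2\<close> sends \<open>e\<^sub>i \<sqdot> e\<^sub>j\<close> to \<open>x\<^sub>a(e\<^sub>i) x\<^sub>a(e\<^sub>j)\<close>. Its polynomial is computed in
  \<open>biquad_form_product_of_square_sums\<close>.
\<close>

definition product_of_square_sums ::
  "('m \<Rightarrow> real ^ 'm) \<Rightarrow> ('n \<Rightarrow> real ^ 'n) \<Rightarrow> real ^ ('m::finite uprod \<times> 'n::finite uprod)" where
  "product_of_square_sums x y =
     (\<chi> i. (\<Sum>a\<in>UNIV. mono2 (x a) (fst i)) * (\<Sum>b\<in>UNIV. sym_mult (y b) (y b) $ snd i))"

text \<open>
  The point \<open>v\<^sup>2 \<otimes> w\<^sup>2\<close> of \<open>Sym\<^sup>2(V) \<otimes> Sym\<^sup>2(W)\<close>, in the basis dual to the coordinates \<open>T $ (p, q)\<close> on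
  \<open>Sym\<^sup>2(V*) \<otimes> Sym\<^sup>2(W*)\<close>; the pairing is evaluation of biquadratic polynomials, see
  \<open>segre_veronese_pairing\<close>.
\<close>

definition segre_veronese ::
  "'k::comm_semiring_1 ^ 'm \<Rightarrow> 'k ^ 'n \<Rightarrow> 'k ^ ('m::finite uprod \<times> 'n::finite uprod)" where
  "segre_veronese v w = (\<chi> i. sym_mult v v $ fst i * mono2 w (snd i))"


section \<open>Complex algebraic geometry in \<open>complex^'i\<close>\<close>

inductive complex_polynomial_function :: "(complex ^ 'i \<Rightarrow> complex) \<Rightarrow> bool" where
  coord: "complex_polynomial_function (\<lambda>z. z $ i)"
| const: "complex_polynomial_function (\<lambda>z. c)"
| add: "complex_polynomial_function p \<Longrightarrow> complex_polynomial_function q \<Longrightarrow>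
          complex_polynomial_function (\<lambda>z. p z + q z)"
| mult: "complex_polynomial_function p \<Longrightarrow> complex_polynomial_function q \<Longrightarrow>
          complex_polynomial_function (\<lambda>z. p z * q z)"

definition zariski_closure :: "(complex ^ 'i) set \<Rightarrow> (complex ^ 'i) set" where
  "zariski_closure S =
     {z. \<forall>p. complex_polynomial_function p \<and> (\<forall>s\<in>S. p s = 0) \<longrightarrow> p z = 0}"

text \<open>
  Over an infinite field polynomials and polynomial functions coincide, so the following is
  irreducibility in the polynomial ring.
\<close>

definition irreducible_polynomial_function :: "(complex ^ 'i \<Rightarrow> complex) \<Rightarrow> bool" where
  "irreducible_polynomial_function p \<longleftrightarrow>
     complex_polynomial_function p \<and> \<not> p constant_on UNIV \<and>
     (\<forall>q r. complex_polynomial_function q \<and> complex_polynomial_function r \<and>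
        (\<forall>z. p z = q z * r z) \<longrightarrow> q constant_on UNIV \<or> r constant_on UNIV)"

definition irreducible_hypersurface :: "(complex ^ 'i) set \<Rightarrow> bool" where
  "irreducible_hypersurface Y \<longleftrightarrow>
     (\<exists>p. irreducible_polynomial_function p \<and> Y = {z. p z = 0})"

text \<open>
  A projective variety is represented by its affine cone \<open>X\<close>, and its tangent spaces by the
  linear subspaces that are the tangent spaces of the cone.
\<close>

definition tangent_space :: "(complex ^ 'i) set \<Rightarrow> complex ^ 'i \<Rightarrow> (complex ^ 'i) set" where
  "tangent_space X x =
     {u. \<forall>p. complex_polynomial_function p \<and> (\<forall>z\<in>X. p z = 0) \<longrightarrow>
           ((\<lambda>t. p (x + t *s u)) has_field_derivative 0) (at 0)}"

text \<open>
  For irreducible \<open>X\<close> the dimension of \<open>X\<close> is the minimal dimension of its tangent spaces, and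
  the smooth points are those where it is attained. The vertex \<open>0\<close> of the cone is not a point of
  the projective variety.
\<close>

definition smooth_point :: "(complex ^ 'i) set \<Rightarrow> complex ^ 'i \<Rightarrow> bool" where
  "smooth_point X x \<longleftrightarrow>
     x \<in> X - {0} \<and> (\<forall>y\<in>X - {0}. vec.dim (tangent_space X x) \<le> vec.dim (tangent_space X y))"

text \<open>The hyperplane with equation \<open>\<Sum>i. c $ i * u $ i = 0\<close>.\<close>

definition tangent_hyperplane :: "(complex ^ 'i) set \<Rightarrow> complex ^ 'i \<Rightarrow> bool" where
  "tangent_hyperplane X c \<longleftrightarrow>
     c \<noteq> 0 \<and> (\<exists>x. smooth_point X x \<and> (\<forall>u\<in>tangent_space X x. (\<Sum>i\<in>UNIV. c $ i * u $ i) = 0))"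

text \<open>
  The affine cone over the dual variety. The closure of a nonempty set in projective space
  corresponds to the closure of the cone over it.
\<close>

definition dual_variety :: "(complex ^ 'i) set \<Rightarrow> (complex ^ 'i) set" where
  "dual_variety X = zariski_closure {c. tangent_hyperplane X c}"

definition segre_veronese_cone :: "(complex ^ ('m::finite uprod \<times> 'n::finite uprod)) set" where
  "segre_veronese_cone = {segre_veronese v w | v w. True}"


section \<open>Semialgebraic notions\<close>

definition complexify :: "real ^ 'i \<Rightarrow> complex ^ 'i" where
  "complexify x = (\<chi> i. complex_of_real (x $ i))"

text \<open>
  The algebraic boundary is a complex variety; its real points form the Zariski closure of the
  boundary over the reals, see \<open>complexify_in_zariski_closure_iff\<close>.
\<close>

definition algebraic_boundary :: "(real ^ 'i) set \<Rightarrow> (complex ^ 'i) set" where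
  "algebraic_boundary S = zariski_closure (complexify ` frontier S)"

definition basic_closed_semialgebraic :: "(real ^ 'i) set \<Rightarrow> bool" where
  "basic_closed_semialgebraic S \<longleftrightarrow>
     (\<exists>G. finite G \<and> (\<forall>g\<in>G. real_polynomial_function g) \<and> S = {x. \<forall>g\<in>G. 0 \<le> g x})"

text \<open>Matrices of size \<open>N\<close> are functions on indices below \<open>N\<close>, as \<open>N\<close> is quantified in \<open>spectrahedron\<close>.\<close>

definition symmetric_matrix :: "nat \<Rightarrow> (nat \<Rightarrow> nat \<Rightarrow> real) \<Rightarrow> bool" where
  "symmetric_matrix N A \<longleftrightarrow> (\<forall>a<N. \<forall>b<N. A a b = A b a)"

definition psd_matrix :: "nat \<Rightarrow> (nat \<Rightarrow> nat \<Rightarrow> real) \<Rightarrow> bool" where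
  "psd_matrix N A \<longleftrightarrow> (\<forall>u. 0 \<le> (\<Sum>a<N. \<Sum>b<N. u a * A a b * u b))"

definition spectrahedron :: "(real ^ 'i) set \<Rightarrow> bool" where
  "spectrahedron S \<longleftrightarrow>
     (\<exists>(N::nat) M0 M. symmetric_matrix N M0 \<and> (\<forall>i. symmetric_matrix N (M i)) \<and>
        S = {x. psd_matrix N (\<lambda>a b. M0 a b + (\<Sum>i\<in>UNIV. x $ i * M i a b))})"


section \<open>Consistency of the encodings\<close>

lemma sum_uprod_mult:
  fixes g :: "'m::finite uprod \<Rightarrow> 'k::comm_semiring_1"
  shows "(\<Sum>p\<in>UNIV. g p * sym_mult u v $ p) = (\<Sum>i\<in>UNIV. \<Sum>j\<in>UNIV. g (Upair i j) * (u $ i * v $ j))"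
proof -
  have "(\<Sum>p\<in>UNIV. g p * sym_mult u v $ p)
      = (\<Sum>p\<in>UNIV. \<Sum>ij | Upair (fst ij) (snd ij) = p.
           g (Upair (fst ij) (snd ij)) * (u $ fst ij * v $ snd ij))"
    by (simp add: sym_mult_def sum_distrib_left case_prod_unfold)
  also have "\<dots> = (\<Sum>ij\<in>UNIV. g (Upair (fst ij) (snd ij)) * (u $ fst ij * v $ snd ij))"
    using sum.group[of "UNIV :: ('m \<times> 'm) set" "UNIV :: 'm uprod set"
        "\<lambda>ij. Upair (fst ij) (snd ij)"
        "\<lambda>ij. g (Upair (fst ij) (snd ij)) * (u $ fst ij * v $ snd ij)"] by simp
  also have "\<dots> = (\<Sum>i\<in>UNIV. \<Sum>j\<in>UNIV. g (Upair i j) * (u $ i * v $ j))"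
    by (simp add: sum.cartesian_product case_prod_unfold flip: UNIV_Times_UNIV)
  finally show ?thesis .
qed

lemma quad_form_square:
  fixes a w :: "'k::comm_semiring_1 ^ 'n"
  shows "quad_form (sym_mult a a) w = (\<Sum>i\<in>UNIV. a $ i * w $ i)\<^sup>2"
proof -
  have "quad_form (sym_mult a a) w = (\<Sum>q\<in>UNIV. mono2 w q * sym_mult a a $ q)"
    by (simp add: quad_form_def mult.commute)
  then show ?thesis
    by (simp add: sum_uprod_mult power2_eq_square sum_product algebra_simps)
qed

lemma mono2_sym_mult:
  fixes a v :: "'k::comm_semiring_1 ^ 'm"
  shows "(\<Sum>p\<in>UNIV. mono2 a p * sym_mult v v $ p) = (\<Sum>i\<in>UNIV. a $ i * v $ i)\<^sup>2"
  by (simp add: sum_uprod_mult power2_eq_square sum_product algebra_simps)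

lemma linear_expand:
  fixes f :: "real ^ 'a \<Rightarrow> 'c::real_vector"
  assumes "linear f"
  shows "f A = (\<Sum>p\<in>UNIV. A $ p *\<^sub>R f (axis p 1))"
proof -
  have "f A = f (\<Sum>p\<in>UNIV. A $ p *s axis p 1)"
    by (simp only: basis_expansion)
  then show ?thesis
    by (simp only: scalar_mult_eq_scaleR linear_sum[OF assms] linear_scale[OF assms])
qed

lemma linear_imp_lin_app:
  fixes f :: "real ^ 'a \<Rightarrow> real ^ 'b"
  assumes "linear f"
  shows "\<exists>!T. f = lin_app T"
proof (rule ex1I)
  have "f A = lin_app (\<chi> i. f (axis (fst i) 1) $ snd i) A" for A
    unfolding linear_expand[OF assms, of A] by (simp add: lin_app_def vec_eq_iff mult.commute)
  then show "f = lin_app (\<chi> i. f (axis (fst i) 1) $ snd i)" by (rule ext)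
next
  fix T assume T: "f = lin_app T"
  have "f (axis p 1) $ q = T $ (p, q)" for p q
    unfolding T by (simp add: lin_app_def axis_def if_distrib cong: if_cong)
  then show "T = (\<chi> i. f (axis (fst i) 1) $ snd i)"
    by (simp add: vec_eq_iff)
qed

lemma segre_veronese_pairing:
  fixes T :: "'k::comm_semiring_1 ^ ('m::finite uprod \<times> 'n::finite uprod)"
  shows "(\<Sum>i\<in>UNIV. T $ i * segre_veronese v w $ i) = biquad_form T v w"
proof -
  have "(\<Sum>i\<in>UNIV. T $ i * segre_veronese v w $ i)
      = (\<Sum>p\<in>UNIV. \<Sum>q\<in>UNIV. T $ (p, q) * (sym_mult v v $ p * mono2 w q))"
    by (simp add: segre_veronese_def sum.cartesian_product case_prod_unfold flip: UNIV_Times_UNIV)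
  also have "\<dots> = (\<Sum>q\<in>UNIV. \<Sum>p\<in>UNIV. T $ (p, q) * (sym_mult v v $ p * mono2 w q))"
    by (rule sum.swap)
  finally show ?thesis
    by (simp add: biquad_form_def quad_form_def lin_app_def sum_distrib_right mult.assoc)
qed

lemma biquad_form_product_of_square_sums:
  "biquad_form (product_of_square_sums x y) v w
     = (\<Sum>a\<in>UNIV. (x a \<bullet> v)\<^sup>2) * (\<Sum>b\<in>UNIV. (y b \<bullet> w)\<^sup>2)"
proof -
  have 1: "(\<Sum>p\<in>UNIV. (\<Sum>a\<in>UNIV. mono2 (x a) p) * sym_mult v v $ p) = (\<Sum>a\<in>UNIV. (x a \<bullet> v)\<^sup>2)"
  proof -
    have "(\<Sum>p\<in>UNIV. (\<Sum>a\<in>UNIV. mono2 (x a) p) * sym_mult v v $ p)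
        = (\<Sum>a\<in>UNIV. \<Sum>p\<in>UNIV. mono2 (x a) p * sym_mult v v $ p)"
      unfolding sum_distrib_right by (rule sum.swap)
    then show ?thesis by (simp add: mono2_sym_mult inner_vec_def)
  qed
  have 2: "(\<Sum>q\<in>UNIV. (\<Sum>b\<in>UNIV. sym_mult (y b) (y b) $ q) * mono2 w q) = (\<Sum>b\<in>UNIV. (y b \<bullet> w)\<^sup>2)"
  proof -
    have "(\<Sum>q\<in>UNIV. (\<Sum>b\<in>UNIV. sym_mult (y b) (y b) $ q) * mono2 w q)
        = (\<Sum>b\<in>UNIV. quad_form (sym_mult (y b) (y b)) w)"
      unfolding sum_distrib_right quad_form_def by (rule sum.swap)
    then show ?thesis by (simp add: quad_form_square inner_vec_def)
  qed
  have "lin_app (product_of_square_sums x y) (sym_mult v v) $ q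
      = (\<Sum>a\<in>UNIV. (x a \<bullet> v)\<^sup>2) * (\<Sum>b\<in>UNIV. sym_mult (y b) (y b) $ q)" for q
    unfolding 1[symmetric] sum_distrib_right[of _ UNIV "\<Sum>b\<in>UNIV. sym_mult (y b) (y b) $ q"]
    unfolding lin_app_def product_of_square_sums_def
    by (simp only: vec_lambda_beta fst_conv snd_conv mult_ac)
  then have "biquad_form (product_of_square_sums x y) v w
      = (\<Sum>q\<in>UNIV. (\<Sum>a\<in>UNIV. (x a \<bullet> v)\<^sup>2) * ((\<Sum>b\<in>UNIV. sym_mult (y b) (y b) $ q) * mono2 w q))"
    unfolding biquad_form_def quad_form_def by (simp only: mult.assoc)
  also have "\<dots> = (\<Sum>a\<in>UNIV. (x a \<bullet> v)\<^sup>2) *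
      (\<Sum>q\<in>UNIV. (\<Sum>b\<in>UNIV. sym_mult (y b) (y b) $ q) * mono2 w q)"
    by (rule sum_distrib_left[symmetric])
  finally show ?thesis unfolding 2 .
qed

lemma complexify_in_zariski_closure_iff:
  fixes S :: "(real ^ 'i) set"
  shows "complexify x \<in> zariski_closure (complexify ` S) \<longleftrightarrow>
     (\<forall>p. real_polynomial_function p \<and> (\<forall>s\<in>S. p s = 0) \<longrightarrow> p x = 0)"
proof -
  have real_to_complex: "\<exists>P. complex_polynomial_function P \<and> (\<forall>x. P (complexify x) = complex_of_real (p x))"
    if "real_polynomial_function p" for p :: "real ^ 'i \<Rightarrow> real"
    using that
  proof induction
    case (linear f)
    have sum_poly: "complex_polynomial_function (\<lambda>z. \<Sum>i\<in>I. of_real (c i) * z $ i)"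
      if "finite I" for I and c :: "'i \<Rightarrow> real"
      using that
    proof induction
      case (insert i F)
      have "complex_polynomial_function (\<lambda>z. of_real (c i) * z $ i + (\<Sum>i\<in>F. of_real (c i) * z $ i))"
        by (intro complex_polynomial_function.intros insert.IH)
      then show ?case using insert.hyps by simp
    qed (simp add: complex_polynomial_function.const)
    have expand: "f x = (\<Sum>i\<in>UNIV. f (axis i 1) * x $ i)" for x
      unfolding linear_expand[OF bounded_linear.linear[OF linear], of x] by (simp add: mult.commute)
    have "(\<Sum>i\<in>UNIV. of_real (f (axis i 1)) * complexify x $ i) = complex_of_real (f x)" for x
      unfolding expand[of x] by (simp add: complexify_def)
    then show ?case using sum_poly[OF finite, of "\<lambda>i. f (axis i 1)"] by blast
  next
    case (const c)
    show ?case by (rule exI[of _ "\<lambda>z. of_real c"]) (simp add: complex_polynomial_function.const)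
  next
    case (add f g)
    then obtain F G where "complex_polynomial_function F" "complex_polynomial_function G"
      "\<And>x. F (complexify x) = complex_of_real (f x)" "\<And>x. G (complexify x) = complex_of_real (g x)"
      by metis
    then show ?case
      by (intro exI[of _ "\<lambda>z. F z + G z"]) (simp add: complex_polynomial_function.add)
  next
    case (mult f g)
    then obtain F G where "complex_polynomial_function F" "complex_polynomial_function G"
      "\<And>x. F (complexify x) = complex_of_real (f x)" "\<And>x. G (complexify x) = complex_of_real (g x)"
      by metis
    then show ?case
      by (intro exI[of _ "\<lambda>z. F z * G z"]) (simp add: complex_polynomial_function.mult)
  qed
  have complex_to_real: "real_polynomial_function (\<lambda>x. Re (P (complexify x))) \<and>
      real_polynomial_function (\<lambda>x. Im (P (complexify x)))"
    if "complex_polynomial_function P" for P :: "complex ^ 'i \<Rightarrow> complex"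
    using that
  proof induction
    case (coord i)
    show ?case
      by (simp add: complexify_def real_polynomial_function.intros(1) bounded_linear_vec_nth
          real_polynomial_function.intros(2))
  next
    case (const c)
    show ?case by (simp add: real_polynomial_function.intros(2))
  next
    case (add p q)
    then show ?case by (simp add: real_polynomial_function.intros(3))
  next
    case (mult p q)
    then show ?case
      by (simp add: real_polynomial_function.intros(3,4) real_polynomial_function_diff)
  qed
  show ?thesis
  proof (intro iffI allI impI)
    fix p assume "complexify x \<in> zariski_closure (complexify ` S)"
      and p: "real_polynomial_function p \<and> (\<forall>s\<in>S. p s = 0)"
    moreover obtain P where "complex_polynomial_function P"
      "\<And>x. P (complexify x) = complex_of_real (p x)"
      using real_to_complex p by metis
    ultimately have "P (complexify x) = 0"
      unfolding zariski_closure_def by force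
    then show "p x = 0"
      using \<open>\<And>x. P (complexify x) = complex_of_real (p x)\<close> by simp
  next
    assume *: "\<forall>p. real_polynomial_function p \<and> (\<forall>s\<in>S. p s = 0) \<longrightarrow> p x = 0"
    show "complexify x \<in> zariski_closure (complexify ` S)"
      unfolding zariski_closure_def
    proof (intro CollectI allI impI)
      fix P :: "complex ^ 'i \<Rightarrow> complex"
      assume P: "complex_polynomial_function P \<and> (\<forall>s\<in>complexify ` S. P s = 0)"
      have "Re (P (complexify x)) = 0"
        by (rule *[rule_format]) (use P complex_to_real in auto)
      moreover have "Im (P (complexify x)) = 0"
        by (rule *[rule_format]) (use P complex_to_real in auto)
      ultimately show "P (complexify x) = 0" by (simp add: complex_eq_iff)
    qed
  qed
qed

end

theory Submission
  imports Defs "HOL-Computational_Algebra.Fundamental_Theorem_Algebra"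
begin

text \<open>
Write \<open>F\<^sub>T\<close> for the biquadratic form of \<open>T\<close> and \<open>H\<close> for the cone of the real \<open>T\<close> with \<open>F\<^sub>T \<ge> 0\<close>; the maps
that preserve sums of squares are exactly these, because a nonnegative quadratic form is a sum of
squares. Let \<open>D\<close> (\<open>singular_forms\<close>) be the set of complex \<open>T\<close> such that all first derivatives of
\<open>F\<^sub>T\<close> vanish at some \<open>(v, w)\<close> with \<open>v, w \<noteq> 0\<close>.

\<^bold>\<open>The dual variety.\<close> The tangent space of the Segre-Veronese cone at \<open>v\<^sup>2 \<otimes> w\<^sup>2\<close> is the image of the
derivative of \<open>(v, w) \<mapsto> v\<^sup>2 \<otimes> w\<^sup>2\<close>, and all its nonzero points are smooth. So the tangent hyperplanes
are the nonzero elements of \<open>D\<close>, and the dual variety is the Zariski closure of \<open>D\<close>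
(\<open>dual_variety_segre_veronese\<close>).

\<^bold>\<open>The algebraic boundary.\<close> A form on the frontier of \<open>H\<close> has a real zero, which is a minimum and hence
a critical point; so the frontier lies in \<open>D\<close>. Three facts make the two sets have the same ideal,
generated by one irreducible polynomial.

\<^item> \<open>D\<close> is irreducible and lies in a hypersurface. Once one coordinate of \<open>v\<close> and one of \<open>w\<close> are
  normalised to \<open>1\<close>, the condition to be singular at \<open>(v, w)\<close> is solved for one coefficient of \<open>T\<close>
  more than there are free coordinates of \<open>(v, w)\<close>.
  This parametrises a dense part of \<open>D\<close> by a polynomial map whose source has one dimension less than
  the space of forms, and counting coefficients gives an equation
  (\<open>singular_forms_prime\<close>, \<open>singular_forms_in_hypersurface\<close>).

\<^item> If \<open>e\<close> is an interior point of \<open>H\<close>, every real line of direction \<open>e\<close> leaves \<open>H\<close> and so meets the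
  frontier (\<open>translate_meets_frontier\<close>). Thus no nonzero polynomial that is constant along \<open>e\<close>
  vanishes on the frontier.

\<^item> As \<open>D\<close> is a cone, it has a homogeneous equation \<open>p\<^sub>0\<close>, and \<open>e\<close> can be chosen with \<open>p\<^sub>0(e) \<noteq> 0\<close>.
  Then the zeros of \<open>p\<^sub>0\<close> on the line \<open>z + s e\<close> satisfy \<open>\<bar>s\<bar> \<le> M \<bar>z\<bar>\<close>.

Given these (\<open>irreducible_hypersurface_of_prime_set\<close>), let \<open>r\<close> be an equation of \<open>D\<close> of least
degree in the direction \<open>e\<close>, with leading coefficient \<open>c\<close>. Up to powers of \<open>c\<close> it divides every
equation of \<open>D\<close>, in particular \<open>p\<^sub>0\<close>. So, where \<open>c\<close> is not zero, the roots of \<open>r\<close> are bounded and its coefficients are locally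
bounded multiples of \<open>c\<close>, and this forces \<open>c\<close> to divide \<open>r\<close>: on a line, domination implies
divisibility in one variable, and division by a polynomial that is monic in some direction makes
this global. The quotient \<open>p\<close> is monic in the direction \<open>e\<close> and generates the prime ideal of \<open>D\<close>, so
it is irreducible. This argument takes the place of unique factorisation in several variables. An
equation of least degree of the frontier divides \<open>p\<close> up to a factor that is constant along \<open>e\<close>; as
\<open>p\<close> is prime, it divides that equation in turn. So the equation vanishes on \<open>D\<close>, and therefore so
does every equation of the frontier.

\<^bold>\<open>Products of sums of squares.\<close> Such a form is positive, hence interior by compactness. Each factor
vanishes at an isotropic complex vector, and a product is singular where both factors vanish.

\<^bold>\<open>No basic closed description.\<close> In a suitable plane with coordinates \<open>a, b\<close> the cone contains, where
\<open>a \<ge> 0\<close> and \<open>b > 0\<close>, exactly the points with \<open>b \<ge> 1\<close> or \<open>a \<ge> (1 - b)\<^sup>2\<close>. For \<open>0 < b < 1\<close> some defining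
polynomial changes sign across the parabola \<open>a = (1 - b)\<^sup>2\<close>, so it vanishes along it to odd order; then
it also changes sign across the parabola for \<open>b > 1\<close>, where both sides belong to the cone. All faces
of a spectrahedron are exposed, but the point \<open>a = 0, b = 1\<close>, where the parabola touches the edge
\<open>a = 0, b \<ge> 1\<close>, is a face of the slice that is not (\<open>not_spectrahedron\<close>).
\<close>

section \<open>Polynomial functions\<close>

abbreviation "polyfun \<equiv> complex_polynomial_function"

lemma polyfun_uminus: "polyfun f \<Longrightarrow> polyfun (\<lambda>z. - f z)"
  using complex_polynomial_function.mult[OF complex_polynomial_function.const[of "-1"]] by simp

lemma polyfun_diff: "polyfun f \<Longrightarrow> polyfun g \<Longrightarrow> polyfun (\<lambda>z. f z - g z)"
  using complex_polynomial_function.add[OF _ polyfun_uminus, of f g] by simp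

lemma polyfun_sum: "(\<And>i. i \<in> I \<Longrightarrow> polyfun (f i)) \<Longrightarrow> polyfun (\<lambda>z. \<Sum>i\<in>I. f i z)"
  by (induction I rule: infinite_finite_induct)
     (auto intro: complex_polynomial_function.intros)

lemma polyfun_prod: "(\<And>i. i \<in> I \<Longrightarrow> polyfun (f i)) \<Longrightarrow> polyfun (\<lambda>z. \<Prod>i\<in>I. f i z)"
  by (induction I rule: infinite_finite_induct)
     (auto intro: complex_polynomial_function.intros)

lemma polyfun_power: "polyfun f \<Longrightarrow> polyfun (\<lambda>z. f z ^ k)"
  by (induction k) (auto intro: complex_polynomial_function.intros)

lemmas polyfun_intros =
  complex_polynomial_function.intros polyfun_uminus polyfun_diff polyfun_sum polyfun_prod polyfun_power

lemma polyfun_compose: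
  assumes "polyfun f" "\<And>i. polyfun (\<lambda>z. \<Phi> z $ i)"
  shows "polyfun (\<lambda>z. f (\<Phi> z))"
  using assms(1) by induction (auto intro: polyfun_intros assms(2))

text \<open>
The bound on the degree is uniform in the line; this uniformity is what
\<open>polyfun_zero_if_zero_on_grid\<close> consumes.
\<close>

lemma polyfun_line:
  assumes "polyfun f"
  shows "\<exists>n. \<forall>z e. \<exists>P. degree P \<le> n \<and> (\<forall>s. f (z + s *s e) = poly P s)"
  using assms
proof induction
  case (coord i)
  show ?case
  proof (rule exI[of _ 1], intro allI)
    fix z e :: "complex ^ 'a"
    show "\<exists>P. degree P \<le> 1 \<and> (\<forall>s. (z + s *s e) $ i = poly P s)"
      by (rule exI[of _ "[:z $ i, e $ i:]"]) simp
  qed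
next
  case (const c)
  show ?case
    by (rule exI[of _ 0], intro allI, rule exI[of _ "[:c:]"]) simp
next
  case (add p q)
  then obtain m n where "\<forall>z e. \<exists>P. degree P \<le> m \<and> (\<forall>s. p (z + s *s e) = poly P s)"
    "\<forall>z e. \<exists>Q. degree Q \<le> n \<and> (\<forall>s. q (z + s *s e) = poly Q s)" by blast
  then obtain P Q where "\<And>z e. degree (P z e) \<le> m \<and> (\<forall>s. p (z + s *s e) = poly (P z e) s)"
    "\<And>z e. degree (Q z e) \<le> n \<and> (\<forall>s. q (z + s *s e) = poly (Q z e) s)" by metis
  then show ?case
    by (intro exI[of _ "max m n"] allI exI[of _ "P z e + Q z e" for z e] conjI degree_add_le)
       (auto simp: le_max_iff_disj)
next
  case (mult p q)
  then obtain m n where "\<forall>z e. \<exists>P. degree P \<le> m \<and> (\<forall>s. p (z + s *s e) = poly P s)"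
    "\<forall>z e. \<exists>Q. degree Q \<le> n \<and> (\<forall>s. q (z + s *s e) = poly Q s)" by blast
  then obtain P Q where "\<And>z e. degree (P z e) \<le> m \<and> (\<forall>s. p (z + s *s e) = poly (P z e) s)"
    "\<And>z e. degree (Q z e) \<le> n \<and> (\<forall>s. q (z + s *s e) = poly (Q z e) s)" by metis
  then show ?case
    by (intro exI[of _ "m + n"] allI exI[of _ "P z e * Q z e" for z e] conjI order.trans[OF degree_mult_le] add_mono)
       auto
qed

lemma polyfun_lineE:
  assumes "polyfun f"
  obtains P where "\<And>s. f (z + s *s e) = poly P s"
  using polyfun_line[OF assms] by meson

lemma polyfun_domain:
  assumes f: "polyfun f" and g: "polyfun g" and fg: "\<And>z. f z * g z = 0"
  shows "(\<forall>z. f z = 0) \<or> (\<forall>z. g z = 0)"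
proof (rule ccontr)
  assume "\<not> ?thesis"
  then obtain x y where x: "f x \<noteq> 0" and y: "g y \<noteq> 0" by blast
  obtain P where P: "\<And>s. f (x + s *s (y - x)) = poly P s" using polyfun_lineE[OF f] by blast
  obtain Q where Q: "\<And>s. g (x + s *s (y - x)) = poly Q s" using polyfun_lineE[OF g] by blast
  have "poly (P * Q) s = 0" for s
    using fg[of "x + s *s (y - x)"] unfolding P Q by simp
  then have "P * Q = 0"
    using poly_all_0_iff_0 by blast
  moreover have "poly P 0 \<noteq> 0" using P[of 0] x by simp
  moreover have "poly Q 1 \<noteq> 0" using Q[of 1] y by simp
  ultimately show False by auto
qed

lemma polyfun_cancel:
  assumes "polyfun c" "polyfun f" "polyfun g" "\<exists>z. c z \<noteq> 0" "\<And>z. c z * f z = c z * g z"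
  shows "f z = g z"
  using polyfun_domain[OF assms(1) polyfun_diff[OF assms(2,3)]] assms(4,5)
  by (auto simp: right_diff_distrib)

lemma polyfun_continuous:
  assumes "polyfun f" shows "continuous_on UNIV f"
  using assms by induction (auto intro!: continuous_intros)

text \<open>
A polynomial of degree at most \<open>n\<close> in one variable is zero if it has \<open>n + 1\<close> zeros; the coordinates are
freed from the grid one at a time.
\<close>

lemma polyfun_zero_if_zero_on_grid:
  fixes f :: "complex ^ 'i \<Rightarrow> complex"
  assumes deg: "\<And>z e. \<exists>P. degree P \<le> n \<and> (\<forall>s. f (z + s *s e) = poly P s)"
    and grid: "\<And>z. (\<forall>i. z $ i \<in> of_nat ` {..n}) \<Longrightarrow> f z = 0"
  shows "f z = 0"
proof -
  have "\<forall>z. (\<forall>i. i \<notin> J \<longrightarrow> z $ i \<in> of_nat ` {..n}) \<longrightarrow> f z = 0" if "finite J" for J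
    using that
  proof induction
    case empty
    then show ?case using grid by simp
  next
    case (insert j J)
    show ?case
    proof (intro allI impI)
      fix z :: "complex ^ 'i" assume z: "\<forall>i. i \<notin> insert j J \<longrightarrow> z $ i \<in> of_nat ` {..n}"
      obtain P where P: "degree P \<le> n" "\<And>s. f (z + s *s axis j 1) = poly P s"
        using deg by blast
      have "poly P (of_nat k - z $ j) = 0" if "k \<le> n" for k
      proof -
        have "\<forall>i. i \<notin> J \<longrightarrow> (z + (of_nat k - z $ j) *s axis j 1) $ i \<in> of_nat ` {..n}"
          using z that by (auto simp: axis_def)
        then show ?thesis using insert.IH P(2) by metis
      qed
      then have "(\<lambda>k. of_nat k - z $ j) ` {..n} \<subseteq> {x. poly P x = 0}" by auto
      moreover have "card ((\<lambda>k. of_nat k - z $ j) ` {..n}) = Suc n"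
        by (subst card_image) (auto simp: inj_on_def)
      ultimately have "P = 0"
        using P(1) card_poly_roots_bound[of P] card_mono[OF poly_roots_finite[of P]]
        by (metis Suc_n_not_le_n order_trans)
      then show "f z = 0" using P(2)[of 0] by simp
    qed
  qed
  from this[of UNIV] show ?thesis by simp
qed

lemma polyfun_zero_if_zero_on_reals:
  fixes f :: "complex ^ 'a \<Rightarrow> complex"
  assumes f: "polyfun f" and "\<And>x. f (complexify x) = 0"
  shows "f z = 0"
proof -
  obtain n where n: "\<forall>z e. \<exists>P. degree P \<le> n \<and> (\<forall>s. f (z + s *s e) = poly P s)"
    using polyfun_line[OF f] by blast
  show ?thesis
  proof (rule polyfun_zero_if_zero_on_grid[of n])
    fix z :: "complex ^ 'a" assume "\<forall>i. z $ i \<in> of_nat ` {..n}"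
    then have "\<forall>i. \<exists>k. z $ i = of_nat k" by auto
    then obtain k where "\<And>i. z $ i = of_nat (k i)" by metis
    then have "z = complexify (\<chi> i. real (k i))"
      by (simp add: complexify_def vec_eq_iff)
    then show "f z = 0" using assms(2) by simp
  qed (use n in blast)
qed

text \<open>
Gaussian elimination: a homogeneous system with more unknowns than equations has a nonzero solution.
\<close>

lemma nontrivial_linear_relation:
  fixes M :: "'a \<Rightarrow> 'b \<Rightarrow> 'k::field"
  assumes "finite B" "finite S" "card B < card S"
  shows "\<exists>x. (\<exists>a\<in>S. x a \<noteq> 0) \<and> (\<forall>b\<in>B. (\<Sum>a\<in>S. x a * M a b) = 0)"
  using assms
proof (induction B arbitrary: S M)
  case empty
  then have "S \<noteq> {}" by auto
  then show ?case by (intro exI[of _ "\<lambda>_. 1"]) auto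
next
  case (insert b B)
  show ?case
  proof (cases "\<forall>a\<in>S. M a b = 0")
    case True
    obtain x where "\<exists>a\<in>S. x a \<noteq> 0" "\<forall>b\<in>B. (\<Sum>a\<in>S. x a * M a b) = 0"
      using insert.IH[of S M] insert.prems insert.hyps by auto
    then show ?thesis using True by (intro exI[of _ x]) auto
  next
    case False
    then obtain a0 where a0: "a0 \<in> S" "M a0 b \<noteq> 0" by blast
    define S' where "S' = S - {a0}"
    define M' where "M' a c = M a c - M a b / M a0 b * M a0 c" for a c
    have S: "S = insert a0 S'" "a0 \<notin> S'" "finite S'" using a0 insert.prems by (auto simp: S'_def)
    have "card B < card S'" using S insert.prems(2) insert.hyps by simp
    then obtain x where x: "\<exists>a\<in>S'. x a \<noteq> 0" "\<forall>c\<in>B. (\<Sum>a\<in>S'. x a * M' a c) = 0"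
      using insert.IH[of S' M'] S by auto
    define y where "y a = (if a = a0 then - (\<Sum>a\<in>S'. x a * M a b) / M a0 b else x a)" for a
    have y: "(\<Sum>a\<in>S. y a * M a c) = (\<Sum>a\<in>S'. x a * M' a c)" for c
    proof -
      have "(\<Sum>a\<in>S. y a * M a c) = y a0 * M a0 c + (\<Sum>a\<in>S'. y a * M a c)"
        using S by simp
      also have "(\<Sum>a\<in>S'. y a * M a c) = (\<Sum>a\<in>S'. x a * M a c)"
        using S(2) by (intro sum.cong) (auto simp: y_def)
      also have "y a0 * M a0 c = - (\<Sum>a\<in>S'. x a * (M a b / M a0 b * M a0 c))"
        by (simp add: y_def sum_distrib_left sum_distrib_right sum_divide_distrib mult_ac)
      finally show ?thesis
        by (simp add: M'_def right_diff_distrib sum_subtractf)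
    qed
    have "M' a b = 0" for a using a0 by (simp add: M'_def)
    then have "\<forall>c\<in>insert b B. (\<Sum>a\<in>S. y a * M a c) = 0"
      unfolding y using x(2) by simp
    moreover have "\<exists>a\<in>S. y a \<noteq> 0" using x(1) S by (auto simp: y_def)
    ultimately show ?thesis by blast
  qed
qed


section \<open>Polynomial maps that ignore a coordinate\<close>

text \<open>
The image of a polynomial map from a space of smaller dimension satisfies an equation. With \<open>K\<close> nodes
in each of the \<open>N\<close> coordinates, the products \<open>L\<close> are the unnormalised Lagrange basis polynomials of
the grid \<open>{0,\<dots>,K-1}\<^sup>N\<close>, so they are linearly independent, and there are \<open>K\<^sup>N\<close> of them. After
composition with \<open>\<Phi>\<close> their degree \<open>n\<close> is linear in \<open>K\<close>, and the vanishing of a combination only has to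
be tested on a grid of \<open>(n + 1)\<^sup>N\<^sup>-\<^sup>1\<close> points, which are fewer when \<open>K\<close> is large.
\<close>

lemma polynomial_map_missing_a_coordinate:
  fixes \<Phi> :: "complex ^ 'i \<Rightarrow> complex ^ 'i"
  assumes poly: "\<And>i. polyfun (\<lambda>z. \<Phi> z $ i)"
    and indep: "\<And>z s. \<Phi> (z + s *s axis i0 1) = \<Phi> z"
  shows "\<exists>f. polyfun f \<and> (\<exists>z. f z \<noteq> 0) \<and> (\<forall>z. f (\<Phi> z) = 0)"
proof -
  have "\<forall>i. \<exists>n. \<forall>z e. \<exists>P. degree P \<le> n \<and> (\<forall>s. \<Phi> (z + s *s e) $ i = poly P s)"
    using polyfun_line[OF poly] by blast
  then obtain deg where deg: "\<And>i z e. \<exists>P. degree P \<le> deg i \<and> (\<forall>s. \<Phi> (z + s *s e) $ i = poly P s)"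
    by metis
  define g where "g = Max (range deg)"
  have deg_le: "deg i \<le> g" for i by (simp add: g_def)
  define N where "N = CARD('i)"
  have N: "N \<ge> 1" by (simp add: N_def Suc_leI)
  \<comment> \<open>chosen so that \<open>(n + 1)\<^sup>N\<^sup>-\<^sup>1 \<le> (g N + 1)\<^sup>N\<^sup>-\<^sup>1 K\<^sup>N\<^sup>-\<^sup>1 < K\<^sup>N\<close> for the degree bound \<open>n = g N K\<close>\<close>
  define K where "K = (g * N + 1) ^ (N - 1) + 1"
  define n where "n = g * N * K"
  define S where "S = PiE (UNIV :: 'i set) (\<lambda>_. {..<K})"
  define B where "B = PiE (UNIV :: 'i set) (\<lambda>i. if i = i0 then {0} else {..n})"
  have finite: "finite S" "finite B" by (auto simp: S_def B_def intro!: finite_PiE)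
  have cardS: "card S = K ^ N" by (simp add: S_def card_PiE N_def)
  have "card B = (\<Prod>i\<in>UNIV. if i = i0 then 1 else n + 1)"
    unfolding B_def by (subst card_PiE) (auto intro!: prod.cong)
  also have "\<dots> = (\<Prod>i\<in>UNIV - {i0}. n + 1)"
    by (subst prod.remove[of _ i0]) auto
  also have "\<dots> = (n + 1) ^ (N - 1)"
    by (simp add: N_def card_Diff_singleton)
  finally have cardB: "card B = (n + 1) ^ (N - 1)" .
  have "n + 1 \<le> (g * N + 1) * K" by (simp add: n_def K_def)
  then have "card B \<le> ((g * N + 1) * K) ^ (N - 1)"
    unfolding cardB by (rule power_mono) simp
  also have "\<dots> = (g * N + 1) ^ (N - 1) * K ^ (N - 1)" by (rule power_mult_distrib)
  also have "\<dots> < K * K ^ (N - 1)"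
    by (rule mult_strict_right_mono) (auto simp: K_def)
  also have "\<dots> = card S" using N unfolding cardS by (metis Suc_diff_1 less_eq_Suc_le One_nat_def power_Suc)
  finally have card_less: "card B < card S" .
  define pt where "pt \<beta> = ((\<chi> i. of_nat (\<beta> i)) :: complex ^ 'i)" for \<beta> :: "'i \<Rightarrow> nat"
  define L where "L \<beta> z = (\<Prod>i\<in>UNIV. \<Prod>j\<in>{..<K} - {\<beta> i}. z $ i - of_nat j)"
    for \<beta> :: "'i \<Rightarrow> nat" and z :: "complex ^ 'i"
  have L_self: "L \<beta> (pt \<beta>) \<noteq> 0" for \<beta> by (auto simp: L_def pt_def)
  have L_other: "L \<beta>' (pt \<beta>) = 0" if ne: "\<beta> \<in> S" "\<beta>' \<noteq> \<beta>" for \<beta> \<beta>'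
  proof -
    obtain i where i: "\<beta>' i \<noteq> \<beta> i" using ne(2) by auto
    have "\<beta> i < K" using that(1) by (auto simp: S_def)
    then have "(\<Prod>j\<in>{..<K} - {\<beta>' i}. pt \<beta> $ i - of_nat j) = 0"
      using i by (auto simp: pt_def)
    then show ?thesis unfolding L_def by (intro prod_zero) auto
  qed
  obtain x where x: "\<exists>\<beta>\<in>S. x \<beta> \<noteq> 0" "\<forall>\<gamma>\<in>B. (\<Sum>\<beta>\<in>S. x \<beta> * L \<beta> (\<Phi> (pt \<gamma>))) = 0"
    using nontrivial_linear_relation[OF finite(2,1) card_less, of "\<lambda>\<beta> \<gamma>. L \<beta> (\<Phi> (pt \<gamma>))"] by blast
  define f where "f z = (\<Sum>\<beta>\<in>S. x \<beta> * L \<beta> z)" for z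
  have "polyfun f"
    unfolding f_def L_def by (intro polyfun_intros)
  moreover have "\<exists>z. f z \<noteq> 0"
  proof -
    obtain \<beta> where \<beta>: "\<beta> \<in> S" "x \<beta> \<noteq> 0" using x(1) by blast
    have "f (pt \<beta>) = x \<beta> * L \<beta> (pt \<beta>) + (\<Sum>\<beta>'\<in>S - {\<beta>}. x \<beta>' * L \<beta>' (pt \<beta>))"
      unfolding f_def by (rule sum.remove) (use finite \<beta> in auto)
    also have "(\<Sum>\<beta>'\<in>S - {\<beta>}. x \<beta>' * L \<beta>' (pt \<beta>)) = 0"
      by (intro sum.neutral) (use L_other \<beta> in auto)
    finally show ?thesis using \<beta> L_self[of \<beta>] by (intro exI[of _ "pt \<beta>"]) simp
  qed
  moreover have "f (\<Phi> z) = 0" for z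
  proof (rule polyfun_zero_if_zero_on_grid[where f = "\<lambda>z. f (\<Phi> z)" and n = n])
    fix z e
    have "\<forall>i. \<exists>P. degree P \<le> g \<and> (\<forall>s. \<Phi> (z + s *s e) $ i = poly P s)"
      using deg deg_le le_trans by metis
    then obtain P where P: "\<And>i. degree (P i) \<le> g" "\<And>i s. \<Phi> (z + s *s e) $ i = poly (P i) s"
      by metis
    define Q where "Q = (\<Sum>\<beta>\<in>S. smult (x \<beta>) (\<Prod>i\<in>UNIV. \<Prod>j\<in>{..<K} - {\<beta> i}. P i - [:of_nat j:]))"
    have inner: "degree (\<Prod>j\<in>{..<K} - {\<beta> i}. P i - [:of_nat j:]) \<le> K * g" for \<beta> i
    proof -
      have "degree (\<Prod>j\<in>{..<K} - {\<beta> i}. P i - [:of_nat j:])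
          \<le> (\<Sum>j\<in>{..<K} - {\<beta> i}. degree (P i - [:of_nat j:]))"
        using degree_prod_sum_le[of "{..<K} - {\<beta> i}" "\<lambda>j. P i - [:of_nat j:]"] by (simp add: o_def)
      also have "\<dots> \<le> (\<Sum>j\<in>{..<K} - {\<beta> i}. g)"
        by (intro sum_mono degree_diff_le P(1)) simp
      also have "\<dots> \<le> (\<Sum>j\<in>{..<K}. g)"
        by (intro sum_mono2) auto
      finally show ?thesis by simp
    qed
    have outer: "degree (\<Prod>i\<in>UNIV. \<Prod>j\<in>{..<K} - {\<beta> i}. P i - [:of_nat j:]) \<le> n" for \<beta>
    proof -
      have "degree (\<Prod>i\<in>UNIV. \<Prod>j\<in>{..<K} - {\<beta> i}. P i - [:of_nat j:])
          \<le> (\<Sum>i\<in>UNIV. degree (\<Prod>j\<in>{..<K} - {\<beta> i}. P i - [:of_nat j:]))"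
        using degree_prod_sum_le[of UNIV "\<lambda>i. \<Prod>j\<in>{..<K} - {\<beta> i}. P i - [:of_nat j:]"]
        by (simp add: o_def)
      also have "\<dots> \<le> (\<Sum>i\<in>(UNIV :: 'i set). K * g)" by (intro sum_mono inner)
      finally show ?thesis by (simp add: n_def N_def mult_ac)
    qed
    have "degree Q \<le> n"
      unfolding Q_def by (intro degree_sum_le finite order.trans[OF degree_smult_le outer])
    moreover have "f (\<Phi> (z + s *s e)) = poly Q s" for s
      by (simp add: f_def L_def Q_def poly_sum poly_prod P(2))
    ultimately show "\<exists>P. degree P \<le> n \<and> (\<forall>s. f (\<Phi> (z + s *s e)) = poly P s)" by blast
  next
    fix z :: "complex ^ 'i" assume z: "\<forall>i. z $ i \<in> of_nat ` {..n}"
    then have "\<forall>i. \<exists>k\<le>n. z $ i = of_nat k" by auto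
    then obtain k where k: "\<And>i. k i \<le> n" "\<And>i. z $ i = of_nat (k i)" by metis
    define \<gamma> where "\<gamma> i = (if i = i0 then 0 else k i)" for i
    have "\<gamma> \<in> B" using k(1) by (auto simp: B_def \<gamma>_def)
    moreover have "pt \<gamma> = z + (- (z $ i0)) *s axis i0 1"
      by (auto simp: pt_def \<gamma>_def vec_eq_iff k(2) axis_def)
    then have "\<Phi> (pt \<gamma>) = \<Phi> z" by (simp only: indep)
    ultimately show "f (\<Phi> z) = 0" using x(2) unfolding f_def by metis
  qed
  ultimately show ?thesis by blast
qed

text \<open>
The homogeneous components of a polynomial and its coefficients as a polynomial in one linear
coordinate are instances of the same statement: the coordinates split into pieces of degree \<open>0\<close> and
\<open>1\<close>, and the pieces multiply by degree.
\<close>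


section \<open>Expansion and division along a direction\<close>

lemma graded_decomposition:
  fixes G :: "nat \<Rightarrow> (complex ^ 'i \<Rightarrow> complex) set"
  assumes f: "polyfun f"
    and add: "\<And>k p q. p \<in> G k \<Longrightarrow> q \<in> G k \<Longrightarrow> (\<lambda>z. p z + q z) \<in> G k"
    and mult: "\<And>j k p q. p \<in> G j \<Longrightarrow> q \<in> G k \<Longrightarrow> (\<lambda>z. p z * q z) \<in> G (j + k)"
    and const: "\<And>c. (\<lambda>z. c) \<in> G 0" and zero: "\<And>k. (\<lambda>z. 0) \<in> G k"
    and coord: "\<And>i. \<exists>a\<in>G 0. \<exists>b\<in>G 1. \<forall>z. z $ i = a z + b z"
  shows "\<exists>n g. (\<forall>k. g k \<in> G k) \<and> (\<forall>k>n. g k = (\<lambda>z. 0)) \<and> (\<forall>z. f z = (\<Sum>k\<le>n. g k z))"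
  using f
proof induction
  case (coord i)
  obtain a b where ab: "a \<in> G 0" "b \<in> G 1" "\<And>z. z $ i = a z + b z" using assms(6) by blast
  show ?case
    by (rule exI[of _ 1], rule exI[of _ "\<lambda>k. if k = 0 then a else if k = 1 then b else (\<lambda>z. 0)"])
       (use ab zero in auto)
next
  case (const c)
  show ?case
    by (rule exI[of _ 0], rule exI[of _ "\<lambda>k. if k = 0 then (\<lambda>z. c) else (\<lambda>z. 0)"])
       (use assms(4) zero in auto)
next
  case (add p q)
  then obtain m n a b where a: "\<And>k. a k \<in> G k" "\<And>k. k > m \<Longrightarrow> a k = (\<lambda>z. 0)" "\<And>z. p z = (\<Sum>k\<le>m. a k z)"
    and b: "\<And>k. b k \<in> G k" "\<And>k. k > n \<Longrightarrow> b k = (\<lambda>z. 0)" "\<And>z. q z = (\<Sum>k\<le>n. b k z)"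
    by metis
  have "(\<Sum>k\<le>m. a k z) = (\<Sum>k\<le>max m n. a k z)" "(\<Sum>k\<le>n. b k z) = (\<Sum>k\<le>max m n. b k z)" for z
    by (rule sum.mono_neutral_left; use a(2) b(2) in auto)+
  then show ?case
    by (intro exI[of _ "max m n"] exI[of _ "\<lambda>k z. a k z + b k z"])
       (use a b assms(2) in \<open>auto simp: sum.distrib\<close>)
next
  case (mult p q)
  then obtain m n a b where a: "\<And>k. a k \<in> G k" "\<And>k. k > m \<Longrightarrow> a k = (\<lambda>z. 0)" "\<And>z. p z = (\<Sum>k\<le>m. a k z)"
    and b: "\<And>k. b k \<in> G k" "\<And>k. k > n \<Longrightarrow> b k = (\<lambda>z. 0)" "\<And>z. q z = (\<Sum>k\<le>n. b k z)"
    by metis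
  define g where "g k z = (\<Sum>j\<le>k. a j z * b (k - j) z)" for k z
  have sumG: "(\<lambda>z. \<Sum>j\<in>J. h j z) \<in> G k" if "finite J" "\<And>j. j \<in> J \<Longrightarrow> h j \<in> G k" for J :: "nat set" and h k
    using that by induction (use zero assms(2) in auto)
  have "g k \<in> G k" for k
    unfolding g_def
  proof (rule sumG)
    fix j assume "j \<in> {..k}"
    then show "(\<lambda>z. a j z * b (k - j) z) \<in> G k"
      using assms(3)[OF a(1)[of j] b(1)[of "k - j"]] by simp
  qed simp
  moreover have "g k = (\<lambda>z. 0)" if "k > m + n" for k
  proof -
    have "a j z * b (k - j) z = 0" for j z
    proof (cases "j > m")
      case False
      then have "k - j > n" using that by linarith
      then show ?thesis using b(2) by simp
    qed (use a(2) in simp)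
    then show ?thesis unfolding g_def[abs_def] by (simp only: sum.neutral_const)
  qed
  moreover have "p z * q z = (\<Sum>k\<le>m + n. g k z)" for z
    using polynomial_product[of m "\<lambda>k. a k z" n "\<lambda>k. b k z" 1] a(2) b(2) by (simp add: a(3) b(3) g_def)
  ultimately show ?case by blast
qed

definition homogeneous :: "nat \<Rightarrow> (complex ^ 'i \<Rightarrow> complex) \<Rightarrow> bool" where
  "homogeneous k h \<longleftrightarrow> polyfun h \<and> (\<forall>c z. h (c *s z) = c ^ k * h z)"

lemma homogeneous_decomposition:
  fixes f :: "complex ^ 'i \<Rightarrow> complex"
  assumes "polyfun f"
  shows "\<exists>n h. (\<forall>k. homogeneous k (h k)) \<and> (\<forall>z. f z = (\<Sum>k\<le>n. h k z))"
proof -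
  have "\<exists>n h. (\<forall>k. h k \<in> Collect (homogeneous k)) \<and> (\<forall>k>n. h k = (\<lambda>z. 0)) \<and> (\<forall>z. f z = (\<Sum>k\<le>n. h k z))"
  proof (rule graded_decomposition[OF assms])
    fix i :: 'i
    show "\<exists>a\<in>Collect (homogeneous 0). \<exists>b\<in>Collect (homogeneous 1). \<forall>z. z $ i = a z + b z"
      by (rule bexI[of _ "\<lambda>z. 0"], rule bexI[of _ "\<lambda>z. z $ i"])
         (auto simp: homogeneous_def intro: polyfun_intros)
  qed (auto simp: homogeneous_def algebra_simps power_add intro: polyfun_intros)
  then show ?thesis by auto
qed

definition invariant_along :: "complex ^ 'i \<Rightarrow> (complex ^ 'i \<Rightarrow> complex) \<Rightarrow> bool" where
  "invariant_along e g \<longleftrightarrow> polyfun g \<and> (\<forall>z s. g (z + s *s e) = g z)"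

text \<open>
Every vector is \<open>height z \<cdot> e\<close> plus a vector that depends only on the class of \<open>z\<close> modulo \<open>e\<close>. A polynomial
thus becomes a polynomial in \<open>height\<close>, with coefficients that are constant along \<open>e\<close>.
\<close>

locale direction =
  fixes e :: "complex ^ 'i" and i0 :: 'i
  assumes e0: "e $ i0 \<noteq> 0"
begin

definition height :: "complex ^ 'i \<Rightarrow> complex" where
  "height z = z $ i0 / e $ i0"

lemma height_translate [simp]: "height (z + s *s e) = height z + s"
  using e0 by (simp add: height_def field_simps)

lemma polyfun_height: "polyfun height"
  unfolding height_def divide_inverse by (intro polyfun_intros)

lemma height_scale: "height (c *s z) = c * height z"
  by (simp add: height_def)

abbreviation series_le :: "nat \<Rightarrow> (nat \<Rightarrow> complex ^ 'i \<Rightarrow> complex) \<Rightarrow> complex ^ 'i \<Rightarrow> complex" where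
  "series_le n g z \<equiv> \<Sum>k\<le>n. g k z * height z ^ k"

abbreviation series_lt :: "nat \<Rightarrow> (nat \<Rightarrow> complex ^ 'i \<Rightarrow> complex) \<Rightarrow> complex ^ 'i \<Rightarrow> complex" where
  "series_lt n g z \<equiv> \<Sum>k<n. g k z * height z ^ k"

lemma expansion:
  assumes "polyfun f"
  shows "\<exists>n g. (\<forall>k. invariant_along e (g k)) \<and> (\<forall>z. f z = series_le n g z)"
proof -
  define G where "G k = {f. \<exists>g. invariant_along e g \<and> f = (\<lambda>z. g z * height z ^ k)}" for k
  have "\<exists>n g. (\<forall>k. g k \<in> G k) \<and> (\<forall>k>n. g k = (\<lambda>z. 0)) \<and> (\<forall>z. f z = (\<Sum>k\<le>n. g k z))"
  proof (rule graded_decomposition[OF assms])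
    fix k p q assume "p \<in> G k" "q \<in> G k"
    then obtain a b where "invariant_along e a" "p = (\<lambda>z. a z * height z ^ k)"
      "invariant_along e b" "q = (\<lambda>z. b z * height z ^ k)" by (auto simp: G_def)
    then show "(\<lambda>z. p z + q z) \<in> G k"
      unfolding G_def by (intro CollectI exI[of _ "\<lambda>z. a z + b z"])
        (auto simp: invariant_along_def algebra_simps intro: polyfun_intros)
  next
    fix j k p q assume "p \<in> G j" "q \<in> G k"
    then obtain a b where "invariant_along e a" "p = (\<lambda>z. a z * height z ^ j)"
      "invariant_along e b" "q = (\<lambda>z. b z * height z ^ k)" by (auto simp: G_def)
    then show "(\<lambda>z. p z * q z) \<in> G (j + k)"
      unfolding G_def by (intro CollectI exI[of _ "\<lambda>z. a z * b z"])
        (auto simp: invariant_along_def algebra_simps power_add intro: polyfun_intros)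
  next
    fix c show "(\<lambda>z. c) \<in> G 0"
      unfolding G_def by (intro CollectI exI[of _ "\<lambda>z. c"]) (auto simp: invariant_along_def intro: polyfun_intros)
  next
    fix k show "(\<lambda>z. 0) \<in> G k"
      unfolding G_def by (intro CollectI exI[of _ "\<lambda>z. 0"]) (auto simp: invariant_along_def intro: polyfun_intros)
  next
    fix i
    have "(\<lambda>z. z $ i - height z * e $ i) \<in> G 0"
      unfolding G_def
      by (intro CollectI exI[of _ "\<lambda>z. z $ i - height z * e $ i"])
         (auto simp: invariant_along_def algebra_simps intro!: polyfun_intros polyfun_height)
    moreover have "(\<lambda>z. e $ i * height z) \<in> G 1"
      unfolding G_def by (intro CollectI exI[of _ "\<lambda>z. e $ i"]) (auto simp: invariant_along_def intro: polyfun_intros)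
    ultimately show "\<exists>a\<in>G 0. \<exists>b\<in>G 1. \<forall>z. z $ i = a z + b z"
      by (intro bexI[of _ "\<lambda>z. z $ i - height z * e $ i"] bexI[of _ "\<lambda>z. e $ i * height z"]) auto
  qed
  then obtain n g where g: "\<And>k. g k \<in> G k" "\<And>z. f z = (\<Sum>k\<le>n. g k z)" by blast
  have "\<forall>k. \<exists>h. invariant_along e h \<and> g k = (\<lambda>z. h z * height z ^ k)" using g(1) by (auto simp: G_def)
  then obtain h where "\<And>k. invariant_along e (h k)" "\<And>k. g k = (\<lambda>z. h k z * height z ^ k)" by metis
  then show ?thesis using g(2) by (intro exI[of _ n] exI[of _ h]) simp
qed

lemma expansion_unique:
  assumes "\<And>k. invariant_along e (g k)" "\<And>z. series_le n g z = 0" "k \<le> n"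
  shows "g k z = 0"
proof -
  have "(\<Sum>k\<le>n. g k z * t ^ k) = 0" for t
  proof -
    have "g k (z + (t - height z) *s e) = g k z" for k
      using assms(1) unfolding invariant_along_def by blast
    then show ?thesis
      using assms(2)[of "z + (t - height z) *s e"] unfolding height_translate by simp
  qed
  then show ?thesis
    using assms(3) polyfun_eq_0[of "\<lambda>k. g k z" n] by blast
qed

text \<open>
In an expansion of a homogeneous polynomial of degree \<open>d\<close> the \<open>k\<close>-th coefficient is homogeneous of degree
\<open>d - k\<close>. So it vanishes for \<open>k > d\<close>, and the \<open>d\<close>-th one is constant; its value is read off at \<open>e\<close>,
where the coefficients of positive degree vanish.
\<close>

lemma homogeneous_expansion:
  assumes h: "homogeneous d h"
  shows "\<exists>g. (\<forall>k. invariant_along e (g k)) \<and> (\<forall>z. h z = series_le d g z) \<and> (\<forall>z. g d z = h e)"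
proof -
  obtain n g where g: "\<And>k. invariant_along e (g k)" "\<And>z. h z = series_le n g z"
    using expansion h unfolding homogeneous_def by blast
  define n' where "n' = max n d"
  define g' where "g' k = (if k \<le> n then g k else (\<lambda>z. 0))" for k
  have g': "invariant_along e (g' k)" for k
    using g(1) by (auto simp: g'_def invariant_along_def intro: polyfun_intros)
  have h': "h z = series_le n' g' z" for z
    unfolding g(2) n'_def g'_def by (rule sum.mono_neutral_cong_left) auto
  have scale: "c ^ k * g' k (c *s z) = c ^ d * g' k z" if "k \<le> n'" for c z k
  proof -
    have "(\<lambda>z. c ^ k * g' k (c *s z) - c ^ d * g' k z) z = 0"
    proof (rule expansion_unique[of "\<lambda>k z. c ^ k * g' k (c *s z) - c ^ d * g' k z" n' k])
      fix k
      have "polyfun (\<lambda>z. g' k (c *s z))"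
        by (rule polyfun_compose) (use g' in \<open>auto simp: invariant_along_def intro: polyfun_intros\<close>)
      moreover have "c *s (z + s *s e) = c *s z + (c * s) *s e" for z s
        by (simp add: vec_eq_iff algebra_simps)
      ultimately show "invariant_along e (\<lambda>z. c ^ k * g' k (c *s z) - c ^ d * g' k z)"
        using g'[of k] by (auto simp: invariant_along_def intro!: polyfun_intros)
    next
      fix z
      have "(\<Sum>k\<le>n'. (c ^ k * g' k (c *s z) - c ^ d * g' k z) * height z ^ k)
          = h (c *s z) - c ^ d * h z"
        by (simp add: h' height_scale sum_distrib_left sum_subtractf algebra_simps power_mult_distrib)
      also have "\<dots> = 0" using h by (simp add: homogeneous_def)
      finally show "(\<Sum>k\<le>n'. (c ^ k * g' k (c *s z) - c ^ d * g' k z) * height z ^ k) = 0" .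
    qed (use that in auto)
    then show ?thesis by simp
  qed
  have high: "g' k z = 0" if "k > d" for k z
  proof (cases "k \<le> n'")
    case True
    obtain P where P: "\<And>c. g' k (0 + c *s z) = poly P c"
      using polyfun_lineE g' unfolding invariant_along_def by blast
    have "poly (monom 1 k * P - monom (g' k z) d) c = 0" for c
      using scale[OF True, of c z] P[of c] by (simp add: poly_monom mult.commute)
    then have eq: "monom 1 k * P = monom (g' k z) d"
      using poly_all_0_iff_0 by (metis eq_iff_diff_eq_0)
    have "coeff (monom 1 k * P) d = 0" using that by (simp add: coeff_monom_mult)
    then show ?thesis unfolding eq by simp
  qed (auto simp: g'_def n'_def)
  have low: "g' k 0 = 0" if "k < d" for k
  proof -
    have "norm ((2::complex) ^ k) \<noteq> norm ((2::complex) ^ d)"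
      using that unfolding norm_power by simp
    then have "(2::complex) ^ k \<noteq> 2 ^ d" by auto
    moreover have "k \<le> n'" using that by (simp add: n'_def)
    ultimately show ?thesis using scale[of k 2 0] by simp
  qed
  have hd: "h z = series_le d g' z" for z
    unfolding h' by (rule sum.mono_neutral_right) (use high in \<open>auto simp: n'_def\<close>)
  have top: "g' d z = h e" for z
  proof -
    obtain P where P: "\<And>c. g' d (0 + c *s z) = poly P c"
      using polyfun_lineE g' unfolding invariant_along_def by blast
    have "poly (monom 1 d * (P - [:g' d z:])) c = 0" for c
      using scale[of d c z] P[of c] by (simp add: poly_monom algebra_simps n'_def)
    then have "monom 1 d * (P - [:g' d z:]) = 0" using poly_all_0_iff_0 by blast
    then have "P = [:g' d z:]" by simp
    then have "g' d z = g' d 0" using P[of 0] by simp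
    moreover have "g' k e = g' k 0" for k
      using g'[of k] unfolding invariant_along_def by (metis add_0 vector_smult_lid)
    moreover have "height e = 1" using e0 by (simp add: height_def)
    ultimately show ?thesis
      using low unfolding hd by (simp flip: lessThan_Suc_atMost)
  qed
  show ?thesis using g' hd top by blast
qed

text \<open>
Division with remainder by a polynomial in \<open>height\<close> with leading coefficient \<open>r d\<close>, which is not
inverted but multiplied into the dividend.
\<close>

lemma pseudo_division:
  assumes r: "\<And>k. invariant_along e (r k)" and g: "\<And>k. invariant_along e (g k)"
  shows "\<exists>j a h. polyfun a \<and> (\<forall>k. invariant_along e (h k)) \<and>
    (\<forall>z. r d z ^ j * series_lt n g z =
       a z * series_le d r z + series_lt d h z)"
  using g
proof (induction n arbitrary: g)
  case 0
  show ?case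
    by (rule exI[of _ 0], rule exI[of _ "\<lambda>z. 0"], rule exI[of _ "\<lambda>k z. 0"])
       (auto simp: invariant_along_def intro: polyfun_intros)
next
  case (Suc n)
  show ?case
  proof (cases "n < d")
    case True
    define h where "h k = (if k < Suc n then g k else (\<lambda>z. 0))" for k
    have "series_lt (Suc n) g z = series_lt d h z" for z
      by (rule sum.mono_neutral_cong_left) (use True in \<open>auto simp: h_def\<close>)
    moreover have "invariant_along e (h k)" for k
      using Suc.prems by (auto simp: h_def invariant_along_def intro: polyfun_intros)
    ultimately show ?thesis
      by (intro exI[of _ 0] exI[of _ "\<lambda>z. 0"] exI[of _ h]) (auto intro: polyfun_intros)
  next
    case False
    define r' where "r' k = (if k \<ge> n - d then r (k - (n - d)) else (\<lambda>z. 0))" for k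
    define g' where "g' k z = r d z * g k z - g n z * r' k z" for k z
    have "invariant_along e (r' k)" for k
      using r by (auto simp: r'_def invariant_along_def intro: polyfun_intros)
    then have g': "invariant_along e (g' k)" for k
      using Suc.prems r by (auto simp: g'_def[abs_def] invariant_along_def intro!: polyfun_intros)
    have shift: "height z ^ (n - d) * series_le d r z = series_lt (Suc n) r' z" for z
    proof -
      have "series_lt (Suc n) r' z = (\<Sum>k\<in>{0 + (n - d)..d + (n - d)}. r' k z * height z ^ k)"
        by (rule sum.mono_neutral_right) (use False in \<open>auto simp: r'_def\<close>)
      also have "\<dots> = (\<Sum>k\<in>{0..d}. r' (k + (n - d)) z * height z ^ (k + (n - d)))"
        by (rule sum.shift_bounds_cl_nat_ivl)
      finally show ?thesis
        by (simp add: r'_def power_add sum_distrib_left atMost_atLeast0 mult_ac)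
    qed
    have step: "r d z * series_lt (Suc n) g z
        = (g n z * height z ^ (n - d)) * series_le d r z + series_lt n g' z" for z
    proof -
      have "g' n z = 0" using False by (simp add: g'_def r'_def)
      then have "series_lt n g' z = series_lt (Suc n) g' z" by simp
      also have "\<dots> = r d z * series_lt (Suc n) g z - g n z * series_lt (Suc n) r' z"
        unfolding sum_distrib_left sum_subtractf[symmetric]
        by (rule sum.cong) (auto simp: g'_def algebra_simps)
      finally show ?thesis unfolding shift[symmetric] by (simp add: mult_ac)
    qed
    obtain j a h where IH: "polyfun a" "\<And>k. invariant_along e (h k)"
      "\<And>z. r d z ^ j * series_lt n g' z =
       a z * series_le d r z + series_lt d h z"
      using Suc.IH[of g'] g' by blast
    have "r d z ^ Suc j * series_lt (Suc n) g z =
        (a z + r d z ^ j * (g n z * height z ^ (n - d))) * series_le d r z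
         + series_lt d h z" for z
    proof -
      have "r d z ^ Suc j * series_lt (Suc n) g z = r d z ^ j * (r d z * series_lt (Suc n) g z)"
        by simp
      also have "\<dots> = r d z ^ j * ((g n z * height z ^ (n - d)) * series_le d r z)
            + r d z ^ j * series_lt n g' z"
        unfolding step by (rule distrib_left)
      finally show ?thesis unfolding IH(3) by (simp only: ring_distribs ac_simps)
    qed
    moreover have "polyfun (\<lambda>z. a z + r d z ^ j * (g n z * height z ^ (n - d)))"
      using Suc.prems r IH(1) by (auto simp: invariant_along_def intro!: polyfun_intros polyfun_height)
    ultimately show ?thesis using IH(2)
      by (intro exI[of _ "Suc j"] exI[of _ "\<lambda>z. a z + r d z ^ j * (g n z * height z ^ (n - d))"] exI[of _ h])
         blast
  qed
qed

end


section \<open>Divisibility from domination\<close>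

text \<open>
Domination passes to the zeros of \<open>C\<close> by continuity, so each root of \<open>C\<close> is a root of \<open>B\<close>, and the
common linear factor can be cancelled. The finite set \<open>F\<close> absorbs the points lost by cancelling.
\<close>

lemma poly_dvd_if_dominated:
  fixes B C :: "complex poly"
  assumes "C \<noteq> 0" "finite F" "\<And>R. \<exists>K. \<forall>s. norm s \<le> R \<and> s \<notin> F \<longrightarrow> norm (poly B s) \<le> K * norm (poly C s)"
  shows "C dvd B"
  using assms
proof (induction "degree C" arbitrary: B C F)
  case 0
  then show ?case by (metis is_unit_iff_degree unit_imp_dvd)
next
  case (Suc n)
  have "\<exists>\<rho>. poly C \<rho> = 0"
    using Suc.hyps(2) fundamental_theorem_of_algebra[of C] constant_degree[of C] by auto
  then obtain \<rho> C' where C: "poly C \<rho> = 0" "C = [:-\<rho>, 1:] * C'"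
    by (metis dvdE poly_eq_0_iff_dvd)
  have "poly B \<rho> = 0"
  proof -
    obtain K where K: "\<And>s. norm s \<le> norm \<rho> + 1 \<Longrightarrow> s \<notin> F \<Longrightarrow> norm (poly B s) \<le> K * norm (poly C s)"
      using Suc.prems(3)[of "norm \<rho> + 1"] by blast
    have "eventually (\<lambda>s. s \<in> ball \<rho> 1 - (F - {\<rho>}) - {\<rho>}) (at \<rho>)"
    proof (rule eventually_at_in_open)
      show "open (ball \<rho> 1 - (F - {\<rho>}))"
        using Suc.prems(2) by (intro open_Diff finite_imp_closed) auto
    qed auto
    then have ev: "eventually (\<lambda>s. norm (poly B s) \<le> K * norm (poly C s)) (at \<rho>)"
    proof eventually_elim
      case (elim s)
      then have "norm (s - \<rho>) < 1" by (simp add: dist_norm norm_minus_commute)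
      then have "norm s \<le> norm \<rho> + 1" using norm_triangle_sub[of s \<rho>] by linarith
      then show ?case using elim K by blast
    qed
    have "((\<lambda>s. norm (poly B s)) \<longlongrightarrow> norm (poly B \<rho>)) (at \<rho>)"
      "((\<lambda>s. K * norm (poly C s)) \<longlongrightarrow> K * norm (poly C \<rho>)) (at \<rho>)"
      by (auto intro!: tendsto_intros)
    then have "norm (poly B \<rho>) \<le> K * norm (poly C \<rho>)"
      using ev by (intro tendsto_le[of "at \<rho>"]) auto
    then show ?thesis using C(1) by simp
  qed
  then obtain B' where B: "B = [:-\<rho>, 1:] * B'" by (metis dvdE poly_eq_0_iff_dvd)
  have C'0: "C' \<noteq> 0" using Suc.prems(1) C(2) by auto
  have deg: "n = degree C'"
  proof -
    have "degree C = degree [:-\<rho>, 1:] + degree C'"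
      unfolding C(2) by (rule degree_mult_eq) (use C'0 in auto)
    then show ?thesis using Suc.hyps(2) by simp
  qed
  have "\<exists>K. \<forall>s. norm s \<le> R \<and> s \<notin> insert \<rho> F \<longrightarrow> norm (poly B' s) \<le> K * norm (poly C' s)" for R
  proof -
    obtain K where K: "\<And>s. norm s \<le> R \<Longrightarrow> s \<notin> F \<Longrightarrow> norm (poly B s) \<le> K * norm (poly C s)"
      using Suc.prems(3)[of R] by blast
    have "norm (poly B' s) \<le> K * norm (poly C' s)" if "norm s \<le> R" "s \<notin> insert \<rho> F" for s
    proof -
      have pos: "norm (s - \<rho>) > 0" using that by auto
      have "norm (s - \<rho>) * norm (poly B' s) \<le> norm (s - \<rho>) * (K * norm (poly C' s))"
      proof -
        have "poly B s = (s - \<rho>) * poly B' s" "poly C s = (s - \<rho>) * poly C' s"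
          by (simp_all add: B C(2) algebra_simps)
        then show ?thesis using K[of s] that by (simp add: norm_mult mult_ac)
      qed
      then show ?thesis using pos by simp
    qed
    then show ?thesis by blast
  qed
  then have "C' dvd B'"
    using Suc.hyps(1)[OF deg C'0, of "insert \<rho> F"] Suc.prems(2) by blast
  then show ?case unfolding B C(2) by (intro mult_dvd_mono) auto
qed

text \<open>
Each linear factor \<open>s - \<rho>\<close> multiplies the size of the coefficients by at most \<open>1 + \<bar>\<rho>\<bar>\<close>.
\<close>

lemma coeff_bound_from_roots:
  fixes P :: "complex poly"
  assumes "\<And>s. poly P s = 0 \<Longrightarrow> norm s \<le> R" "0 \<le> R"
  shows "norm (coeff P k) \<le> norm (lead_coeff P) * (1 + R) ^ degree P"
  using assms
proof (induction "degree P" arbitrary: P k)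
  case 0
  then obtain c where "P = [:c:]" by (metis degree_eq_zeroE)
  then show ?case by (cases k) auto
next
  case (Suc n)
  have "\<exists>\<rho>. poly P \<rho> = 0"
    using Suc.hyps(2) fundamental_theorem_of_algebra[of P] constant_degree[of P] by auto
  then obtain \<rho> P' where P: "poly P \<rho> = 0" "P = [:-\<rho>, 1:] * P'"
    by (metis dvdE poly_eq_0_iff_dvd)
  have P0: "P' \<noteq> 0" using P(2) Suc.hyps(2) by auto
  have deg: "degree P = Suc (degree P')"
    unfolding P(2) by (subst degree_mult_eq) (use P0 in auto)
  have lead: "lead_coeff P = lead_coeff P'"
    unfolding P(2) lead_coeff_mult by simp
  have IH: "norm (coeff P' j) \<le> norm (lead_coeff P') * (1 + R) ^ degree P'" for j
    by (rule Suc.hyps(1)) (use Suc.hyps(2) deg Suc.prems P(2) in auto)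
  define E where "E = norm (lead_coeff P') * (1 + R) ^ degree P'"
  have E: "0 \<le> E" using Suc.prems(2) by (simp add: E_def)
  have \<rho>: "norm \<rho> \<le> R" using Suc.prems(1) P(1) by blast
  have "coeff P k = (case k of 0 \<Rightarrow> 0 | Suc j \<Rightarrow> coeff P' j) - \<rho> * coeff P' k"
    unfolding P(2) by (simp add: coeff_pCons split: nat.split)
  then have "norm (coeff P k) \<le> norm (case k of 0 \<Rightarrow> 0 | Suc j \<Rightarrow> coeff P' j) + norm (\<rho> * coeff P' k)"
    using norm_triangle_ineq4 by metis
  also have "norm (case k of 0 \<Rightarrow> 0 | Suc j \<Rightarrow> coeff P' j) \<le> E"
    using IH E by (auto simp: E_def split: nat.split)
  also have "norm (\<rho> * coeff P' k) \<le> R * E"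
    unfolding norm_mult using IH[of k] \<rho> E_def by (intro mult_mono) (auto simp: Suc.prems(2))
  finally show ?case unfolding lead unfolding deg by (simp add: E_def algebra_simps)
qed

text \<open>
A polynomial has a constant leading coefficient in any direction in which its homogeneous component of
highest degree does not vanish.
\<close>

lemma exists_monic_direction:
  fixes c :: "complex ^ 'i \<Rightarrow> complex"
  assumes c: "polyfun c" and nz: "\<exists>z. c z \<noteq> 0"
  shows "\<exists>e i0 d g \<gamma>. direction e i0 \<and> (\<forall>k. invariant_along e (g k)) \<and> \<gamma> \<noteq> 0 \<and> (\<forall>z. g d z = \<gamma>) \<and>
           (\<forall>z. c z = (\<Sum>k\<le>d. g k z * direction.height e i0 z ^ k))"
proof -
  obtain n h where h: "\<And>k. homogeneous k (h k)" "\<And>z. c z = (\<Sum>k\<le>n. h k z)"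
    using homogeneous_decomposition[OF c] by blast
  define d where "d = Max {k. k \<le> n \<and> (\<exists>z. h k z \<noteq> 0)}"
  have "{k. k \<le> n \<and> (\<exists>z. h k z \<noteq> 0)} \<noteq> {}"
  proof
    assume "{k. k \<le> n \<and> (\<exists>z. h k z \<noteq> 0)} = {}"
    then have "c z = 0" for z unfolding h(2) by (intro sum.neutral) auto
    then show False using nz by blast
  qed
  then have "d \<in> {k. k \<le> n \<and> (\<exists>z. h k z \<noteq> 0)}"
    unfolding d_def by (intro Max_in) auto
  then obtain e where d: "d \<le> n" and e: "h d e \<noteq> 0" by blast
  have above: "h k z = 0" if "d < k" "k \<le> n" for k z
    using that Max_ge[of "{k. k \<le> n \<and> (\<exists>z. h k z \<noteq> 0)}" k] by (fastforce simp: d_def)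
  have cd: "c z = (\<Sum>k\<le>d. h k z)" for z
    unfolding h(2) by (rule sum.mono_neutral_right) (use d above in auto)
  obtain e' where e': "h d e' \<noteq> 0" "e' \<noteq> 0"
  proof (cases "e = 0")
    case True
    have "h d (0 *s axis undefined 1) = 0 ^ d * h d (axis undefined 1)"
      using h(1)[of d] unfolding homogeneous_def by blast
    then have "h d (axis undefined 1) \<noteq> 0" using e True by (cases d) auto
    then show ?thesis using that by (metis axis_eq_0_iff one_neq_zero)
  qed (use e that in blast)
  then obtain i0 where i0: "e' $ i0 \<noteq> 0" by (metis vec_eq_iff zero_index)
  interpret direction e' i0 by standard (rule i0)
  have "\<forall>k. \<exists>g. (\<forall>j. invariant_along e' (g j)) \<and> (\<forall>z. h k z = (\<Sum>j\<le>k. g j z * height z ^ j)) \<and> (\<forall>z. g k z = h k e')"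
    using homogeneous_expansion[OF h(1)] by blast
  then obtain G where G: "\<And>k j. invariant_along e' (G k j)" "\<And>k z. h k z = (\<Sum>j\<le>k. G k j z * height z ^ j)"
    "\<And>k z. G k k z = h k e'" by metis
  define g where "g j z = (\<Sum>k\<in>{j..d}. G k j z)" for j z
  have "c z = (\<Sum>j\<le>d. g j z * height z ^ j)" for z
  proof -
    have "c z = (\<Sum>k\<le>d. \<Sum>j\<le>k. G k j z * height z ^ j)" unfolding cd G(2) ..
    also have "\<dots> = (\<Sum>k\<in>{..d}. \<Sum>j\<in>{j \<in> {..d}. j \<le> k}. G k j z * height z ^ j)"
      by (intro sum.cong) auto
    also have "\<dots> = (\<Sum>j\<in>{..d}. \<Sum>k\<in>{k \<in> {..d}. j \<le> k}. G k j z * height z ^ j)"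
      by (rule sum.swap_restrict) auto
    also have "\<dots> = (\<Sum>j\<le>d. g j z * height z ^ j)"
      unfolding g_def sum_distrib_right by (intro sum.cong) auto
    finally show ?thesis .
  qed
  moreover have "invariant_along e' (g j)" for j
    using G(1) by (auto simp: g_def[abs_def] invariant_along_def intro!: polyfun_intros)
  moreover have "g d z = h d e'" for z by (simp add: g_def G(3))
  ultimately show ?thesis using e'(1) direction_axioms
    by (intro exI[of _ e'] exI[of _ i0] exI[of _ d] exI[of _ g] exI[of _ "h d e'"]) blast
qed

text \<open>
Divide \<open>a\<close> by \<open>c\<close> in a direction in which \<open>c\<close> is monic. On each line of this direction the remainder is
still dominated by \<open>c\<close>, hence divisible by it, and its degree is too small unless it is zero. This
replaces the fact that polynomial rings are integrally closed.
\<close>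

lemma polyfun_dvd_if_dominated:
  fixes a c :: "complex ^ 'i \<Rightarrow> complex"
  assumes a: "polyfun a" and c: "polyfun c" "\<exists>z. c z \<noteq> 0"
    and dom: "\<And>R. \<exists>K. \<forall>z. norm z \<le> R \<and> c z \<noteq> 0 \<longrightarrow> norm (a z) \<le> K * norm (c z)"
  shows "\<exists>q. polyfun q \<and> (\<forall>z. a z = q z * c z)"
proof -
  obtain e i0 d g \<gamma> where dir: "direction e i0" and g: "\<And>k. invariant_along e (g k)" and \<gamma>: "\<gamma> \<noteq> 0"
    and gd: "\<And>z. g d z = \<gamma>" and cg: "\<And>z. c z = (\<Sum>k\<le>d. g k z * direction.height e i0 z ^ k)"
    using exists_monic_direction[OF c] by blast
  interpret direction e i0 by (rule dir)
  obtain n f where f: "\<And>k. invariant_along e (f k)" "\<And>z. a z = series_le n f z"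
    using expansion[OF a] by blast
  obtain j q b where q: "polyfun q" and b: "\<And>k. invariant_along e (b k)"
    and div: "\<And>z. g d z ^ j * series_lt (Suc n) f z =
       q z * series_le d g z + series_lt d b z"
    using pseudo_division[of g f d "Suc n"] g f(1) by blast
  have div': "\<gamma> ^ j * a z = q z * c z + series_lt d b z" for z
    using div[of z] unfolding gd cg[symmetric] lessThan_Suc_atMost f(2)[symmetric] .
  have "series_lt d b z = 0" for z
  proof -
    define w where "w s = z + (s - height z) *s e" for s
    have hw: "height (w s) = s" for s unfolding w_def height_translate by simp
    have inv: "h (w s) = h z" if "invariant_along e h" for h s
      using that unfolding w_def invariant_along_def by blast
    define C where "C = (\<Sum>k\<le>d. monom (g k z) k)"
    define B where "B = (\<Sum>k<d. monom (b k z) k)"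
    have C: "poly C s = c (w s)" for s
      unfolding C_def cg by (simp add: poly_sum poly_monom hw inv g)
    have B: "poly B s = (\<Sum>k<d. b k (w s) * height (w s) ^ k)" for s
      unfolding B_def by (simp add: poly_sum poly_monom hw inv b)
    have coeff_C: "coeff C d = \<gamma>"
      unfolding C_def coeff_sum by (simp add: gd)
    then have C0: "C \<noteq> 0" using \<gamma> by auto
    have degC: "d \<le> degree C" using coeff_C \<gamma> by (simp add: le_degree)
    have "C dvd B"
    proof (rule poly_dvd_if_dominated[OF C0, of "{s. poly C s = 0}"])
      show "finite {s. poly C s = 0}" using C0 by (rule poly_roots_finite)
      fix R
      obtain Q where Q: "\<And>s. q ((z - height z *s e) + s *s e) = poly Q s"
        using polyfun_lineE[OF q] by blast
      have w_eq: "w s = (z - height z *s e) + s *s e" for s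
        by (simp add: w_def vec_eq_iff algebra_simps)
      obtain M where M: "\<And>s. norm s \<le> R \<Longrightarrow> norm (q (w s)) \<le> M"
      proof -
        have "compact ((poly Q) ` cball 0 R)"
          by (intro compact_continuous_image continuous_intros) auto
        then obtain M where "\<And>s. norm s \<le> R \<Longrightarrow> norm (poly Q s) \<le> M"
          using compact_imp_bounded bounded_iff by (metis dist_0_norm imageI mem_cball)
        then have "norm (q (w s)) \<le> M" if "norm s \<le> R" for s
          using that unfolding w_eq Q by blast
        then show ?thesis by (rule that)
      qed
      define R' where "R' = norm (z - height z *s e) + R * norm e"
      obtain K where K: "\<And>z. norm z \<le> R' \<Longrightarrow> c z \<noteq> 0 \<Longrightarrow> norm (a z) \<le> K * norm (c z)"
        using dom by blast
      have "norm (poly B s) \<le> (norm (\<gamma> ^ j) * K + M) * norm (poly C s)"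
        if s: "norm s \<le> R" "s \<notin> {s. poly C s = 0}" for s
      proof -
        have "norm (s *s e) = norm s * norm e"
          by (simp add: norm_vec_def L2_set_def norm_mult power_mult_distrib real_sqrt_mult flip: sum_distrib_left)
        also have "\<dots> \<le> R * norm e" using s(1) by (rule mult_right_mono) simp
        finally have "norm (w s) \<le> R'"
          unfolding w_eq R'_def using norm_triangle_ineq[of "z - height z *s e" "s *s e"] by linarith
        then have aK: "norm (a (w s)) \<le> K * norm (c (w s))" using K s(2) C by simp
        have "poly B s = \<gamma> ^ j * a (w s) - q (w s) * c (w s)"
          unfolding B using div'[of "w s"] by simp
        then have "norm (poly B s) \<le> norm (\<gamma> ^ j) * norm (a (w s)) + norm (q (w s)) * norm (c (w s))"
          using norm_triangle_ineq4[of "\<gamma> ^ j * a (w s)" "q (w s) * c (w s)"] by (simp add: norm_mult)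
        also have "\<dots> \<le> norm (\<gamma> ^ j) * (K * norm (c (w s))) + M * norm (c (w s))"
          using aK M[OF s(1)] by (intro add_mono mult_left_mono mult_right_mono) auto
        finally show ?thesis unfolding C by (simp add: algebra_simps)
      qed
      then show "\<exists>K. \<forall>s. norm s \<le> R \<and> s \<notin> {s. poly C s = 0} \<longrightarrow> norm (poly B s) \<le> K * norm (poly C s)"
        by blast
    qed
    have "B = 0"
    proof (cases "d = 0")
      case False
      have "degree B \<le> d - 1"
        unfolding B_def by (intro degree_sum_le) (auto intro: order.trans[OF degree_monom_le])
      then show ?thesis using \<open>C dvd B\<close> degC False dvd_imp_degree_le[of C B] by linarith
    qed (simp add: B_def)
    then have "poly B (height z) = 0" by simp
    then show ?thesis unfolding B by (simp add: w_def)
  qed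
  then have "a z = (inverse (\<gamma> ^ j) * q z) * c z" for z
    using div'[of z] \<gamma> by (simp add: field_simps)
  then show ?thesis using q by (intro exI[of _ "\<lambda>z. inverse (\<gamma> ^ j) * q z"]) (auto intro: polyfun_intros)
qed


section \<open>Irreducible sets with a prime equation\<close>

context direction
begin

text \<open>
Among the equations of \<open>X\<close>, one of least degree \<open>d\<close> in \<open>height\<close> divides all others up to a power of its
leading coefficient, since the remainder is an equation of lower degree. The degree \<open>d\<close> is positive
because no nonzero polynomial that is constant along \<open>e\<close> vanishes on \<open>X\<close>.
\<close>

lemma minimal_relation:
  assumes noinv: "\<forall>g. invariant_along e g \<and> (\<forall>z\<in>X. g z = 0) \<longrightarrow> (\<forall>z. g z = 0)"
    and nz: "polyfun f0" "\<forall>z\<in>X. f0 z = 0" "\<exists>z. f0 z \<noteq> 0"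
  shows "\<exists>d r. d > 0 \<and> (\<forall>k. invariant_along e (r k)) \<and> (\<exists>z. r d z \<noteq> 0) \<and>
    (\<forall>z\<in>X. series_le d r z = 0) \<and>
    (\<forall>h. (\<forall>k. invariant_along e (h k)) \<and> (\<forall>z\<in>X. series_lt d h z = 0)
      \<longrightarrow> (\<forall>z. series_lt d h z = 0)) \<and>
    (\<forall>f. polyfun f \<and> (\<forall>z\<in>X. f z = 0)
      \<longrightarrow> (\<exists>j a. polyfun a \<and> (\<forall>z. r d z ^ j * f z = a z * series_le d r z)))"
proof -
  define rel where "rel n g \<longleftrightarrow> (\<forall>k. invariant_along e (g k)) \<and> (\<exists>z. g n z \<noteq> 0) \<and>
      (\<forall>z\<in>X. series_le n g z = 0)" for n and g :: "nat \<Rightarrow> complex ^ 'i \<Rightarrow> complex"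
  have top: "\<exists>m\<le>n. rel m g"
    if g: "\<forall>k. invariant_along e (g k)" "\<forall>z\<in>X. series_le n g z = 0"
      and ne: "\<exists>z. series_le n g z \<noteq> 0" for g n
    using g(2) ne
  proof (induction n)
    case 0
    then have "rel 0 g" using g(1) by (auto simp: rel_def)
    then show ?case by blast
  next
    case (Suc n)
    show ?case
    proof (cases "\<exists>z. g (Suc n) z \<noteq> 0")
      case True
      then have "rel (Suc n) g" using g(1) Suc.prems unfolding rel_def by blast
      then show ?thesis by blast
    next
      case False
      then obtain m where "m \<le> n" "rel m g" using Suc by auto
      then show ?thesis using le_SucI by blast
    qed
  qed
  obtain n g where g: "\<And>k. invariant_along e (g k)" "\<And>z. f0 z = series_le n g z"
    using expansion[OF nz(1)] by blast
  have "\<exists>m g. rel m g" using top[of g n] g(1) nz(2,3) unfolding g(2) by blast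
  define d where "d = (LEAST m. \<exists>g. rel m g)"
  obtain r where r: "rel d r"
    using LeastI_ex[OF \<open>\<exists>m g. rel m g\<close>] unfolding d_def by blast
  have least: "d \<le> m" if "rel m g" for m g
    unfolding d_def using that by (intro Least_le) blast
  have pos: "d > 0"
  proof (rule ccontr)
    assume "\<not> d > 0"
    then have "invariant_along e (r 0)" "\<forall>z\<in>X. r 0 z = 0" "\<exists>z. r 0 z \<noteq> 0"
      using r by (auto simp: rel_def)
    then show False using noinv by blast
  qed
  have low: "\<forall>z. series_lt d h z = 0"
    if h: "\<And>k. invariant_along e (h k)" "\<forall>z\<in>X. series_lt d h z = 0" for h
  proof (rule ccontr)
    have eq: "{..<d} = {..d - 1}" using pos by auto
    assume "\<not> ?thesis"
    then obtain m where "m \<le> d - 1" "rel m h" using top[of h "d - 1"] h unfolding eq by blast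
    then show False using least[of m h] pos by linarith
  qed
  have div: "\<exists>j a. polyfun a \<and> (\<forall>z. r d z ^ j * f z = a z * series_le d r z)"
    if f: "polyfun f" "\<forall>z\<in>X. f z = 0" for f
  proof -
    obtain n g where g: "\<And>k. invariant_along e (g k)" "\<And>z. f z = series_le n g z"
      using expansion[OF f(1)] by blast
    obtain j a h where a: "polyfun a" and h: "\<And>k. invariant_along e (h k)"
      and eq: "\<And>z. r d z ^ j * series_lt (Suc n) g z =
        a z * series_le d r z + series_lt d h z"
      using pseudo_division[of r g d "Suc n"] g(1) r unfolding rel_def by blast
    have eq': "r d z ^ j * f z = a z * series_le d r z + series_lt d h z" for z
      using eq[of z] unfolding lessThan_Suc_atMost g(2)[symmetric] .
    have "series_lt d h z = 0" if "z \<in> X" for z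
      using eq'[of z] f(2) r that by (simp add: rel_def)
    then have "\<forall>z. series_lt d h z = 0" using low[of h] h by blast
    then show ?thesis using a eq' by auto
  qed
  show ?thesis
    using pos r low div unfolding rel_def by blast
qed

text \<open>
In the application \<open>D\<close> is the set of singular forms and \<open>B\<close> the frontier of the cone. The bound on the
roots of \<open>p0\<close> makes the minimal equation of \<open>D\<close> divisible by its leading coefficient, which yields a
generator \<open>p\<close> of the ideal of \<open>D\<close>. The ideal of \<open>B\<close> may a priori be larger; that it is not follows by
comparing its own minimal equation with \<open>p\<close>.
\<close>

theorem irreducible_hypersurface_of_prime_set:
  assumes ne: "e \<noteq> 0"
    and prime: "\<And>f g. polyfun f \<Longrightarrow> polyfun g \<Longrightarrow> \<forall>z\<in>D. f z * g z = 0
      \<Longrightarrow> (\<forall>z\<in>D. f z = 0) \<or> (\<forall>z\<in>D. g z = 0)"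
    and p0: "polyfun p0" "\<forall>z\<in>D. p0 z = 0" "\<And>z s. p0 (z + s *s e) = 0 \<Longrightarrow> norm s \<le> M * norm z" "M \<ge> 0"
    and noinv: "\<And>g. invariant_along e g \<Longrightarrow> \<forall>z\<in>B. g z = 0 \<Longrightarrow> \<forall>z. g z = 0"
    and B: "\<And>f. polyfun f \<Longrightarrow> \<forall>z\<in>D. f z = 0 \<Longrightarrow> \<forall>z\<in>B. f z = 0"
  shows "\<exists>p. irreducible_polynomial_function p \<and> zariski_closure D = {z. p z = 0} \<and> zariski_closure B = {z. p z = 0}"
proof -
  have noinvD: "\<forall>z. g z = 0" if "invariant_along e g" "\<forall>z\<in>D. g z = 0" for g
    using noinv B that unfolding invariant_along_def by blast
  have p0_nz: "\<exists>z. p0 z \<noteq> 0"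
  proof -
    have "p0 (0 + 1 *s e) \<noteq> 0" using p0(3)[of 0 1] by auto
    then show ?thesis by blast
  qed
  have "\<forall>g. invariant_along e g \<and> (\<forall>z\<in>D. g z = 0) \<longrightarrow> (\<forall>z. g z = 0)" using noinvD by blast
  from minimal_relation[OF this p0(1,2) p0_nz]
  obtain d r where d: "d > 0" and r': "\<forall>k. invariant_along e (r k)" and r_top: "\<exists>z. r d z \<noteq> 0"
    and rD: "\<forall>z\<in>D. series_le d r z = 0"
    and low: "\<forall>h. (\<forall>k. invariant_along e (h k)) \<and> (\<forall>z\<in>D. series_lt d h z = 0)
      \<longrightarrow> (\<forall>z. series_lt d h z = 0)"
    and div: "\<forall>f. polyfun f \<and> (\<forall>z\<in>D. f z = 0)
      \<longrightarrow> (\<exists>j a. polyfun a \<and> (\<forall>z. r d z ^ j * f z = a z * series_le d r z))"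
    by blast
  note r = r'[rule_format]
  define c where "c = r d"
  have c: "polyfun c" using r[of d] by (simp add: c_def invariant_along_def)
  have c_nz: "\<exists>z. c z \<noteq> 0" using r_top by (simp add: c_def)
  obtain j0 a0 where a0: "\<And>z. c z ^ j0 * p0 z = a0 z * series_le d r z"
    using div p0(1,2) unfolding c_def by blast
  define A where "A = M + 1 / norm (e $ i0)"
  have A: "A \<ge> 0" using p0(4) by (simp add: A_def)
  \<comment> \<open>off the zeros of \<open>c\<close>, the roots of \<open>r\<close> are roots of \<open>p0\<close>\<close>
  have bound: "norm (r k z) \<le> norm (c z) * (1 + A * norm z) ^ d" if "c z \<noteq> 0" "k \<le> d" for k z
  proof -
    define P where "P = (\<Sum>k\<le>d. monom (r k z) k)"
    have coeff: "coeff P k = r k z" if "k \<le> d" for k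
      using that by (simp add: P_def coeff_sum)
    have "degree P \<le> d"
      unfolding P_def by (intro degree_sum_le) (auto intro: order.trans[OF degree_monom_le])
    moreover have "coeff P d \<noteq> 0" using that(1) coeff[of d] by (simp add: c_def)
    ultimately have deg: "degree P = d" using le_degree[of P d] by simp
    have lead: "lead_coeff P = c z" unfolding deg using coeff[of d] by (simp add: c_def)
    have "norm s \<le> A * norm z" if root: "poly P s = 0" for s
    proof -
      define w where "w = z + (s - height z) *s e"
      have hw: "height w = s" unfolding w_def height_translate by simp
      have inv: "r k w = r k z" for k using r[of k] unfolding w_def invariant_along_def by blast
      have "(\<Sum>k\<le>d. r k w * height w ^ k) = 0"
        using root by (simp add: P_def poly_sum poly_monom hw inv)
      then have "c w ^ j0 * p0 w = 0" using a0[of w] by simp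
      moreover have "c w \<noteq> 0" using \<open>c z \<noteq> 0\<close> inv by (simp add: c_def)
      ultimately have "p0 (z + (s - height z) *s e) = 0" unfolding w_def by simp
      then have "norm (s - height z) \<le> M * norm z" by (rule p0(3))
      moreover have "norm (height z) \<le> 1 / norm (e $ i0) * norm z"
        unfolding height_def norm_divide using Finite_Cartesian_Product.norm_nth_le[of z i0]
        by (simp add: divide_right_mono)
      ultimately show ?thesis
        using norm_triangle_sub[of s "height z"] by (simp add: A_def algebra_simps)
    qed
    then have "norm (coeff P k) \<le> norm (lead_coeff P) * (1 + A * norm z) ^ degree P"
      by (intro coeff_bound_from_roots) (auto simp: A)
    then show ?thesis unfolding lead coeff[OF that(2)] unfolding deg .
  qed
  have "\<exists>q. polyfun q \<and> (\<forall>z. r k z = q z * c z)" if "k \<le> d" for k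
  proof (rule polyfun_dvd_if_dominated[OF _ c c_nz])
    show "polyfun (r k)" using r[of k] by (simp add: invariant_along_def)
    fix R
    have "norm (r k z) \<le> (1 + A * \<bar>R\<bar>) ^ d * norm (c z)" if "norm z \<le> R" "c z \<noteq> 0" for z
    proof -
      have "norm (r k z) \<le> norm (c z) * (1 + A * norm z) ^ d" using bound that \<open>k \<le> d\<close> by blast
      also have "\<dots> \<le> norm (c z) * (1 + A * \<bar>R\<bar>) ^ d"
        using A that by (intro mult_left_mono power_mono add_left_mono) auto
      finally show ?thesis by (simp add: mult.commute)
    qed
    then show "\<exists>K. \<forall>z. norm z \<le> R \<and> c z \<noteq> 0 \<longrightarrow> norm (r k z) \<le> K * norm (c z)" by blast
  qed
  then obtain q where q: "\<And>k. k \<le> d \<Longrightarrow> polyfun (q k)" "\<And>k z. k \<le> d \<Longrightarrow> r k z = q k z * c z"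
    by metis
  define P where "P k = (if k \<le> d then q k else (\<lambda>z. 0))" for k
  have P_poly: "polyfun (P k)" for k using q(1) by (auto simp: P_def intro: polyfun_intros)
  have P: "invariant_along e (P k)" for k
    unfolding invariant_along_def
  proof (intro conjI allI P_poly)
    fix z s
    show "P k (z + s *s e) = P k z"
    proof (cases "k \<le> d")
      case True
      have "(\<lambda>z. P k (z + s *s e)) z = P k z"
      proof (rule polyfun_cancel[OF c _ P_poly c_nz])
        show "polyfun (\<lambda>z. P k (z + s *s e))"
          by (rule polyfun_compose[OF P_poly]) (auto intro!: polyfun_intros)
        fix z
        have "q k (z + s *s e) * c (z + s *s e) = q k z * c z"
          using r[of k] q(2)[OF True] unfolding invariant_along_def by metis
        moreover have "c (z + s *s e) = c z" using r[of d] by (simp add: c_def invariant_along_def)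
        ultimately show "c z * P k (z + s *s e) = c z * P k z" using True by (simp add: P_def mult.commute)
      qed
      then show ?thesis by simp
    qed (simp add: P_def)
  qed
  define p where "p z = series_le d P z" for z
  have p: "polyfun p" unfolding p_def using P_poly by (intro polyfun_intros polyfun_height)
  have cp: "c z * p z = series_le d r z" for z
    unfolding p_def sum_distrib_left by (rule sum.cong) (auto simp: q(2) P_def)
  have P_top: "P d z = 1" for z
  proof (rule polyfun_cancel[OF c P_poly complex_polynomial_function.const c_nz])
    fix z show "c z * P d z = c z * 1"
      using q(2)[of d z] by (simp add: P_def mult.commute flip: c_def)
  qed
  have c_notD: "\<not> (\<forall>z\<in>D. c z = 0)"
    using noinvD[of c] r[of d] c_nz by (auto simp: c_def)
  have pD: "\<forall>z\<in>D. p z = 0"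
    using prime[OF c p] cp rD c_notD by simp
  have principal: "\<exists>a. polyfun a \<and> (\<forall>z. f z = a z * p z)" if f: "polyfun f" "\<forall>z\<in>D. f z = 0" for f
  proof -
    obtain n g where g: "\<And>k. invariant_along e (g k)" "\<And>z. f z = series_le n g z"
      using expansion[OF f(1)] by blast
    obtain j a h where a: "polyfun a" and h: "\<And>k. invariant_along e (h k)"
      and eq: "\<And>z. P d z ^ j * series_lt (Suc n) g z =
        a z * series_le d P z + series_lt d h z"
      using pseudo_division[of P g d "Suc n"] g(1) P by blast
    have eq': "f z = a z * p z + series_lt d h z" for z
      using eq[of z] unfolding lessThan_Suc_atMost g(2)[symmetric] P_top p_def[symmetric] by simp
    have "series_lt d h z = 0" if "z \<in> D" for z
      using eq'[of z] f(2) pD that by simp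
    then have "\<forall>z. series_lt d h z = 0" using low h by blast
    then show ?thesis using a eq' by auto
  qed
  have p_root: "\<exists>t. p (z + t *s e) = 0" for z
  proof -
    define Q where "Q = (\<Sum>k\<le>d. monom (P k z) k)"
    have "coeff Q d = 1" by (simp add: Q_def coeff_sum P_top)
    then have "\<not> constant (poly Q)"
      using d constant_degree[of Q] le_degree[of Q d] by auto
    then obtain s where s: "poly Q s = 0" using fundamental_theorem_of_algebra by blast
    have "P k (z + (s - height z) *s e) = P k z" for k using P[of k] unfolding invariant_along_def by blast
    then have "p (z + (s - height z) *s e) = 0"
      using s unfolding p_def height_translate by (simp add: Q_def poly_sum poly_monom)
    then show ?thesis by blast
  qed
  have p_nz: "\<exists>z. p z \<noteq> 0"
  proof (rule ccontr)
    assume "\<not> (\<exists>z. p z \<noteq> 0)"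
    then have "\<And>z. series_le d P z = 0" by (auto simp: p_def)
    then have "P d 0 = 0" by (intro expansion_unique[of P d]) (use P in auto)
    then show False by (simp add: P_top)
  qed
  have irred: "irreducible_polynomial_function p"
    unfolding irreducible_polynomial_function_def
  proof (intro conjI allI impI)
    show "polyfun p" by (rule p)
    show "\<not> p constant_on UNIV"
      using p_root[of 0] p_nz unfolding constant_on_def by (metis UNIV_I)
    fix f g assume fg: "polyfun f \<and> polyfun g \<and> (\<forall>z. p z = f z * g z)"
    have unit: "v constant_on UNIV" if uv: "polyfun u" "polyfun v" "\<forall>z. p z = u z * v z" "\<forall>z\<in>D. u z = 0" for u v
    proof -
      obtain a where a: "polyfun a" "\<And>z. u z = a z * p z" using principal[OF uv(1,4)] by blast
      have av: "a z * v z = 1" for z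
        by (rule polyfun_cancel[OF p _ _ p_nz, of "\<lambda>z. a z * v z"])
           (use a uv in \<open>auto intro: polyfun_intros simp: mult_ac\<close>)
      have "v y = v x" for x y
      proof -
        obtain F where F: "\<And>s. a (x + s *s (y - x)) = poly F s" using polyfun_lineE[OF a(1)] by blast
        obtain G where G: "\<And>s. v (x + s *s (y - x)) = poly G s" using polyfun_lineE[OF uv(2)] by blast
        have "poly (F * G - 1) s = 0" for s using av[of "x + s *s (y - x)"] by (simp only: F G) simp
        then have "F * G = 1" using poly_all_0_iff_0 by (metis eq_iff_diff_eq_0)
        then have "is_unit G" by (metis dvdI mult.commute)
        then obtain k where "G = [:k:]" by (metis is_unit_polyE)
        then show ?thesis using G[of 0] G[of 1] by simp
      qed
      then show ?thesis unfolding constant_on_def by blast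
    qed
    have "(\<forall>z\<in>D. f z = 0) \<or> (\<forall>z\<in>D. g z = 0)"
      using prime[of f g] fg pD by auto
    then show "f constant_on UNIV \<or> g constant_on UNIV"
      using unit[of f g] unit[of g f] fg by (auto simp: mult.commute)
  qed
  have closureD: "zariski_closure D = {z. p z = 0}"
  proof
    show "zariski_closure D \<subseteq> {z. p z = 0}" using p pD unfolding zariski_closure_def by blast
    show "{z. p z = 0} \<subseteq> zariski_closure D" unfolding zariski_closure_def
      using principal by fastforce
  qed
  have pB: "\<forall>z\<in>B. p z = 0" using B p pD by blast
  have BD: "\<forall>z\<in>D. f z = 0" if f: "polyfun f" "\<forall>z\<in>B. f z = 0" for f
  proof -
    have "\<forall>g. invariant_along e g \<and> (\<forall>z\<in>B. g z = 0) \<longrightarrow> (\<forall>z. g z = 0)" using noinv by blast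
    from minimal_relation[OF this p pB p_nz]
    obtain d' h where d': "d' > 0" and h': "\<forall>k. invariant_along e (h k)" and h_top: "\<exists>z. h d' z \<noteq> 0"
      and div': "\<forall>f. polyfun f \<and> (\<forall>z\<in>B. f z = 0)
        \<longrightarrow> (\<exists>j a. polyfun a \<and> (\<forall>z. h d' z ^ j * f z = a z * series_le d' h z))"
      by blast
    note h = h'[rule_format]
    define H where "H z = series_le d' h z" for z
    have h_poly: "polyfun (h k)" for k using h[of k] by (simp add: invariant_along_def)
    have H: "polyfun H" unfolding H_def using h_poly by (intro polyfun_intros polyfun_height)
    have top_notD: "\<not> (\<forall>z\<in>D. h d' z ^ j = 0)" for j
    proof
      assume "\<forall>z\<in>D. h d' z ^ j = 0"
      then have "\<forall>z\<in>D. h d' z = 0" by simp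
      then show False using noinvD h h_top by blast
    qed
    \<comment> \<open>the prime \<open>p\<close> divides \<open>a\<close> or \<open>H\<close>; if it divided \<open>a\<close>, then \<open>H\<close> would divide a polynomial constant along \<open>e\<close>\<close>
    obtain j a where a: "polyfun a" "\<And>z. h d' z ^ j * p z = a z * H z"
      using div' p pB unfolding H_def by blast
    have "\<not> (\<forall>z\<in>D. a z = 0)"
    proof
      assume "\<forall>z\<in>D. a z = 0"
      then obtain b where b: "polyfun b" "\<And>z. a z = b z * p z" using principal a(1) by blast
      have eq: "h d' z ^ j = b z * H z" for z
        by (rule polyfun_cancel[OF p _ _ p_nz, of "\<lambda>z. h d' z ^ j" "\<lambda>z. b z * H z"])
           (use a b h_poly H in \<open>auto intro!: polyfun_intros simp: mult_ac\<close>)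
      obtain z where z: "h d' z \<noteq> 0" using h_top by blast
      define Q where "Q = (\<Sum>k\<le>d'. monom (h k z) k)"
      have "coeff Q d' \<noteq> 0" using z by (simp add: Q_def coeff_sum)
      then have "\<not> constant (poly Q)"
        using d' constant_degree[of Q] le_degree[of Q d'] by auto
      then obtain s where s: "poly Q s = 0" using fundamental_theorem_of_algebra by blast
      have inv: "h k (z + (s - height z) *s e) = h k z" for k using h[of k] unfolding invariant_along_def by blast
      have "H (z + (s - height z) *s e) = 0"
        using s unfolding H_def height_translate inv by (simp add: Q_def poly_sum poly_monom)
      then show False using eq[of "z + (s - height z) *s e"] z inv by simp
    qed
    moreover have "\<forall>z\<in>D. a z * H z = 0" using pD by (simp flip: a(2))
    ultimately have HD: "\<forall>z\<in>D. H z = 0" using prime[OF a(1) H] by blast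
    obtain j' b where b: "\<And>z. h d' z ^ j' * f z = b z * H z"
      using div' f unfolding H_def by blast
    have "\<forall>z\<in>D. h d' z ^ j' * f z = 0" using HD by (simp add: b)
    then show ?thesis
      using prime[of "\<lambda>z. h d' z ^ j'" f] top_notD[of j'] f(1) h_poly by (blast intro: polyfun_power)
  qed
  have "zariski_closure B = zariski_closure D"
    unfolding zariski_closure_def using B BD by blast
  then show ?thesis using irred closureD by blast
qed

end


section \<open>Tangent spaces of the Segre-Veronese variety\<close>

text \<open>
Over the complex numbers this is bilinear, unlike an inner product.
\<close>

definition pairing :: "'k::comm_semiring_1 ^ 'i \<Rightarrow> 'k ^ 'i \<Rightarrow> 'k" where
  "pairing c x = (\<Sum>i\<in>UNIV. c $ i * x $ i)"

lemma pairing_simps: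
  fixes c d x y :: "'k::comm_ring_1 ^ 'i"
  shows "pairing (c + d) x = pairing c x + pairing d x" "pairing (c - d) x = pairing c x - pairing d x"
    "pairing c (x + y) = pairing c x + pairing c y" "pairing c (x - y) = pairing c x - pairing c y"
    "pairing c (a *s x) = a * pairing c x" "pairing (a *s c) x = a * pairing c x"
    "pairing 0 x = 0" "pairing c 0 = 0"
  by (simp_all add: pairing_def algebra_simps sum.distrib sum_subtractf sum_distrib_left)

lemma pairing_sum: "pairing (\<Sum>k\<in>K. f k) x = (\<Sum>k\<in>K. pairing (f k) x)"
  for f :: "'b \<Rightarrow> 'k::comm_ring_1 ^ 'i"
  by (induction K rule: infinite_finite_induct) (simp_all add: pairing_simps)

lemma pairing_axis [simp]: "pairing (axis i a) x = a * x $ i" for x :: "'k::comm_ring_1 ^ 'i"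
  by (simp add: pairing_def axis_def if_distrib[of "\<lambda>c. c * _"] cong: if_cong)

lemma uprod_pair_cases:
  obtains i j k l where "x = (Upair i j, Upair k l)"
  by (metis prod.collapse uprod_exhaust)

lemma sym_mult_Upair:
  "sym_mult u v $ Upair i j = (if i = j then u $ i * v $ i else u $ i * v $ j + u $ j * v $ i)"
proof -
  have "{(a, b). Upair a b = Upair i j} = {(i, j), (j, i)}" by auto
  then show ?thesis by (simp add: sym_mult_def)
qed

lemma segre_veronese_Upair:
  "segre_veronese v w $ (Upair i j, Upair k l) = (if i = j then 1 else 2) * (v $ i * v $ j * w $ k * w $ l)"
  by (simp add: segre_veronese_def sym_mult_Upair mult_2) (simp add: algebra_simps)

text \<open>
Equal to \<open>w\<^sub>k w'\<^sub>l + w'\<^sub>k w\<^sub>l\<close> at \<open>Upair k l\<close>. Being a difference of values of \<open>mono2\<close>, it is well defined on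
unordered pairs.
\<close>

definition mono2_polar :: "'k::comm_ring_1 ^ 'n \<Rightarrow> 'k ^ 'n \<Rightarrow> 'n::finite uprod \<Rightarrow> 'k" where
  "mono2_polar w w' q = mono2 (w + w') q - mono2 w q - mono2 w' q"

text \<open>
The derivative of \<open>segre_veronese\<close> at \<open>(v, w)\<close> in the direction \<open>(v', w')\<close>.
\<close>

definition tangent_vector ::
  "'k::comm_ring_1 ^ 'm \<Rightarrow> 'k ^ 'n \<Rightarrow> 'k ^ 'm \<Rightarrow> 'k ^ 'n \<Rightarrow> 'k ^ ('m::finite uprod \<times> 'n::finite uprod)" where
  "tangent_vector v w v' w' =
     (\<chi> i. (sym_mult v v' $ fst i + sym_mult v' v $ fst i) * mono2 w (snd i) + sym_mult v v $ fst i * mono2_polar w w' (snd i))"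

lemma tangent_vector_Upair:
  "tangent_vector v w v' w' $ (Upair i j, Upair k l) = (if i = j then 1 else 2) *
     ((v $ i * v' $ j + v' $ i * v $ j) * w $ k * w $ l + v $ i * v $ j * (w $ k * w' $ l + w' $ k * w $ l))"
  by (simp add: tangent_vector_def sym_mult_Upair mono2_polar_def algebra_simps)

lemma vec_eq_uprodI:
  fixes x y :: "'k ^ ('m::finite uprod \<times> 'n::finite uprod)"
  assumes "\<And>i j k l. x $ (Upair i j, Upair k l) = y $ (Upair i j, Upair k l)"
  shows "x = y"
  unfolding vec_eq_iff
proof
  fix a show "x $ a = y $ a"
    by (rule uprod_pair_cases[of a]) (simp add: assms)
qed

lemmas uprod_components = tangent_vector_Upair segre_veronese_Upair

lemma tangent_vector_linear:
  fixes v :: "'k::comm_ring_1 ^ 'm::finite" and w :: "'k ^ 'n::finite"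
  shows "tangent_vector v w (x + y) (x' + y') = tangent_vector v w x x' + tangent_vector v w y y'"
    "tangent_vector v w (x - y) (x' - y') = tangent_vector v w x x' - tangent_vector v w y y'"
    "tangent_vector v w (a *s x) (a *s x') = a *s tangent_vector v w x x'"
  by (auto intro!: vec_eq_uprodI simp: uprod_components algebra_simps)

lemma linear_functional_expand:
  fixes f :: "'k::comm_ring_1 ^ 'i \<Rightarrow> 'k"
  assumes add: "\<And>x y. f (x + y) = f x + f y" and scale: "\<And>a x. f (a *s x) = a * f x"
  shows "f x = (\<Sum>j\<in>UNIV. x $ j * f (axis j 1))"
proof -
  have "f 0 = 0" using scale[of 0 0] by simp
  then have "f (\<Sum>j\<in>J. x $ j *s axis j 1) = (\<Sum>j\<in>J. x $ j * f (axis j 1))" for J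
    by (induction J rule: infinite_finite_induct) (simp_all add: add scale)
  from this[of UNIV] show ?thesis by (simp add: basis_expansion)
qed

lemma tangent_vector_basis:
  fixes v :: "'k::comm_ring_1 ^ 'm::finite" and w :: "'k ^ 'n::finite"
  shows "pairing c (tangent_vector v w v' 0) = (\<Sum>j\<in>UNIV. v' $ j * pairing c (tangent_vector v w (axis j 1) 0))"
    and "pairing c (tangent_vector v w 0 w') = (\<Sum>l\<in>UNIV. w' $ l * pairing c (tangent_vector v w 0 (axis l 1)))"
proof -
  have 1: "tangent_vector v w (x + y) 0 = tangent_vector v w x 0 + tangent_vector v w y 0"
    "tangent_vector v w (a *s x) 0 = a *s tangent_vector v w x 0" for a x y
    using tangent_vector_linear(1)[of v w x y 0 0] tangent_vector_linear(3)[of v w a x 0] by simp_all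
  have 2: "tangent_vector v w 0 (x + y) = tangent_vector v w 0 x + tangent_vector v w 0 y"
    "tangent_vector v w 0 (a *s x) = a *s tangent_vector v w 0 x" for a x y
    using tangent_vector_linear(1)[of v w 0 0 x y] tangent_vector_linear(3)[of v w a 0 x] by simp_all
  show "pairing c (tangent_vector v w v' 0) = (\<Sum>j\<in>UNIV. v' $ j * pairing c (tangent_vector v w (axis j 1) 0))"
    by (rule linear_functional_expand) (simp_all only: 1 pairing_simps)
  show "pairing c (tangent_vector v w 0 w') = (\<Sum>l\<in>UNIV. w' $ l * pairing c (tangent_vector v w 0 (axis l 1)))"
    by (rule linear_functional_expand) (simp_all only: 2 pairing_simps)
qed

text \<open>
By \<open>segre_veronese_pairing\<close> the derivative of the biquadratic form of \<open>c\<close> at \<open>(v, w)\<close> in the direction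
\<open>(v', w')\<close> is the pairing of \<open>c\<close> with the tangent vector.
\<close>

definition critical ::
  "'k::comm_ring_1 ^ ('m::finite uprod \<times> 'n::finite uprod) \<Rightarrow> 'k ^ 'm \<Rightarrow> 'k ^ 'n \<Rightarrow> bool" where
  "critical c v w \<longleftrightarrow> (\<forall>v' w'. pairing c (tangent_vector v w v' w') = 0)"

lemma critical_scale_point:
  assumes "critical c v w" shows "critical c (a *s v) (b *s w)"
  unfolding critical_def
proof (intro allI)
  fix v' w'
  have "tangent_vector (a *s v) (b *s w) v' w' = tangent_vector v w ((a * b ^ 2) *s v') ((a ^ 2 * b) *s w')"
    by (auto intro!: vec_eq_uprodI simp: uprod_components algebra_simps power2_eq_square)
  then show "pairing c (tangent_vector (a *s v) (b *s w) v' w') = 0"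
    using assms by (simp add: critical_def)
qed

lemma critical_scale: "critical c v w \<Longrightarrow> critical (a *s c) v w"
  by (simp add: critical_def pairing_simps)

lemma segre_veronese_eq_0_iff:
  fixes v :: "complex ^ 'm::finite" and w :: "complex ^ 'n::finite"
  shows "segre_veronese v w = 0 \<longleftrightarrow> v = 0 \<or> w = 0"
proof
  assume *: "segre_veronese v w = 0"
  show "v = 0 \<or> w = 0"
  proof (rule ccontr)
    assume "\<not> (v = 0 \<or> w = 0)"
    then obtain i k where "v $ i \<noteq> 0" "w $ k \<noteq> 0" by (auto simp: vec_eq_iff)
    moreover have "segre_veronese v w $ (Upair i i, Upair k k) = 0" using * by simp
    ultimately show False by (simp add: segre_veronese_Upair)
  qed
qed (auto intro!: vec_eq_uprodI simp: uprod_components)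

text \<open>
One vector \<open>g\<close> gives the derivative along every curve through \<open>x\<close>. This makes the tangent space, which is
defined by lines, a linear space that also contains the velocities of curves in the variety.
\<close>

lemma polyfun_gradient:
  assumes "polyfun p"
  shows "\<exists>g. \<forall>\<gamma> u. \<gamma> 0 = x \<and> (\<forall>i. ((\<lambda>t. \<gamma> t $ i) has_field_derivative u $ i) (at 0))
    \<longrightarrow> ((\<lambda>t. p (\<gamma> t)) has_field_derivative pairing g u) (at 0)"
  using assms
proof induction
  case (coord i)
  show ?case by (rule exI[of _ "axis i 1"]) simp
next
  case (const c)
  show ?case by (rule exI[of _ 0]) (simp add: pairing_simps)
next
  case (add p q)
  then obtain g h where
    "\<forall>\<gamma> u. \<gamma> 0 = x \<and> (\<forall>i. ((\<lambda>t. \<gamma> t $ i) has_field_derivative u $ i) (at 0))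
    \<longrightarrow> ((\<lambda>t. p (\<gamma> t)) has_field_derivative pairing g u) (at 0)"
    "\<forall>\<gamma> u. \<gamma> 0 = x \<and> (\<forall>i. ((\<lambda>t. \<gamma> t $ i) has_field_derivative u $ i) (at 0))
    \<longrightarrow> ((\<lambda>t. q (\<gamma> t)) has_field_derivative pairing h u) (at 0)"
    by blast
  then show ?case
    by (intro exI[of _ "g + h"]) (auto simp: pairing_simps intro!: DERIV_add)
next
  case (mult p q)
  then obtain g h where
    g: "\<And>\<gamma> u. \<gamma> 0 = x \<and> (\<forall>i. ((\<lambda>t. \<gamma> t $ i) has_field_derivative u $ i) (at 0))
    \<longrightarrow> ((\<lambda>t. p (\<gamma> t)) has_field_derivative pairing g u) (at 0)" and
    h: "\<And>\<gamma> u. \<gamma> 0 = x \<and> (\<forall>i. ((\<lambda>t. \<gamma> t $ i) has_field_derivative u $ i) (at 0))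
    \<longrightarrow> ((\<lambda>t. q (\<gamma> t)) has_field_derivative pairing h u) (at 0)"
    by blast
  show ?case
  proof (intro exI[of _ "q x *s g + p x *s h"] allI impI)
    fix \<gamma> :: "complex \<Rightarrow> complex ^ 'a" and u
    assume *: "\<gamma> 0 = x \<and> (\<forall>i. ((\<lambda>t. \<gamma> t $ i) has_field_derivative u $ i) (at 0))"
    then have "((\<lambda>t. p (\<gamma> t) * q (\<gamma> t)) has_field_derivative
        pairing g u * q (\<gamma> 0) + pairing h u * p (\<gamma> 0)) (at 0)"
      using g h by (intro DERIV_mult) blast+
    then show "((\<lambda>t. p (\<gamma> t) * q (\<gamma> t)) has_field_derivative
        pairing (q x *s g + p x *s h) u) (at 0)"
      using * by (simp add: pairing_simps mult.commute)
  qed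
qed

lemma line_derivative: "((\<lambda>t. (x + t *s u) $ i) has_field_derivative u $ i) (at 0)" for u :: "complex ^ 'i"
  by (auto intro!: derivative_eq_intros)

lemma tangent_space_diff:
  assumes "u \<in> tangent_space X x" "u' \<in> tangent_space X x"
  shows "u - u' \<in> tangent_space X x"
  unfolding tangent_space_def
proof (intro CollectI allI impI)
  fix p assume p: "polyfun p \<and> (\<forall>z\<in>X. p z = 0)"
  then obtain g where g: "\<And>\<gamma> u. \<gamma> 0 = x \<Longrightarrow> (\<And>i. ((\<lambda>t. \<gamma> t $ i) has_field_derivative u $ i) (at 0))
      \<Longrightarrow> ((\<lambda>t. p (\<gamma> t)) has_field_derivative pairing g u) (at 0)"
    using polyfun_gradient[of p x] by blast
  have D: "((\<lambda>t. p (x + t *s u)) has_field_derivative pairing g u) (at 0)" for u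
    by (rule g) (simp, rule line_derivative)
  have "pairing g u = 0" "pairing g u' = 0"
    using D assms p unfolding tangent_space_def by (blast intro: DERIV_unique)+
  then show "((\<lambda>t. p (x + t *s (u - u'))) has_field_derivative 0) (at 0)"
    using D[of "u - u'"] by (simp add: pairing_simps)
qed

lemma tangent_vector_in_tangent_space:
  fixes v v' :: "complex ^ 'm::finite" and w w' :: "complex ^ 'n::finite"
  shows "tangent_vector v w v' w' \<in> tangent_space segre_veronese_cone (segre_veronese v w)"
  unfolding tangent_space_def
proof (intro CollectI allI impI)
  fix p :: "complex ^ ('m uprod \<times> 'n uprod) \<Rightarrow> complex"
  assume p: "polyfun p \<and> (\<forall>z\<in>segre_veronese_cone. p z = 0)"
  define x where "x = segre_veronese v w"
  define u where "u = tangent_vector v w v' w'"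
  obtain g where g: "\<And>\<gamma> u. \<gamma> 0 = x \<Longrightarrow> (\<And>i. ((\<lambda>t. \<gamma> t $ i) has_field_derivative u $ i) (at 0))
      \<Longrightarrow> ((\<lambda>t. p (\<gamma> t)) has_field_derivative pairing g u) (at 0)"
    using polyfun_gradient[of p x] p by blast
  have "((\<lambda>t. p (segre_veronese (v + t *s v') (w + t *s w'))) has_field_derivative pairing g u) (at 0)"
  proof (rule g)
    fix a :: "'m uprod \<times> 'n uprod"
    obtain i j k l where a: "a = (Upair i j, Upair k l)" by (rule uprod_pair_cases)
    show "((\<lambda>t. segre_veronese (v + t *s v') (w + t *s w') $ a) has_field_derivative u $ a) (at 0)"
      unfolding a u_def uprod_components
      by (auto intro!: derivative_eq_intros simp: algebra_simps)
  qed (simp add: x_def)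
  moreover have "p (segre_veronese (v + t *s v') (w + t *s w')) = 0" for t
    using p unfolding segre_veronese_cone_def by blast
  ultimately have "pairing g u = 0" by (simp add: DERIV_unique[OF DERIV_const])
  then show "((\<lambda>t. p (segre_veronese v w + t *s tangent_vector v w v' w')) has_field_derivative 0) (at 0)"
    unfolding x_def[symmetric] u_def[symmetric]
    using g[of "\<lambda>t. x + t *s u" u, OF _ line_derivative] by simp
qed

context
  fixes v :: "complex ^ 'm::finite" and w :: "complex ^ 'n::finite" and i0 :: 'm and k0 :: 'n
  assumes v0: "v $ i0 \<noteq> 0" and w0: "w $ k0 \<noteq> 0"
begin

text \<open>
The \<open>m + n - 1\<close> coordinates \<open>(Upair i0 j, Upair k0 k0)\<close> and \<open>(Upair i0 i0, Upair k0 l)\<close> are local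
coordinates of the cone near \<open>v\<^sup>2 \<otimes> w\<^sup>2\<close>. Scaling \<open>v\<close> up and \<open>w\<close> down does not move the point, which allows
\<open>w' $ k0 = 0\<close>.
\<close>

lemma tangent_vector_prescribed:
  fixes u :: "complex ^ ('m uprod \<times> 'n uprod)"
  shows "\<exists>v' w'. w' $ k0 = 0 \<and>
    (\<forall>j. tangent_vector v w v' w' $ (Upair i0 j, Upair k0 k0) = u $ (Upair i0 j, Upair k0 k0)) \<and>
    (\<forall>l. tangent_vector v w v' w' $ (Upair i0 i0, Upair k0 l) = u $ (Upair i0 i0, Upair k0 l))"
proof -
  define a where "a = u $ (Upair i0 i0, Upair k0 k0) / (2 * v $ i0 * (w $ k0)\<^sup>2)"
  define v' where "v' = (\<chi> j. if j = i0 then a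
    else (u $ (Upair i0 j, Upair k0 k0) / (2 * (w $ k0)\<^sup>2) - a * v $ j) / v $ i0)"
  define w' where "w' = (\<chi> l. if l = k0 then 0
    else (u $ (Upair i0 i0, Upair k0 l) - 2 * v $ i0 * a * w $ l * w $ k0) / ((v $ i0)\<^sup>2 * w $ k0))"
  show ?thesis
    by (rule exI[of _ v'], rule exI[of _ w'])
       (use v0 w0 in \<open>auto simp: tangent_vector_Upair v'_def w'_def a_def field_simps power2_eq_square\<close>)
qed

lemma tangent_vector_determined:
  assumes "w' $ k0 = 0"
    and "\<And>j. tangent_vector v w v' w' $ (Upair i0 j, Upair k0 k0) = 0"
    and "\<And>l. tangent_vector v w v' w' $ (Upair i0 i0, Upair k0 l) = 0"
  shows "v' = 0" "w' = 0"
proof -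
  have i0: "v' $ i0 = 0"
    using assms(2)[of i0] assms(1) v0 w0 by (simp add: tangent_vector_Upair)
  have "v' $ j = 0" for j
    using assms(2)[of j] assms(1) v0 w0 i0 by (cases "i0 = j") (auto simp: tangent_vector_Upair)
  moreover have "w' $ l = 0" for l
    using assms(3)[of l] assms(1) v0 w0 i0 by (cases "k0 = l") (auto simp: tangent_vector_Upair)
  ultimately show "v' = 0" "w' = 0" by (auto simp: vec_eq_iff)
qed

text \<open>
On the cone, every coordinate is determined by these local coordinates through a binomial equation \<open>p\<close>
that is linear in it. If the local coordinates of a tangent vector are zero, the derivative of \<open>p\<close> shows
that all are.
\<close>

lemma tangent_space_zero_coordinates:
  assumes u: "u \<in> tangent_space segre_veronese_cone (segre_veronese v w)"
    and s: "\<And>j. u $ (Upair i0 j, Upair k0 k0) = 0" and t: "\<And>l. u $ (Upair i0 i0, Upair k0 l) = 0"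
  shows "u = 0"
proof (rule vec_eq_uprodI)
  fix i j k l
  define \<nu> where "\<nu> i j = (if i = j then 1 else 2 :: complex)" for i j :: 'm
  have \<nu>: "\<nu> i j \<noteq> 0" for i j by (simp add: \<nu>_def)
  \<comment> \<open>the monomials \<open>v\<^sub>i v\<^sub>j w\<^sub>k w\<^sub>l v\<^sub>i\<^sub>0\<^sup>6 w\<^sub>k\<^sub>0\<^sup>6\<close> agree; \<open>\<nu>\<close> counts the ordered pairs\<close>
  define p :: "complex ^ ('m uprod \<times> 'n uprod) \<Rightarrow> complex" where
    "p z = z $ (Upair i j, Upair k l) * (z $ (Upair i0 i0, Upair k0 k0)) ^ 3 -
      \<nu> i j / (\<nu> i0 i * \<nu> i0 j) *
      (z $ (Upair i0 i, Upair k0 k0) * z $ (Upair i0 j, Upair k0 k0) *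
       z $ (Upair i0 i0, Upair k0 k) * z $ (Upair i0 i0, Upair k0 l))" for z
  have "polyfun p" unfolding p_def by (intro polyfun_intros)
  moreover have "p (segre_veronese v w) = 0" for v w
    using \<nu>[of i0 i] \<nu>[of i0 j] unfolding p_def segre_veronese_Upair \<nu>_def[symmetric]
    by (simp add: field_simps power3_eq_cube) (simp add: \<nu>_def)
  ultimately have 0: "((\<lambda>t. p (segre_veronese v w + t *s u)) has_field_derivative 0) (at 0)"
    using u unfolding tangent_space_def segre_veronese_cone_def by blast
  have "p (segre_veronese v w + t *s u)
      = p (segre_veronese v w) + t * u $ (Upair i j, Upair k l) * (segre_veronese v w $ (Upair i0 i0, Upair k0 k0)) ^ 3" for t
    unfolding p_def by (simp add: s assms(3) algebra_simps)
  then have "((\<lambda>t. p (segre_veronese v w) + t * u $ (Upair i j, Upair k l) *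
      (segre_veronese v w $ (Upair i0 i0, Upair k0 k0)) ^ 3) has_field_derivative 0) (at 0)"
    using 0 by simp
  moreover have "((\<lambda>t. p (segre_veronese v w) + t * u $ (Upair i j, Upair k l) *
      (segre_veronese v w $ (Upair i0 i0, Upair k0 k0)) ^ 3) has_field_derivative
      u $ (Upair i j, Upair k l) * (segre_veronese v w $ (Upair i0 i0, Upair k0 k0)) ^ 3) (at 0)"
    by (auto intro!: derivative_eq_intros)
  ultimately have "u $ (Upair i j, Upair k l) * (segre_veronese v w $ (Upair i0 i0, Upair k0 k0)) ^ 3 = 0"
    using DERIV_unique by blast
  then show "u $ (Upair i j, Upair k l) = 0 $ (Upair i j, Upair k l)"
    using v0 w0 by (simp add: segre_veronese_Upair)
qed

lemma tangent_space_segre_veronese: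
  "tangent_space segre_veronese_cone (segre_veronese v w) = {tangent_vector v w v' w' | v' w'. w' $ k0 = 0}"
proof
  show "{tangent_vector v w v' w' | v' w'. w' $ k0 = 0} \<subseteq> tangent_space segre_veronese_cone (segre_veronese v w)"
    using tangent_vector_in_tangent_space by blast
  show "tangent_space segre_veronese_cone (segre_veronese v w) \<subseteq> {tangent_vector v w v' w' | v' w'. w' $ k0 = 0}"
  proof
    fix u assume u: "u \<in> tangent_space segre_veronese_cone (segre_veronese v w)"
    obtain v' w' where vw: "w' $ k0 = 0"
      "\<And>j. tangent_vector v w v' w' $ (Upair i0 j, Upair k0 k0) = u $ (Upair i0 j, Upair k0 k0)"
      "\<And>l. tangent_vector v w v' w' $ (Upair i0 i0, Upair k0 l) = u $ (Upair i0 i0, Upair k0 l)"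
      using tangent_vector_prescribed[of u] by blast
    have "u - tangent_vector v w v' w' = 0"
      by (rule tangent_space_zero_coordinates[OF tangent_space_diff[OF u tangent_vector_in_tangent_space]])
         (simp_all add: vw)
    then show "u \<in> {tangent_vector v w v' w' | v' w'. w' $ k0 = 0}" using vw(1) by auto
  qed
qed

text \<open>
All tangent spaces at nonzero points have the same dimension, hence all these points are smooth.
\<close>

lemma dim_tangent_space_segre_veronese:
  "vec.dim (tangent_space segre_veronese_cone (segre_veronese v w)) = CARD('m) + CARD('n) - 1"
proof -
  define L :: "complex ^ ('m + 'n) \<Rightarrow> complex ^ ('m uprod \<times> 'n uprod)" where
    "L z = tangent_vector v w (\<chi> i. z $ Inl i) (\<chi> k. z $ Inr k)" for z
  define S where "S = {z :: complex ^ ('m + 'n). \<forall>a. a \<notin> UNIV - {Inr k0} \<longrightarrow> z $ a = 0}"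
  have lin: "Vector_Spaces.linear (*s) (*s) L"
    unfolding Vector_Spaces.linear_iff
  proof (intro conjI allI vec.vector_space_axioms)
    fix x y :: "complex ^ ('m + 'n)"
    have "(\<chi> i. (x + y) $ Inl i) = (\<chi> i. x $ Inl i) + (\<chi> i. y $ Inl i)"
      "(\<chi> k. (x + y) $ Inr k) = (\<chi> k. x $ Inr k) + (\<chi> k. y $ Inr k)"
      by (simp_all add: vec_eq_iff)
    then show "L (x + y) = L x + L y"
      unfolding L_def by (simp only: tangent_vector_linear(1))
  next
    fix c and x :: "complex ^ ('m + 'n)"
    have "(\<chi> i. (c *s x) $ Inl i) = c *s (\<chi> i. x $ Inl i)" "(\<chi> k. (c *s x) $ Inr k) = c *s (\<chi> k. x $ Inr k)"
      by (simp_all add: vec_eq_iff)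
    then show "L (c *s x) = c *s L x"
      unfolding L_def by (simp only: tangent_vector_linear(3))
  qed
  have S: "vec.subspace S" by (auto simp: S_def vec.subspace_def)
  have "tangent_space segre_veronese_cone (segre_veronese v w) = L ` S"
  proof -
    have "\<exists>z\<in>S. tangent_vector v w v' w' = L z" if "w' $ k0 = 0" for v' w'
      by (rule bexI[of _ "\<chi> a. case a of Inl i \<Rightarrow> v' $ i | Inr k \<Rightarrow> w' $ k"])
         (use that in \<open>auto simp: L_def S_def\<close>)
    moreover have "\<exists>v' w'. L z = tangent_vector v w v' w' \<and> w' $ k0 = 0" if "z \<in> S" for z
      by (intro exI conjI, unfold L_def, rule refl) (use that in \<open>simp add: S_def\<close>)
    ultimately show ?thesis
      unfolding tangent_space_segre_veronese by blast
  qed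
  moreover have "inj_on L S"
  proof -
    have "z = 0" if "z \<in> S" "L z = 0" for z
    proof -
      have "(\<chi> i. z $ Inl i) = 0" "(\<chi> k. z $ Inr k) = 0"
      proof -
        have "(\<chi> k. z $ Inr k) $ k0 = 0" using that(1) by (simp add: S_def)
        moreover have "tangent_vector v w (\<chi> i. z $ Inl i) (\<chi> k. z $ Inr k) = 0"
          using that(2) by (simp add: L_def)
        ultimately show "(\<chi> i. z $ Inl i) = 0" "(\<chi> k. z $ Inr k) = 0"
          using tangent_vector_determined[of "\<chi> k. z $ Inr k" "\<chi> i. z $ Inl i"] by simp_all
      qed
      then have "z $ a = 0" for a by (cases a) (simp_all add: vec_eq_iff)
      then show ?thesis by (simp add: vec_eq_iff)
    qed
    then show ?thesis using vec.linear_inj_on_iff_eq_0[OF lin S] by blast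
  qed
  ultimately have "vec.dim (tangent_space segre_veronese_cone (segre_veronese v w)) = vec.dim S"
    using vec.dim_image_eq[OF lin, of S] S by (simp add: vec.span_eq_iff[THEN iffD2])
  also have "\<dots> = card (UNIV - {Inr k0 :: 'm + 'n})"
    unfolding S_def by (rule dim_substandard_cart)
  finally show ?thesis by (simp add: card_Diff_singleton)
qed

end

lemma smooth_point_segre_veronese_cone:
  "smooth_point segre_veronese_cone x \<longleftrightarrow> (\<exists>v w. v \<noteq> 0 \<and> w \<noteq> 0 \<and> x = segre_veronese v w)"
  for x :: "complex ^ ('m::finite uprod \<times> 'n::finite uprod)"
proof -
  have nonzero: "x \<in> segre_veronese_cone - {0} \<longleftrightarrow> (\<exists>v w. v \<noteq> 0 \<and> w \<noteq> 0 \<and> x = segre_veronese v w)"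
    for x :: "complex ^ ('m uprod \<times> 'n uprod)"
    by (auto simp: segre_veronese_cone_def) (metis segre_veronese_eq_0_iff)+
  have dim: "vec.dim (tangent_space segre_veronese_cone y) = CARD('m) + CARD('n) - 1"
    if ne: "y \<in> segre_veronese_cone - {0}" for y :: "complex ^ ('m uprod \<times> 'n uprod)"
  proof -
    obtain v w where y: "v \<noteq> 0" "w \<noteq> 0" "y = segre_veronese v w" using ne nonzero[of y] by blast
    then obtain i0 k0 where "v $ i0 \<noteq> 0" "w $ k0 \<noteq> 0" by (auto simp: vec_eq_iff)
    then show ?thesis unfolding y(3) by (rule dim_tangent_space_segre_veronese)
  qed
  have "\<forall>y\<in>segre_veronese_cone - {0}. vec.dim (tangent_space segre_veronese_cone x)
      \<le> vec.dim (tangent_space segre_veronese_cone (y :: complex ^ ('m uprod \<times> 'n uprod)))" if "x \<in> segre_veronese_cone - {0}"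
    using dim[OF that] dim by simp
  then show ?thesis unfolding smooth_point_def using nonzero[of x] by blast
qed

lemma tangent_hyperplane_iff_critical:
  "tangent_hyperplane segre_veronese_cone c \<longleftrightarrow> c \<noteq> 0 \<and> (\<exists>v w. v \<noteq> 0 \<and> w \<noteq> 0 \<and> critical c v w)"
proof -
  have "(\<forall>u\<in>tangent_space segre_veronese_cone (segre_veronese v w). pairing c u = 0) \<longleftrightarrow> critical c v w"
    if vw: "v \<noteq> 0" "w \<noteq> 0" for v w
  proof
    assume "\<forall>u\<in>tangent_space segre_veronese_cone (segre_veronese v w). pairing c u = 0"
    then show "critical c v w"
      unfolding critical_def using tangent_vector_in_tangent_space by blast
  next
    assume crit: "critical c v w"
    obtain i0 k0 where "v $ i0 \<noteq> 0" "w $ k0 \<noteq> 0" using vw by (auto simp: vec_eq_iff)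
    from tangent_space_segre_veronese[OF this]
    show "\<forall>u\<in>tangent_space segre_veronese_cone (segre_veronese v w). pairing c u = 0"
      using crit by (auto simp: critical_def)
  qed
  then show ?thesis
    unfolding tangent_hyperplane_def smooth_point_segre_veronese_cone pairing_def[symmetric] by blast
qed


section \<open>The irreducible set of singular forms\<close>

lemma exists_distinct:
  assumes "CARD('a::finite) \<ge> 2" shows "\<exists>i j :: 'a. i \<noteq> j"
proof (rule ccontr)
  assume "\<nexists>i j :: 'a. i \<noteq> j"
  then have "CARD('a) \<le> Suc 0" by (subst card_le_Suc0_iff_eq) auto
  then show False using assms by simp
qed

definition singular_forms :: "(complex ^ ('m::finite uprod \<times> 'n::finite uprod)) set" where
  "singular_forms = {c. \<exists>v w. v \<noteq> 0 \<and> w \<noteq> 0 \<and> critical c v w}"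

text \<open>
Suppose \<open>v $ i0 = w $ k0 = 1\<close>. The coefficients of \<open>x\<^sub>i\<^sub>0 x\<^sub>j y\<^sub>k\<^sub>0\<^sup>2\<close>, \<open>x\<^sub>i\<^sub>0\<^sup>2 y\<^sub>k\<^sub>0 y\<^sub>l\<close> and \<open>x\<^sub>i\<^sub>0\<^sup>2 y\<^sub>k\<^sub>0\<^sup>2\<close> are changed so that the
derivative in the direction \<open>x\<^sub>j\<close>, the derivative in the direction \<open>y\<^sub>l\<close>, and finally the value at
\<open>(v, w)\<close> become zero. The division by \<open>2\<close> occurs because \<open>Upair i0 j\<close> stands for two ordered pairs.
\<close>

definition make_critical ::
  "'m \<Rightarrow> 'n \<Rightarrow> complex ^ ('m uprod \<times> 'n uprod) \<Rightarrow> complex ^ 'm \<Rightarrow> complex ^ 'n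
    \<Rightarrow> complex ^ ('m::finite uprod \<times> 'n::finite uprod)" where
  "make_critical i0 k0 u v w =
     (let c = u - (\<Sum>j\<in>UNIV - {i0}. axis (Upair i0 j, Upair k0 k0) (pairing u (tangent_vector v w (axis j 1) 0) / 2))
                - (\<Sum>l\<in>UNIV - {k0}. axis (Upair i0 i0, Upair k0 l) (pairing u (tangent_vector v w 0 (axis l 1))))
      in c - axis (Upair i0 i0, Upair k0 k0) (pairing c (segre_veronese v w)))"

text \<open>
By Euler's relation the derivatives along \<open>v\<close> and along \<open>w\<close> are twice the value, and every direction is
a combination of these two and of directions with coordinates zero at \<open>i0\<close> and \<open>k0\<close>.
\<close>

lemma critical_normalised:
  fixes c :: "complex ^ ('m::finite uprod \<times> 'n::finite uprod)"
  assumes v: "v $ i0 = 1" and w: "w $ k0 = 1"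
    and c: "pairing c (segre_veronese v w) = 0"
    and cv: "\<And>v'. v' $ i0 = 0 \<Longrightarrow> pairing c (tangent_vector v w v' 0) = 0"
    and cw: "\<And>w'. w' $ k0 = 0 \<Longrightarrow> pairing c (tangent_vector v w 0 w') = 0"
  shows "critical c v w"
  unfolding critical_def
proof (intro allI)
  fix v' w'
  have "tangent_vector v w v' w' = (2 * (v' $ i0 + w' $ k0)) *s segre_veronese v w
      + tangent_vector v w (v' - v' $ i0 *s v) 0 + tangent_vector v w 0 (w' - w' $ k0 *s w)"
    by (rule vec_eq_uprodI) (auto simp: uprod_components algebra_simps)
  moreover have "(v' - v' $ i0 *s v) $ i0 = 0" "(w' - w' $ k0 *s w) $ k0 = 0"
    using v w by simp_all
  ultimately show "pairing c (tangent_vector v w v' w') = 0"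
    using c cv cw by (simp add: pairing_simps)
qed

lemma critical_segre_veronese:
  fixes c :: "complex ^ ('m::finite uprod \<times> 'n::finite uprod)"
  assumes "critical c v w" shows "pairing c (segre_veronese v w) = 0"
proof -
  have "tangent_vector v w v 0 = 2 *s segre_veronese v w"
    by (rule vec_eq_uprodI) (auto simp: uprod_components algebra_simps)
  then have "2 * pairing c (segre_veronese v w) = 0"
    using assms unfolding critical_def by (metis pairing_simps(5))
  then show ?thesis by simp
qed

lemma make_critical_if_critical:
  assumes "critical c v w" shows "make_critical i0 k0 c v w = c"
proof -
  have "pairing c (tangent_vector v w v' w') = 0" for v' w'
    using assms by (simp add: critical_def)
  then show ?thesis
    using critical_segre_veronese[OF assms]
    by (simp add: make_critical_def axis_eq_0_iff[THEN iffD2])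
qed

lemma critical_make_critical:
  fixes u :: "complex ^ ('m::finite uprod \<times> 'n::finite uprod)"
  assumes v: "v $ i0 = 1" and w: "w $ k0 = 1"
  shows "critical (make_critical i0 k0 u v w) v w"
proof -
  define g where "g j = pairing u (tangent_vector v w (axis j 1) 0)" for j
  define h where "h l = pairing u (tangent_vector v w 0 (axis l 1))" for l
  define c where "c = u - (\<Sum>j\<in>UNIV - {i0}. axis (Upair i0 j, Upair k0 k0) (g j / 2))
                - (\<Sum>l\<in>UNIV - {k0}. axis (Upair i0 i0, Upair k0 l) (h l))"
  have mc: "make_critical i0 k0 u v w = c - axis (Upair i0 i0, Upair k0 k0) (pairing c (segre_veronese v w))"
    by (simp add: make_critical_def c_def g_def h_def Let_def)
  have pair: "pairing c x = pairing u x - (\<Sum>j\<in>UNIV - {i0}. g j / 2 * x $ (Upair i0 j, Upair k0 k0))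
      - (\<Sum>l\<in>UNIV - {k0}. h l * x $ (Upair i0 i0, Upair k0 l))" for x
    unfolding c_def by (simp add: pairing_simps pairing_sum)
  show ?thesis
  proof (rule critical_normalised[of v i0 w k0, OF v w])
    show "pairing (make_critical i0 k0 u v w) (segre_veronese v w) = 0"
      unfolding mc by (simp add: pairing_simps segre_veronese_Upair v w)
  next
    fix v' :: "complex ^ 'm" assume v': "v' $ i0 = 0"
    have "pairing u (tangent_vector v w v' 0) = (\<Sum>j\<in>UNIV. v' $ j * g j)"
      unfolding g_def by (rule tangent_vector_basis)
    also have "\<dots> = (\<Sum>j\<in>UNIV - {i0}. v' $ j * g j)"
      by (rule sum.mono_neutral_right) (auto simp: v')
    also have "\<dots> = (\<Sum>j\<in>UNIV - {i0}. g j / 2 * tangent_vector v w v' 0 $ (Upair i0 j, Upair k0 k0))"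
      by (rule sum.cong) (auto simp: tangent_vector_Upair v w v')
    finally show "pairing (make_critical i0 k0 u v w) (tangent_vector v w v' 0) = 0"
      unfolding mc by (simp add: pairing_simps pair tangent_vector_Upair v w v')
  next
    fix w' :: "complex ^ 'n" assume w': "w' $ k0 = 0"
    have "pairing u (tangent_vector v w 0 w') = (\<Sum>l\<in>UNIV. w' $ l * h l)"
      unfolding h_def by (rule tangent_vector_basis)
    also have "\<dots> = (\<Sum>l\<in>UNIV - {k0}. w' $ l * h l)"
      by (rule sum.mono_neutral_right) (auto simp: w')
    also have "\<dots> = (\<Sum>l\<in>UNIV - {k0}. h l * tangent_vector v w 0 w' $ (Upair i0 i0, Upair k0 l))"
      by (rule sum.cong) (auto simp: tangent_vector_Upair v w w')
    finally show "pairing (make_critical i0 k0 u v w) (tangent_vector v w 0 w') = 0"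
      unfolding mc by (simp add: pairing_simps pair tangent_vector_Upair v w w')
  qed
qed

text \<open>
The correction is a polynomial expression in the coefficients of \<open>u\<close> and the coordinates of \<open>v\<close> and \<open>w\<close>,
so it inherits any property closed under the ring operations. It is used for polynomiality and for
continuity.
\<close>

lemma make_critical_closure:
  fixes P :: "('a \<Rightarrow> complex) \<Rightarrow> bool" and u :: "'a \<Rightarrow> complex ^ ('m::finite uprod \<times> 'n::finite uprod)"
  assumes const: "\<And>c. P (\<lambda>a. c)"
    and add: "\<And>f g. P f \<Longrightarrow> P g \<Longrightarrow> P (\<lambda>a. f a + g a)"
    and mult: "\<And>f g. P f \<Longrightarrow> P g \<Longrightarrow> P (\<lambda>a. f a * g a)"
    and u: "\<And>x. P (\<lambda>a. u a $ x)" and v: "\<And>i. P (\<lambda>a. v a $ i)" and w: "\<And>k. P (\<lambda>a. w a $ k)"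
  shows "P (\<lambda>a. make_critical i0 k0 (u a) (v a) (w a) $ x)"
proof -
  have diff: "P (\<lambda>a. f a - g a)" if "P f" "P g" for f g
    using add[OF that(1) mult[OF const[of "-1"] that(2)]] by simp
  have sum: "P (\<lambda>a. \<Sum>j\<in>J. f j a)" if "\<And>j. P (f j)" for f :: "'b \<Rightarrow> _" and J :: "'b set"
    using that by (induction J rule: infinite_finite_induct) (auto intro: const add)
  have pairing: "P (\<lambda>a. pairing (c a) (x a))" if "\<And>i. P (\<lambda>a. c a $ i)" "\<And>i. P (\<lambda>a. x a $ i)"
    for c x :: "'a \<Rightarrow> complex ^ ('m uprod \<times> 'n uprod)"
    unfolding pairing_def
  proof -
    have "P (\<lambda>a. c a $ i * x a $ i)" for i by (intro mult that)
    then have "P (\<lambda>a. \<Sum>i\<in>I. c a $ i * x a $ i)" for I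
      by (induction I rule: infinite_finite_induct) (auto intro: const add)
    then show "P (\<lambda>a. \<Sum>i\<in>UNIV. c a $ i * x a $ i)" .
  qed
  have tv: "P (\<lambda>a. tangent_vector (v a) (w a) v' w' $ x)" for v' w' x
  proof -
    obtain i j k l where x: "x = (Upair i j, Upair k l)" by (rule uprod_pair_cases)
    show ?thesis unfolding x tangent_vector_Upair by (intro mult add const v w)
  qed
  have sv: "P (\<lambda>a. segre_veronese (v a) (w a) $ x)" for x
  proof -
    obtain i j k l where x: "x = (Upair i j, Upair k l)" by (rule uprod_pair_cases)
    show ?thesis unfolding x segre_veronese_Upair by (intro mult add const v w)
  qed
  have ax: "P (\<lambda>a. axis y (f a) $ x)" if "P f" for f and x y :: "'m uprod \<times> 'n uprod"
    using that by (cases "x = y") (auto simp: axis_def intro: const)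
  have half: "P (\<lambda>a. f a / 2)" if "P f" for f
    using mult[OF that const[of "1/2"]] by simp
  define c where "c a = u a - (\<Sum>j\<in>UNIV - {i0}. axis (Upair i0 j, Upair k0 k0) (pairing (u a) (tangent_vector (v a) (w a) (axis j 1) 0) / 2))
                - (\<Sum>l\<in>UNIV - {k0}. axis (Upair i0 i0, Upair k0 l) (pairing (u a) (tangent_vector (v a) (w a) 0 (axis l 1))))" for a
  have c: "P (\<lambda>a. c a $ x)" for x
    unfolding c_def vector_minus_component sum_component
    by (intro diff sum ax half pairing tv u)
  have "make_critical i0 k0 (u a) (v a) (w a) = c a - axis (Upair i0 i0, Upair k0 k0) (pairing (c a) (segre_veronese (v a) (w a)))" for a
    by (simp add: make_critical_def c_def Let_def)
  then show ?thesis
    by (simp only: vector_minus_component) (intro diff c ax pairing sv)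
qed

text \<open>
The corrected coefficients are uniquely determined: pairing with the tangent vector along one
coordinate axis, or with the point itself, isolates a single one of them.
\<close>

lemma critical_zero_if_supported:
  fixes d :: "complex ^ ('m::finite uprod \<times> 'n::finite uprod)"
  assumes v: "v $ i0 = 1" and w: "w $ k0 = 1" and crit: "critical d v w"
    and supp: "\<And>x. (\<And>j. x \<noteq> (Upair i0 j, Upair k0 k0)) \<Longrightarrow> (\<And>l. x \<noteq> (Upair i0 i0, Upair k0 l)) \<Longrightarrow> d $ x = 0"
  shows "d = 0"
proof -
  have single: "d $ y * x $ y = 0" if "pairing d x = 0" "\<And>a. a \<noteq> y \<Longrightarrow> d $ a * x $ a = 0" for x y
  proof -
    have "pairing d x = d $ y * x $ y + (\<Sum>a\<in>UNIV - {y}. d $ a * x $ a)"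
      unfolding pairing_def by (rule sum.remove) auto
    also have "(\<Sum>a\<in>UNIV - {y}. d $ a * x $ a) = 0"
      by (rule sum.neutral) (use that(2) in auto)
    finally show ?thesis using that(1) by simp
  qed
  have s: "d $ (Upair i0 j, Upair k0 k0) = 0" if "j \<noteq> i0" for j
  proof -
    have "d $ (Upair i0 j, Upair k0 k0) * tangent_vector v w (axis j 1) 0 $ (Upair i0 j, Upair k0 k0) = 0"
    proof (rule single)
      show "pairing d (tangent_vector v w (axis j 1) 0) = 0" using crit by (simp add: critical_def)
      fix a assume a: "a \<noteq> (Upair i0 j, Upair k0 k0)"
      show "d $ a * tangent_vector v w (axis j 1) 0 $ a = 0"
      proof (cases "d $ a = 0")
        case False
        then consider j' where "a = (Upair i0 j', Upair k0 k0)" "j' \<noteq> j" | l where "a = (Upair i0 i0, Upair k0 l)"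
          using supp a by metis
        then show ?thesis
          by cases (use that in \<open>auto simp: tangent_vector_Upair axis_def\<close>)
      qed simp
    qed
    then show ?thesis using that by (auto simp: tangent_vector_Upair v w axis_def)
  qed
  have t: "d $ (Upair i0 i0, Upair k0 l) = 0" if "l \<noteq> k0" for l
  proof -
    have "d $ (Upair i0 i0, Upair k0 l) * tangent_vector v w 0 (axis l 1) $ (Upair i0 i0, Upair k0 l) = 0"
    proof (rule single)
      show "pairing d (tangent_vector v w 0 (axis l 1)) = 0" using crit by (simp add: critical_def)
      fix a assume a: "a \<noteq> (Upair i0 i0, Upair k0 l)"
      show "d $ a * tangent_vector v w 0 (axis l 1) $ a = 0"
      proof (cases "d $ a = 0")
        case False
        then consider j' where "a = (Upair i0 j', Upair k0 k0)" | l' where "a = (Upair i0 i0, Upair k0 l')" "l' \<noteq> l"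
          using supp a by metis
        then show ?thesis
          by cases (use that in \<open>auto simp: tangent_vector_Upair axis_def\<close>)
      qed simp
    qed
    then show ?thesis using that by (auto simp: tangent_vector_Upair v w axis_def)
  qed
  have rest: "d $ a = 0" if "a \<noteq> (Upair i0 i0, Upair k0 k0)" for a
    using supp[of a] s t that by metis
  have "d $ (Upair i0 i0, Upair k0 k0) * segre_veronese v w $ (Upair i0 i0, Upair k0 k0) = 0"
    by (rule single[OF critical_segre_veronese[OF crit]]) (simp add: rest)
  then have "d $ (Upair i0 i0, Upair k0 k0) = 0" by (simp add: segre_veronese_Upair v w)
  then have "d $ a = 0" for a using rest by metis
  then show ?thesis by (simp add: vec_eq_iff)
qed

text \<open>
The coordinates of \<open>z\<close> at the corrected positions are free to encode \<open>v\<close> and \<open>w\<close>, except the one at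
\<open>(Upair i0 i0, Upair k0 k0)\<close>, which is ignored. So the singular forms are parametrised by one
coordinate less than the dimension of the space of forms.
\<close>

definition singular_form_at :: "'m \<Rightarrow> 'n \<Rightarrow> complex ^ ('m uprod \<times> 'n uprod) \<Rightarrow> complex ^ ('m::finite uprod \<times> 'n::finite uprod)" where
  "singular_form_at i0 k0 z = make_critical i0 k0
     (\<chi> x. if x = (Upair i0 i0, Upair k0 k0) then 0 else z $ x)
     (\<chi> j. if j = i0 then 1 else z $ (Upair i0 j, Upair k0 k0))
     (\<chi> l. if l = k0 then 1 else z $ (Upair i0 i0, Upair k0 l))"

lemma singular_form_at_in_singular_forms: "singular_form_at i0 k0 z \<in> singular_forms"
proof -
  define v where "v = (\<chi> j. if j = i0 then 1 else z $ (Upair i0 j, Upair k0 k0))"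
  define w where "w = (\<chi> l. if l = k0 then 1 else z $ (Upair i0 i0, Upair k0 l))"
  have "v $ i0 = 1" "w $ k0 = 1" by (simp_all add: v_def w_def)
  moreover from this have "v \<noteq> 0" "w \<noteq> 0" by (metis zero_index zero_neq_one)+
  moreover have "critical (singular_form_at i0 k0 z) v w"
    unfolding singular_form_at_def v_def[symmetric] w_def[symmetric]
    by (rule critical_make_critical) (use calculation in auto)
  ultimately show ?thesis unfolding singular_forms_def by blast
qed

lemma polyfun_singular_form_at: "polyfun (\<lambda>z. singular_form_at i0 k0 z $ x)"
  unfolding singular_form_at_def
proof (rule make_critical_closure[where P = polyfun])
  have if_intro: "polyfun (\<lambda>z. if b then f z else g z)" if "polyfun f" "polyfun g" for b f g
    using that by (cases b) auto
  show "polyfun (\<lambda>z. (\<chi> x. if x = (Upair i0 i0, Upair k0 k0) then 0 else z $ x) $ x)" for x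
    unfolding vec_lambda_beta by (intro if_intro polyfun_intros)
  show "polyfun (\<lambda>z. (\<chi> j. if j = i0 then 1 else z $ (Upair i0 j, Upair k0 k0)) $ j)" for j
    unfolding vec_lambda_beta by (intro if_intro polyfun_intros)
  show "polyfun (\<lambda>z. (\<chi> l. if l = k0 then 1 else z $ (Upair i0 i0, Upair k0 l)) $ l)" for l
    unfolding vec_lambda_beta by (intro if_intro polyfun_intros)
qed (intro polyfun_intros; assumption)+

lemma singular_form_at_ignores_coordinate:
  "singular_form_at i0 k0 (z + s *s axis (Upair i0 i0, Upair k0 k0) 1) = singular_form_at i0 k0 z"
proof -
  have "(\<chi> x. if x = (Upair i0 i0, Upair k0 k0) then 0 else (z + s *s axis (Upair i0 i0, Upair k0 k0) 1) $ x)
      = (\<chi> x. if x = (Upair i0 i0, Upair k0 k0) then 0 else z $ x)"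
    "(\<chi> j. if j = i0 then 1 else (z + s *s axis (Upair i0 i0, Upair k0 k0) 1) $ (Upair i0 j, Upair k0 k0))
      = (\<chi> j. if j = i0 then 1 else z $ (Upair i0 j, Upair k0 k0))"
    "(\<chi> l. if l = k0 then 1 else (z + s *s axis (Upair i0 i0, Upair k0 k0) 1) $ (Upair i0 i0, Upair k0 l))
      = (\<chi> l. if l = k0 then 1 else z $ (Upair i0 i0, Upair k0 l))"
    by (auto simp: vec_eq_iff axis_def)
  then show ?thesis unfolding singular_form_at_def by (simp only:)
qed

lemma in_range_singular_form_at:
  fixes c :: "complex ^ ('m::finite uprod \<times> 'n::finite uprod)"
  assumes crit: "critical c v w" and v: "v $ i0 \<noteq> 0" and w: "w $ k0 \<noteq> 0"
  shows "c \<in> range (singular_form_at i0 k0)"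
proof -
  define v1 where "v1 = inverse (v $ i0) *s v"
  define w1 where "w1 = inverse (w $ k0) *s w"
  have v1: "v1 $ i0 = 1" and w1: "w1 $ k0 = 1" using v w by (simp_all add: v1_def w1_def)
  have crit1: "critical c v1 w1" unfolding v1_def w1_def by (rule critical_scale_point[OF crit])
  define z where "z = (\<chi> x. if \<exists>j. x = (Upair i0 j, Upair k0 k0) then v1 $ (THE j. x = (Upair i0 j, Upair k0 k0))
    else if \<exists>l. x = (Upair i0 i0, Upair k0 l) then w1 $ (THE l. x = (Upair i0 i0, Upair k0 l)) else c $ x)"
  have zs: "z $ (Upair i0 j, Upair k0 k0) = v1 $ j" for j
  proof -
    have "(THE j'. (Upair i0 j, Upair k0 k0) = (Upair i0 j', Upair k0 k0)) = j" by (rule the_equality) auto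
    then show ?thesis by (auto simp: z_def)
  qed
  have zt: "z $ (Upair i0 i0, Upair k0 l) = w1 $ l" if "l \<noteq> k0" for l
  proof -
    have "(THE l'. (Upair i0 i0, Upair k0 l) = (Upair i0 i0, Upair k0 l')) = l" by (rule the_equality) auto
    then show ?thesis using that by (auto simp: z_def)
  qed
  have zo: "z $ x = c $ x" if "\<And>j. x \<noteq> (Upair i0 j, Upair k0 k0)" "\<And>l. x \<noteq> (Upair i0 i0, Upair k0 l)" for x
    using that by (auto simp: z_def)
  define u where "u = (\<chi> x. if x = (Upair i0 i0, Upair k0 k0) then 0 else z $ x)"
  have "(\<chi> j. if j = i0 then 1 else z $ (Upair i0 j, Upair k0 k0)) = v1"
    by (auto simp: vec_eq_iff zs v1)
  moreover have "(\<chi> l. if l = k0 then 1 else z $ (Upair i0 i0, Upair k0 l)) = w1"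
    by (auto simp: vec_eq_iff zt w1)
  ultimately have p: "singular_form_at i0 k0 z = make_critical i0 k0 u v1 w1"
    unfolding singular_form_at_def u_def by (simp only:)
  have "c - singular_form_at i0 k0 z = 0"
  proof (rule critical_zero_if_supported[OF v1 w1])
    have "critical (singular_form_at i0 k0 z) v1 w1" unfolding p by (rule critical_make_critical[OF v1 w1])
    then show "critical (c - singular_form_at i0 k0 z) v1 w1"
      using crit1 by (simp add: critical_def pairing_simps)
    fix x assume x: "\<And>j. x \<noteq> (Upair i0 j, Upair k0 k0)" "\<And>l. x \<noteq> (Upair i0 i0, Upair k0 l)"
    then have "make_critical i0 k0 u v1 w1 $ x = u $ x"
      by (auto simp: make_critical_def Let_def axis_def)
    then show "(c - singular_form_at i0 k0 z) $ x = 0"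
      unfolding p using zo[OF x] x by (simp add: u_def)
  qed
  then show ?thesis by (metis eq_iff_diff_eq_0 rangeI)
qed

text \<open>
A form that is singular at \<open>(v, w)\<close> with \<open>v $ i0 = 0\<close> or \<open>w $ k0 = 0\<close> is a limit of parametrised ones:
move the singular point slightly and correct the form in another chart \<open>(i1, k1)\<close>.
\<close>

lemma polyfun_zero_on_singular_forms:
  fixes f :: "complex ^ ('m::finite uprod \<times> 'n::finite uprod) \<Rightarrow> complex"
  assumes f: "polyfun f" and f0: "\<And>z. f (singular_form_at i0 k0 z) = 0" and c: "c \<in> singular_forms"
  shows "f c = 0"
proof -
  obtain v0 w0 where vw0: "v0 \<noteq> 0" "w0 \<noteq> 0" "critical c v0 w0" using c by (auto simp: singular_forms_def)
  then obtain i1 k1 where ik: "v0 $ i1 \<noteq> 0" "w0 $ k1 \<noteq> 0" by (auto simp: vec_eq_iff)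
  define v where "v = inverse (v0 $ i1) *s v0"
  define w where "w = inverse (w0 $ k1) *s w0"
  have v: "v $ i1 = 1" and w: "w $ k1 = 1" using ik by (simp_all add: v_def w_def)
  have crit: "critical c v w" unfolding v_def w_def by (rule critical_scale_point[OF vw0(3)])
  define a :: "complex ^ 'm" where "a = (if v $ i0 = 0 then axis i0 1 else 0)"
  define b :: "complex ^ 'n" where "b = (if w $ k0 = 0 then axis k0 1 else 0)"
  define C where "C \<epsilon> = make_critical i1 k1 c (v + \<epsilon> *s a) (w + \<epsilon> *s b)" for \<epsilon>
  have zero: "f (C \<epsilon>) = 0" if "\<epsilon> \<noteq> 0" for \<epsilon>
  proof -
    have "(v + \<epsilon> *s a) $ i1 = 1" "(w + \<epsilon> *s b) $ k1 = 1"
      using v w by (auto simp: a_def b_def axis_def)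
    then have "critical (C \<epsilon>) (v + \<epsilon> *s a) (w + \<epsilon> *s b)"
      unfolding C_def by (rule critical_make_critical)
    moreover have "(v + \<epsilon> *s a) $ i0 \<noteq> 0" "(w + \<epsilon> *s b) $ k0 \<noteq> 0"
      using that by (auto simp: a_def b_def)
    ultimately have "C \<epsilon> \<in> range (singular_form_at i0 k0)" by (rule in_range_singular_form_at)
    then show ?thesis using f0 by auto
  qed
  have "continuous_on UNIV (\<lambda>\<epsilon>. \<chi> x. C \<epsilon> $ x)"
    unfolding C_def
    by (intro continuous_on_vec_lambda make_critical_closure[where P = "continuous_on UNIV"])
       (auto intro!: continuous_intros)
  then have "continuous_on UNIV (\<lambda>\<epsilon>. f (C \<epsilon>))"
    by (intro continuous_on_compose2[OF polyfun_continuous[OF f]]) auto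
  then have "((\<lambda>\<epsilon>. f (C \<epsilon>)) \<longlongrightarrow> f (C 0)) (at 0)"
    by (simp add: continuous_on_def)
  moreover have "((\<lambda>\<epsilon>. f (C \<epsilon>)) \<longlongrightarrow> 0) (at 0)"
    by (rule tendsto_eventually) (auto simp: eventually_at_filter zero)
  ultimately have "f (C 0) = 0" using tendsto_unique by (metis at_neq_bot)
  then show ?thesis using make_critical_if_critical[OF crit] by (simp add: C_def)
qed

text \<open>
A product that vanishes on the singular forms pulls back to a zero product on the parameter space.
\<close>

lemma singular_forms_prime:
  fixes f g :: "complex ^ ('m::finite uprod \<times> 'n::finite uprod) \<Rightarrow> complex"
  assumes f: "polyfun f" and g: "polyfun g" and fg: "\<forall>c\<in>singular_forms. f c * g c = 0"
  shows "(\<forall>c\<in>singular_forms. f c = 0) \<or> (\<forall>c\<in>singular_forms. g c = 0)"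
proof -
  obtain i0 :: 'm and k0 :: 'n where True by blast
  have "(\<forall>z. f (singular_form_at i0 k0 z) = 0) \<or> (\<forall>z. g (singular_form_at i0 k0 z) = 0)"
    by (rule polyfun_domain[OF polyfun_compose[OF f polyfun_singular_form_at] polyfun_compose[OF g polyfun_singular_form_at]])
       (use fg singular_form_at_in_singular_forms in blast)
  then show ?thesis using polyfun_zero_on_singular_forms f g by blast
qed

lemma singular_forms_in_hypersurface:
  "\<exists>f :: complex ^ ('m::finite uprod \<times> 'n::finite uprod) \<Rightarrow> complex.
     polyfun f \<and> (\<exists>z. f z \<noteq> 0) \<and> (\<forall>c\<in>singular_forms. f c = 0)"
proof -
  obtain i0 :: 'm and k0 :: 'n where True by blast
  obtain f where "polyfun f" "\<exists>z. f z \<noteq> 0" "\<forall>z. f (singular_form_at i0 k0 z) = 0"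
    using polynomial_map_missing_a_coordinate[of "singular_form_at i0 k0" "(Upair i0 i0, Upair k0 k0)",
      OF polyfun_singular_form_at singular_form_at_ignores_coordinate] by blast
  then show ?thesis using polyfun_zero_on_singular_forms by blast
qed

lemma singular_forms_scale: "c \<in> singular_forms \<Longrightarrow> a *s c \<in> singular_forms"
  unfolding singular_forms_def using critical_scale by blast

text \<open>
The homogeneous components of an equation of a cone are equations of the cone.
\<close>

lemma homogeneous_equation:
  fixes X :: "(complex ^ 'i) set"
  assumes cone: "\<And>a c. c \<in> X \<Longrightarrow> a *s c \<in> X"
    and f: "polyfun f" "\<exists>z. f z \<noteq> 0" "\<forall>c\<in>X. f c = 0"
  shows "\<exists>d h. homogeneous d h \<and> (\<exists>z. h z \<noteq> 0) \<and> (\<forall>c\<in>X. h c = 0)"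
proof -
  obtain n h where h: "\<And>k. homogeneous k (h k)" "\<And>z. f z = (\<Sum>k\<le>n. h k z)"
    using homogeneous_decomposition[OF f(1)] by blast
  have "h k c = 0" if "c \<in> X" "k \<le> n" for k c
  proof -
    have "(\<Sum>k\<le>n. h k c * a ^ k) = 0" for a
    proof -
      have "(\<Sum>k\<le>n. h k c * a ^ k) = f (a *s c)"
        unfolding h(2) using h(1) by (simp add: homogeneous_def mult.commute)
      then show ?thesis using cone[OF that(1)] f(3) by simp
    qed
    then show ?thesis using polyfun_eq_0[of "\<lambda>k. h k c" n] that(2) by blast
  qed
  moreover obtain k z where "k \<le> n" "h k z \<noteq> 0"
  proof -
    obtain z where "f z \<noteq> 0" using f(2) by blast
    then have "\<exists>k\<in>{..n}. h k z \<noteq> 0" unfolding h(2) by (metis sum.neutral)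
    then show ?thesis using that by auto
  qed
  ultimately show ?thesis using h(1) by blast
qed

text \<open>
For \<open>s \<noteq> 0\<close> the value at \<open>z + s e\<close> is \<open>s\<^sup>d h(e + z/s)\<close>, and \<open>h\<close> has no zero near \<open>e\<close>.
\<close>

lemma homogeneous_root_bound:
  fixes h :: "complex ^ 'i \<Rightarrow> complex"
  assumes h: "homogeneous d h" and e: "h e \<noteq> 0"
  shows "\<exists>M\<ge>0. \<forall>z s. h (z + s *s e) = 0 \<longrightarrow> norm s \<le> M * norm z"
proof -
  have "polyfun h" using h by (simp add: homogeneous_def)
  then have "open (h -` (- {0}))"
    by (intro open_vimage polyfun_continuous) auto
  then obtain \<epsilon> where \<epsilon>: "\<epsilon> > 0" "ball e \<epsilon> \<subseteq> h -` (- {0})"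
    using e by (metis ComplI open_contains_ball singletonD vimageI)
  have "norm s \<le> (1 / \<epsilon>) * norm z" if root: "h (z + s *s e) = 0" for z s
  proof (cases "s = 0")
    case False
    have "z + s *s e = s *s (e + inverse s *s z)"
      using False by (simp add: vec_eq_iff algebra_simps)
    then have "s ^ d * h (e + inverse s *s z) = 0"
      using root h unfolding homogeneous_def by metis
    then have "e + inverse s *s z \<notin> ball e \<epsilon>" using False \<epsilon>(2) by auto
    then have "\<epsilon> \<le> norm (inverse s *s z)" by (simp add: dist_norm)
    also have "norm (inverse s *s z) = norm z / norm s"
      by (simp add: norm_vec_def L2_set_def norm_mult power_mult_distrib real_sqrt_mult norm_inverse
          divide_inverse mult.commute flip: sum_distrib_left)
    finally show ?thesis using False \<epsilon>(1) by (simp add: field_simps)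
  qed (use \<epsilon> in simp)
  then show ?thesis using \<epsilon>(1) by (intro exI[of _ "1 / \<epsilon>"]) auto
qed

text \<open>
Tangent hyperplanes are nonzero by definition, and adding the form \<open>0\<close> does not change the Zariski
closure as it lies on the line through any nonzero singular form.
\<close>

lemma dual_variety_segre_veronese:
  assumes m: "CARD('m) \<ge> 2"
  shows "dual_variety segre_veronese_cone
    = zariski_closure (singular_forms :: (complex ^ ('m::finite uprod \<times> 'n::finite uprod)) set)"
proof -
  have tangent: "{c. tangent_hyperplane segre_veronese_cone c}
      = (singular_forms :: (complex ^ ('m::finite uprod \<times> 'n::finite uprod)) set) - {0}"
    by (auto simp: tangent_hyperplane_iff_critical singular_forms_def)
  obtain i j :: 'm where ij: "i \<noteq> j"
    using exists_distinct[OF m] by blast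
  define c0 :: "complex ^ ('m uprod \<times> 'n uprod)" where "c0 = axis (Upair i i, Upair undefined undefined) 1"
  have "critical c0 (axis j 1) (axis undefined 1)"
    unfolding critical_def c0_def pairing_axis tangent_vector_Upair using ij by (auto simp: axis_def)
  then have c0: "c0 \<in> singular_forms" unfolding singular_forms_def
    by (intro CollectI exI[of _ "axis j 1"] exI[of _ "axis undefined 1"]) (simp add: axis_eq_0_iff)
  have c0_nz: "c0 \<noteq> 0" by (simp add: c0_def axis_eq_0_iff)
  have "f 0 = 0" if f: "polyfun f" "\<forall>c\<in>singular_forms - {0}. f c = 0"
    for f :: "complex ^ ('m uprod \<times> 'n uprod) \<Rightarrow> complex"
  proof -
    obtain P where P: "\<And>s. f (0 + s *s c0) = poly P s" using polyfun_lineE[OF f(1)] by blast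
    have "poly P s = 0" if "s \<noteq> 0" for s
    proof -
      have "s *s c0 \<in> singular_forms - {0}" using singular_forms_scale[OF c0] that c0_nz by simp
      then show ?thesis using f(2) P[of s] by simp
    qed
    then have "poly (monom 1 1 * P) s = 0" for s by (cases "s = 0") (simp_all add: poly_monom)
    then have "monom 1 1 * P = 0" using poly_all_0_iff_0 by blast
    then have "P = 0" by simp
    then show ?thesis using P[of 0] by simp
  qed
  then have "\<forall>c\<in>singular_forms. f c = 0" if "polyfun f" "\<forall>c\<in>singular_forms - {0}. f c = 0"
    for f :: "complex ^ ('m uprod \<times> 'n uprod) \<Rightarrow> complex"
    using that by (metis Diff_iff singletonD)
  then have "zariski_closure (singular_forms - {0} :: (complex ^ ('m uprod \<times> 'n uprod)) set)
      = zariski_closure singular_forms"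
    unfolding zariski_closure_def by blast
  then show ?thesis unfolding dual_variety_def tangent .
qed


section \<open>Positive semidefinite quadratic forms\<close>

text \<open>
One step of completing the square. It is stated so that it also covers \<open>M a a = 0\<close>, where semidefiniteness
makes the whole row zero and the default value \<open>x / 0 = 0\<close> is the right one.
\<close>

lemma psd_eliminate:
  fixes M :: "'a \<Rightarrow> 'a \<Rightarrow> real"
  assumes "finite I" "a \<notin> I" and sym: "\<And>i j. M i j = M j i"
    and psd: "\<And>w. 0 \<le> (\<Sum>i\<in>insert a I. \<Sum>j\<in>insert a I. M i j * w i * w j)"
  defines "M' \<equiv> \<lambda>i j. M i j - M a i * M a j / M a a"
  shows "(\<Sum>i\<in>insert a I. \<Sum>j\<in>insert a I. M i j * w i * w j) =
      M a a * (w a + (\<Sum>i\<in>I. M a i * w i) / M a a)\<^sup>2 + (\<Sum>i\<in>I. \<Sum>j\<in>I. M' i j * w i * w j)" (is ?expand)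
    and "0 \<le> (\<Sum>i\<in>I. \<Sum>j\<in>I. M' i j * w i * w j)" (is ?psd)
    and "0 \<le> M a a"
    and "M a a = 0 \<Longrightarrow> i \<in> I \<Longrightarrow> M a i = 0"
proof -
  define Q where "Q w = (\<Sum>i\<in>insert a I. \<Sum>j\<in>insert a I. M i j * w i * w j)" for w
  define QI where "QI w = (\<Sum>i\<in>I. \<Sum>j\<in>I. M i j * w i * w j)" for w
  define B where "B w = (\<Sum>i\<in>I. M a i * w i)" for w
  have Q: "Q w = M a a * (w a)\<^sup>2 + 2 * w a * B w + QI w" for w
  proof -
    have "Q w = M a a * w a * w a + (\<Sum>j\<in>I. M a j * w a * w j) + ((\<Sum>i\<in>I. M i a * w i * w a) + QI w)"
      using assms(1,2) by (simp add: Q_def QI_def sum.distrib)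
    moreover have "(\<Sum>j\<in>I. M a j * w a * w j) = w a * B w" "(\<Sum>i\<in>I. M i a * w i * w a) = w a * B w"
      unfolding B_def sum_distrib_left by (auto intro!: sum.cong simp: sym[of _ a])
    ultimately show ?thesis by (simp add: power2_eq_square algebra_simps)
  qed
  have pos: "0 \<le> Q w" for w unfolding Q_def by (rule psd)
  have upd: "B (w(a := t)) = B w" "QI (w(a := t)) = QI w" for w t
    unfolding B_def QI_def using assms(2) by (auto intro!: sum.cong)
  show Maa: "0 \<le> M a a"
  proof -
    have "B (\<lambda>i. if i = a then 1 else 0) = 0" "QI (\<lambda>i. if i = a then 1 else 0) = 0"
      unfolding B_def QI_def using assms(2) by (auto intro!: sum.neutral)
    then show ?thesis using pos[of "\<lambda>i. if i = a then 1 else 0"] Q by simp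
  qed
  have zero: "B w = 0" if "M a a = 0" for w
  proof (rule ccontr)
    assume "B w \<noteq> 0"
    then have "Q (w(a := - (QI w + 1) / (2 * B w))) = -1"
      unfolding Q upd using that by (simp add: field_simps)
    then show False using pos by (metis less_le_not_le neg_0_le_iff_le zero_less_one not_one_le_zero)
  qed
  show "M a a = 0 \<Longrightarrow> i \<in> I \<Longrightarrow> M a i = 0"
  proof -
    assume "M a a = 0" "i \<in> I"
    have "B (\<lambda>j. if j = i then 1 else 0) = M a i"
      unfolding B_def using assms(1) \<open>i \<in> I\<close> by (simp add: if_distrib cong: if_cong)
    then show "M a i = 0" using zero[OF \<open>M a a = 0\<close>] by metis
  qed
  have Q': "(\<Sum>i\<in>I. \<Sum>j\<in>I. M' i j * w i * w j) = QI w - (B w)\<^sup>2 / M a a" for w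
  proof -
    have "(B w)\<^sup>2 / M a a = (\<Sum>i\<in>I. \<Sum>j\<in>I. M a i * M a j / M a a * w i * w j)"
      unfolding B_def power2_eq_square sum_product sum_divide_distrib by (intro sum.cong) auto
    then show ?thesis by (simp add: M'_def QI_def left_diff_distrib sum_subtractf)
  qed
  show ?expand
    unfolding Q' B_def[symmetric] Q_def[symmetric] Q
    using zero by (cases "M a a = 0") (auto simp: power2_eq_square field_simps)
  show ?psd
  proof -
    have "Q (w(a := - B w / M a a)) = QI w - (B w)\<^sup>2 / M a a"
      unfolding Q upd using zero by (cases "M a a = 0") (auto simp: power2_eq_square field_simps)
    then show ?thesis unfolding Q' using pos by metis
  qed
qed

lemma psd_sum_of_squares:
  fixes M :: "'a \<Rightarrow> 'a \<Rightarrow> real"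
  assumes "finite I" "\<And>i j. M i j = M j i"
    and "\<And>w. 0 \<le> (\<Sum>i\<in>I. \<Sum>j\<in>I. M i j * w i * w j)"
  shows "\<exists>(K::nat) l. \<forall>w. (\<Sum>i\<in>I. \<Sum>j\<in>I. M i j * w i * w j) = (\<Sum>r<K. (\<Sum>i\<in>I. l r i * w i)\<^sup>2)"
  using assms
proof (induction I arbitrary: M)
  case empty
  show ?case by (rule exI[of _ 0]) simp
next
  case (insert a I)
  define M' where "M' i j = M i j - M a i * M a j / M a a" for i j
  note elim = psd_eliminate[OF insert.hyps insert.prems, folded M'_def]
  have "M' i j = M' j i" for i j using insert.prems(1) by (simp add: M'_def mult.commute)
  then obtain K :: nat and l where l: "\<And>w. (\<Sum>i\<in>I. \<Sum>j\<in>I. M' i j * w i * w j) = (\<Sum>r<K. (\<Sum>i\<in>I. l r i * w i)\<^sup>2)"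
    using insert.IH[of M'] elim(2) by blast
  define m where "m r i = (case r of 0 \<Rightarrow> sqrt (M a a) * (if i = a then 1 else M a i / M a a)
      | Suc r \<Rightarrow> (if i = a then 0 else l r i))" for r i
  have restrict: "(\<Sum>i\<in>I. (if i = a then c i else d i) * w i) = (\<Sum>i\<in>I. d i * w i)" for c d w :: "'a \<Rightarrow> real"
    using insert.hyps by (intro sum.cong) auto
  have "(\<Sum>i\<in>insert a I. \<Sum>j\<in>insert a I. M i j * w i * w j) = (\<Sum>r<Suc K. (\<Sum>i\<in>insert a I. m r i * w i)\<^sup>2)" for w
  proof -
    have "(\<Sum>i\<in>insert a I. m (Suc r) i * w i) = (\<Sum>i\<in>I. l r i * w i)" for r
      using insert.hyps restrict[of "\<lambda>_. 0" "l r" w] by (simp add: m_def)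
    moreover have "(\<Sum>i\<in>insert a I. m 0 i * w i) = sqrt (M a a) * (w a + (\<Sum>i\<in>I. M a i * w i) / M a a)"
    proof -
      have "(\<Sum>i\<in>insert a I. m 0 i * w i) = sqrt (M a a) * (\<Sum>i\<in>insert a I. (if i = a then 1 else M a i / M a a) * w i)"
        unfolding sum_distrib_left by (simp add: m_def mult.assoc)
      also have "(\<Sum>i\<in>insert a I. (if i = a then 1 else M a i / M a a) * w i) = w a + (\<Sum>i\<in>I. M a i / M a a * w i)"
        using insert.hyps restrict[of "\<lambda>_. 1" "\<lambda>i. M a i / M a a" w] by simp
      finally show ?thesis by (simp add: sum_divide_distrib)
    qed
    ultimately show ?thesis
      unfolding elim(1) l sum.lessThan_Suc_shift by (simp add: power_mult_distrib elim(3))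
  qed
  then show ?case by blast
qed

text \<open>
A semidefinite form controls every linear form that vanishes on its zero set. In the induction the zero
set of the reduced form lifts to the one of \<open>M\<close> by choosing the eliminated variable so that its square
vanishes.
\<close>

lemma psd_dominates_linear_form:
  fixes M :: "'a \<Rightarrow> 'a \<Rightarrow> real"
  assumes "finite I" "\<And>i j. M i j = M j i"
    and "\<And>w. 0 \<le> (\<Sum>i\<in>I. \<Sum>j\<in>I. M i j * w i * w j)"
    and "\<And>w. (\<Sum>i\<in>I. \<Sum>j\<in>I. M i j * w i * w j) = 0 \<Longrightarrow> (\<Sum>i\<in>I. d i * w i) = 0"
  shows "\<exists>C\<ge>0. \<forall>w. (\<Sum>i\<in>I. d i * w i)\<^sup>2 \<le> C * (\<Sum>i\<in>I. \<Sum>j\<in>I. M i j * w i * w j)"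
  using assms
proof (induction I arbitrary: M d)
  case empty
  show ?case by (rule exI[of _ 0]) simp
next
  case (insert a I)
  define M' where "M' i j = M i j - M a i * M a j / M a a" for i j
  note elim = psd_eliminate[OF insert.hyps insert.prems(1,2), folded M'_def]
  define \<tau> where "\<tau> w = w a + (\<Sum>i\<in>I. M a i * w i) / M a a" for w
  define d' where "d' i = d i - d a * M a i / M a a" for i
  have split: "(\<Sum>i\<in>insert a I. d i * w i) = d a * \<tau> w + (\<Sum>i\<in>I. d' i * w i)" for w
  proof -
    have "(\<Sum>i\<in>I. d' i * w i) = (\<Sum>i\<in>I. d i * w i) - d a * ((\<Sum>i\<in>I. M a i * w i) / M a a)"
      by (simp add: d'_def left_diff_distrib sum_subtractf sum_divide_distrib sum_distrib_left mult.assoc)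
    then show ?thesis using insert.hyps by (simp add: \<tau>_def algebra_simps)
  qed
  have "M' i j = M' j i" for i j using insert.prems(1) by (simp add: M'_def mult.commute)
  moreover have "(\<Sum>i\<in>I. d' i * w i) = 0" if "(\<Sum>i\<in>I. \<Sum>j\<in>I. M' i j * w i * w j) = 0" for w
  proof -
    define u where "u = w(a := - (\<Sum>i\<in>I. M a i * w i) / M a a)"
    have same: "(\<Sum>i\<in>I. f i * u i) = (\<Sum>i\<in>I. f i * w i)" for f
      unfolding u_def using insert.hyps by (intro sum.cong) auto
    have "(\<Sum>i\<in>I. \<Sum>j\<in>I. M' i j * u i * u j) = (\<Sum>i\<in>I. \<Sum>j\<in>I. M' i j * w i * w j)"
      unfolding u_def using insert.hyps by (intro sum.cong) auto
    moreover have \<tau>: "\<tau> u = 0" unfolding \<tau>_def same by (simp add: u_def)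
    ultimately have "(\<Sum>i\<in>insert a I. \<Sum>j\<in>insert a I. M i j * u i * u j) = 0"
      unfolding elim(1) \<tau>_def[symmetric] using that by simp
    then have "(\<Sum>i\<in>insert a I. d i * u i) = 0" by (rule insert.prems(3))
    then show ?thesis unfolding split same \<tau> by simp
  qed
  ultimately obtain C where C: "C \<ge> 0" "\<And>w. (\<Sum>i\<in>I. d' i * w i)\<^sup>2 \<le> C * (\<Sum>i\<in>I. \<Sum>j\<in>I. M' i j * w i * w j)"
    using insert.IH[of M' d'] elim(2) by blast
  have da: "d a = 0" if "M a a = 0"
  proof -
    define u where "u i = (if i = a then 1 else 0 :: real)" for i
    have 0: "(\<Sum>i\<in>I. f i * u i) = 0" for f using insert.hyps by (intro sum.neutral) (auto simp: u_def)
    have "(\<Sum>i\<in>I. \<Sum>j\<in>I. M' i j * u i * u j) = 0"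
      using insert.hyps by (intro sum.neutral) (auto simp: u_def)
    then have "(\<Sum>i\<in>insert a I. \<Sum>j\<in>insert a I. M i j * u i * u j) = 0"
      unfolding elim(1) using that by simp
    then have "(\<Sum>i\<in>insert a I. d i * u i) = 0" by (rule insert.prems(3))
    then show ?thesis using insert.hyps by (simp add: 0) (simp add: u_def)
  qed
  define E where "E = (if M a a = 0 then 0 else 2 * (d a)\<^sup>2 / M a a)"
  have "(\<Sum>i\<in>insert a I. d i * w i)\<^sup>2 \<le> (E + 2 * C) * (\<Sum>i\<in>insert a I. \<Sum>j\<in>insert a I. M i j * w i * w j)" for w
  proof -
    define Q' where "Q' = (\<Sum>i\<in>I. \<Sum>j\<in>I. M' i j * w i * w j)"
    have Q': "0 \<le> Q'" unfolding Q'_def by (rule elim(2))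
    have E: "E \<ge> 0" using elim(3) by (simp add: E_def)
    have "(d a * \<tau> w + (\<Sum>i\<in>I. d' i * w i))\<^sup>2 \<le> 2 * (d a * \<tau> w)\<^sup>2 + 2 * (\<Sum>i\<in>I. d' i * w i)\<^sup>2"
      using sum_squares_bound[of "d a * \<tau> w" "\<Sum>i\<in>I. d' i * w i"] unfolding power2_sum by linarith
    also have "2 * (d a * \<tau> w)\<^sup>2 = E * (M a a * (\<tau> w)\<^sup>2)"
      using da by (simp add: E_def power_mult_distrib)
    also have "2 * (\<Sum>i\<in>I. d' i * w i)\<^sup>2 \<le> 2 * C * Q'" using C(2)[of w] by (simp add: Q'_def)
    also have "E * (M a a * (\<tau> w)\<^sup>2) + 2 * C * Q' \<le> (E + 2 * C) * (M a a * (\<tau> w)\<^sup>2 + Q')"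
      using E C(1) Q' elim(3) by (simp add: algebra_simps)
    finally show ?thesis unfolding split elim(1) \<tau>_def[symmetric] Q'_def by simp
  qed
  moreover have "E + 2 * C \<ge> 0" using C(1) elim(3) by (simp add: E_def)
  ultimately show ?case by blast
qed

lemma biquad_form_pairing: "biquad_form T v w = pairing T (segre_veronese v w)"
  unfolding pairing_def by (rule segre_veronese_pairing[symmetric])

lemma pairing_inner: "pairing c x = c \<bullet> x" for c :: "real ^ 'i"
  by (simp add: pairing_def inner_vec_def)

lemma quad_form_matrix:
  fixes c :: "real ^ ('n::finite uprod)"
  shows "quad_form c w = (\<Sum>k\<in>UNIV. \<Sum>l\<in>UNIV. c $ Upair k l * (if k = l then 1 else 1/2) * w $ k * w $ l)"
proof -
  define g where "g q = c $ q * (if \<exists>k. q = Upair k k then 1 else 1/2)" for q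
  have g: "g (Upair k l) = c $ Upair k l * (if k = l then 1 else 1/2)" for k l by (auto simp: g_def)
  have "g q * sym_mult w w $ q = c $ q * mono2 w q" for q
    by (cases q) (auto simp: g sym_mult_Upair)
  then have "quad_form c w = (\<Sum>q\<in>UNIV. g q * sym_mult w w $ q)" by (simp add: quad_form_def)
  then show ?thesis unfolding sum_uprod_mult g by (simp add: mult_ac)
qed

lemma quad_form_zero:
  fixes c :: "real ^ ('n::finite uprod)"
  assumes "\<And>w. quad_form c w = 0" shows "c = 0"
proof -
  have 1: "c $ Upair k k = 0" for k
  proof -
    have "c $ q * mono2 (axis k 1) q = (if q = Upair k k then c $ q else 0 :: real)" for q
      by (cases q) (auto simp: axis_def)
    then show ?thesis using assms[of "axis k 1"] by (simp add: quad_form_def)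
  qed
  have 2: "c $ Upair k l = 0" if "k \<noteq> l" for k l
  proof -
    have "c $ q * mono2 (axis k 1 + axis l 1) q = (if q = Upair k l then c $ q else 0 :: real)" for q
      using that by (cases q) (auto simp: axis_def 1)
    then show ?thesis using assms[of "axis k 1 + axis l 1"] by (simp add: quad_form_def)
  qed
  have "c $ q = 0" for q by (cases q) (metis 1 2)
  then show ?thesis by (simp add: vec_eq_iff)
qed

lemma quad_form_linear:
  "quad_form (c - d) w = quad_form c w - quad_form d w" "quad_form 0 w = 0"
  "quad_form (c + d) w = quad_form c w + quad_form d w"
  for c d :: "real ^ ('n::finite uprod)"
  by (simp_all add: quad_form_def algebra_simps sum_subtractf sum.distrib)

lemma quad_form_sum: "quad_form (\<Sum>k<N. f k) w = (\<Sum>k<N. quad_form (f k) w)"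
  for f :: "nat \<Rightarrow> real ^ ('n::finite uprod)"
  by (induction N) (simp_all add: quad_form_linear)

text \<open>
The sum of squares is found by completing the square; it has the right coefficients because a
quadratic form determines them.
\<close>

lemma S_plus_iff: "c \<in> S_plus \<longleftrightarrow> (\<forall>w. 0 \<le> quad_form c w)"
  for c :: "real ^ ('n::finite uprod)"
proof
  assume "c \<in> S_plus"
  then obtain N u where "c = (\<Sum>k<(N::nat). sym_mult (u k) (u k))" by (auto simp: S_plus_def)
  then show "\<forall>w. 0 \<le> quad_form c w" by (simp add: quad_form_sum quad_form_square sum_nonneg)
next
  assume psd: "\<forall>w. 0 \<le> quad_form c w"
  define M where "M k l = c $ Upair k l * (if k = l then 1 else 1/2)" for k l
  have q: "quad_form c (\<chi> i. w i) = (\<Sum>k\<in>UNIV. \<Sum>l\<in>UNIV. M k l * w k * w l)" for w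
    by (simp add: quad_form_matrix M_def)
  have "M k l = M l k" for k l
  proof -
    have swap: "Upair k l = Upair l k" by simp
    show ?thesis unfolding M_def swap by auto
  qed
  then obtain K :: nat and h where h: "\<And>w. (\<Sum>k\<in>UNIV. \<Sum>l\<in>UNIV. M k l * w k * w l) = (\<Sum>r<K. (\<Sum>i\<in>UNIV. h r i * w i)\<^sup>2)"
  proof -
    have "0 \<le> (\<Sum>k\<in>UNIV. \<Sum>l\<in>UNIV. M k l * w k * w l)" for w using psd q[of w] by metis
    from psd_sum_of_squares[OF finite \<open>\<And>k l. M k l = M l k\<close> this] show thesis using that by blast
  qed
  define u where "u r = (\<chi> i. h r i)" for r
  have "quad_form (c - (\<Sum>r<K. sym_mult (u r) (u r))) w = 0" for w
  proof -
    have "quad_form c w = (\<Sum>r<K. (\<Sum>i\<in>UNIV. h r i * w $ i)\<^sup>2)"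
      using q[of "\<lambda>i. w $ i"] h[of "\<lambda>i. w $ i"] by simp
    then show ?thesis by (simp add: quad_form_linear quad_form_sum quad_form_square u_def)
  qed
  then have "c = (\<Sum>r<K. sym_mult (u r) (u r))" using quad_form_zero by (metis eq_iff_diff_eq_0)
  then show "c \<in> S_plus" unfolding S_plus_def by blast
qed

lemma Hom_AC_S_plus_iff:
  fixes T :: "real ^ ('m::finite uprod \<times> 'n::finite uprod)"
  shows "T \<in> Hom_AC S_plus S_plus \<longleftrightarrow> (\<forall>v w. 0 \<le> biquad_form T v w)"
proof
  assume T: "T \<in> Hom_AC S_plus S_plus"
  show "\<forall>v w. 0 \<le> biquad_form T v w"
  proof (intro allI)
    fix v :: "real ^ 'm" and w :: "real ^ 'n"
    have "sym_mult v v \<in> S_plus"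
      unfolding S_plus_def by (intro CollectI exI[of _ 1] exI[of _ "\<lambda>_. v"]) simp
    then have "lin_app T (sym_mult v v) \<in> S_plus" using T by (simp add: Hom_AC_def)
    then show "0 \<le> biquad_form T v w" by (simp add: S_plus_iff biquad_form_def)
  qed
next
  assume T: "\<forall>v w. 0 \<le> biquad_form T v w"
  show "T \<in> Hom_AC S_plus S_plus"
    unfolding Hom_AC_def
  proof (intro CollectI ballI)
    fix A :: "real ^ 'm uprod" assume "A \<in> S_plus"
    then obtain N u where A: "A = (\<Sum>k<(N::nat). sym_mult (u k) (u k))" by (auto simp: S_plus_def)
    have add: "lin_app T (a + b) = lin_app T a + lin_app T b" "lin_app T 0 = 0" for a b
      by (simp_all add: lin_app_def vec_eq_iff algebra_simps sum.distrib)
    have "lin_app T (\<Sum>k<N. sym_mult (u k) (u k)) = (\<Sum>k<N. lin_app T (sym_mult (u k) (u k)))"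
      by (induction N) (simp_all add: add)
    then have "quad_form (lin_app T A) w = (\<Sum>k<N. biquad_form T (u k) w)" for w
      unfolding A biquad_form_def by (simp add: quad_form_sum)
    then show "lin_app T A \<in> S_plus" using T by (simp add: S_plus_iff sum_nonneg)
  qed
qed


section \<open>The cone of nonnegative biquadratic forms\<close>

lemma continuous_on_segre_veronese:
  "continuous_on UNIV (\<lambda>p. segre_veronese (fst p) (snd p) :: real ^ ('m::finite uprod \<times> 'n::finite uprod))"
proof -
  have "continuous_on UNIV (\<lambda>p. \<chi> x. segre_veronese (fst p) (snd p) $ x :: real ^ ('m::finite uprod \<times> 'n::finite uprod))"
  proof (rule continuous_on_vec_lambda)
    fix x :: "'m uprod \<times> 'n uprod"
    obtain i j k l where x: "x = (Upair i j, Upair k l)" by (rule uprod_pair_cases)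
    show "continuous_on UNIV (\<lambda>p. segre_veronese (fst p) (snd p) $ x :: real)"
      unfolding x segre_veronese_Upair by (intro continuous_intros)
  qed
  then show ?thesis by simp
qed

lemma biquad_form_scale: "biquad_form T (a *s v) (b *s w) = (a * b)\<^sup>2 * biquad_form T v w"
  for T :: "'k::comm_ring_1 ^ ('m::finite uprod \<times> 'n::finite uprod)"
proof -
  have "segre_veronese (a *s v) (b *s w) = (a * b)\<^sup>2 *s segre_veronese v w"
    by (rule vec_eq_uprodI) (simp add: segre_veronese_Upair power2_eq_square mult_ac)
  then show ?thesis by (simp add: biquad_form_pairing pairing_simps)
qed

lemma biquad_form_zero [simp]: "biquad_form T 0 w = 0" "biquad_form T v 0 = 0"
  for T :: "'k::comm_ring_1 ^ ('m::finite uprod \<times> 'n::finite uprod)"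
proof -
  have "segre_veronese 0 w = (0 :: 'k ^ ('m uprod \<times> 'n uprod))" "segre_veronese v 0 = (0 :: 'k ^ ('m uprod \<times> 'n uprod))"
    by (rule vec_eq_uprodI; simp add: segre_veronese_Upair)+
  then show "biquad_form T 0 w = 0" "biquad_form T v 0 = 0" by (simp_all add: biquad_form_pairing pairing_simps)
qed

abbreviation (input) nonneg_biquad :: "(real ^ ('m::finite uprod \<times> 'n::finite uprod)) set" where
  "nonneg_biquad \<equiv> Hom_AC S_plus S_plus"

text \<open>
By compactness a positive form has a positive minimum on the product of the unit spheres, which
survives small perturbations and extends to all vectors by homogeneity.
\<close>

lemma interior_if_positive:
  fixes T :: "real ^ ('m::finite uprod \<times> 'n::finite uprod)"
  assumes pos: "\<And>v w. v \<noteq> 0 \<Longrightarrow> w \<noteq> 0 \<Longrightarrow> biquad_form T v w > 0"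
  shows "T \<in> interior nonneg_biquad"
proof -
  define S where "S = (sphere 0 1 :: (real ^ 'm) set) \<times> (sphere 0 1 :: (real ^ 'n) set)"
  have S: "compact S" unfolding S_def by (intro compact_Times compact_sphere)
  have "(axis undefined 1, axis undefined 1) \<in> S" by (simp add: S_def)
  then have ne: "S \<noteq> {}" by blast
  have cont: "continuous_on S (\<lambda>p. segre_veronese (fst p) (snd p) :: real ^ ('m uprod \<times> 'n uprod))"
    using continuous_on_segre_veronese continuous_on_subset by blast
  have "continuous_on S (\<lambda>p. T \<bullet> segre_veronese (fst p) (snd p))"
    by (intro continuous_on_inner continuous_on_const cont)
  then obtain p0 where p0: "p0 \<in> S" "\<And>p. p \<in> S \<Longrightarrow> T \<bullet> segre_veronese (fst p0) (snd p0) \<le> T \<bullet> segre_veronese (fst p) (snd p)"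
    using continuous_attains_inf[OF S ne, of "\<lambda>p. T \<bullet> segre_veronese (fst p) (snd p)"] by blast
  define m where "m = T \<bullet> segre_veronese (fst p0) (snd p0)"
  have "fst p0 \<noteq> 0" "snd p0 \<noteq> 0" using p0(1) by (auto simp: S_def)
  then have m: "m > 0" using pos by (simp add: m_def biquad_form_pairing pairing_inner)
  have "bounded ((\<lambda>p. segre_veronese (fst p) (snd p) :: real ^ ('m uprod \<times> 'n uprod)) ` S)"
    by (intro compact_imp_bounded compact_continuous_image cont S)
  then obtain B where B: "B > 0" "\<And>p. p \<in> S \<Longrightarrow> norm (segre_veronese (fst p) (snd p) :: real ^ ('m uprod \<times> 'n uprod)) \<le> B"
    unfolding bounded_pos by auto
  have "ball T (m / B) \<subseteq> nonneg_biquad"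
  proof
    fix U assume "U \<in> ball T (m / B)"
    then have U: "norm (T - U) < m / B" by (simp add: dist_norm)
    have sphere: "0 \<le> biquad_form U v w" if "(v, w) \<in> S" for v w
    proof -
      have "(T - U) \<bullet> segre_veronese v w \<le> norm (T - U) * norm (segre_veronese v w :: real ^ ('m uprod \<times> 'n uprod))"
        by (rule norm_cauchy_schwarz)
      also have "\<dots> \<le> m / B * B" using U B(2)[OF that] B(1) m by (intro mult_mono) auto
      also have "\<dots> = m" using B(1) by simp
      also have "m \<le> T \<bullet> segre_veronese v w" using p0(2)[OF that] by (simp add: m_def)
      finally show ?thesis by (simp add: biquad_form_pairing pairing_inner inner_diff_left)
    qed
    have "0 \<le> biquad_form U v w" for v w
    proof (cases "v = 0 \<or> w = 0")
      case False
      have "biquad_form U (norm v *s (inverse (norm v) *s v)) (norm w *s (inverse (norm w) *s w))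
          = (norm v * norm w)\<^sup>2 * biquad_form U (inverse (norm v) *s v) (inverse (norm w) *s w)"
        by (rule biquad_form_scale)
      moreover have "(inverse (norm v) *s v, inverse (norm w) *s w) \<in> S"
        using False by (simp add: S_def scalar_mult_eq_scaleR)
      ultimately show ?thesis using sphere False by (simp add: scalar_mult_eq_scaleR)
    qed auto
    then show "U \<in> nonneg_biquad" by (simp add: Hom_AC_S_plus_iff)
  qed
  then show ?thesis using m B(1) by (meson centre_in_ball divide_pos_pos interior_maximal open_ball subsetD)
qed

lemma closed_nonneg_biquad: "closed (nonneg_biquad :: (real ^ ('m::finite uprod \<times> 'n::finite uprod)) set)"
proof -
  have "nonneg_biquad = (\<Inter>v. \<Inter>w. {T :: real ^ ('m uprod \<times> 'n uprod). segre_veronese v w \<bullet> T \<ge> 0})"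
    by (auto simp: Hom_AC_S_plus_iff biquad_form_pairing pairing_inner inner_commute)
  then show ?thesis by (auto intro!: closed_INT closed_halfspace_ge)
qed

lemma linear_coefficient_zero:
  fixes b c :: real
  assumes "\<And>t. 0 \<le> t * b + t\<^sup>2 * c" shows "b = 0"
proof (rule ccontr)
  assume b: "b \<noteq> 0"
  define k where "k = \<bar>c\<bar> + 1"
  have k: "k > 0" "\<bar>c\<bar> = k - 1" by (simp_all add: k_def)
  define t where "t = - b / k"
  have "t * b + t\<^sup>2 * c \<le> t * b + t\<^sup>2 * \<bar>c\<bar>" by (simp add: mult_left_mono)
  also have "\<dots> = - (b\<^sup>2 / k\<^sup>2)"
    using k(1) unfolding k(2) by (simp add: t_def power2_eq_square field_simps)
  also have "\<dots> < 0" using b k(1) by simp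
  finally show False using assms[of t] by simp
qed

text \<open>
A zero of a nonnegative form is a minimum. It suffices to look at lines that move only \<open>v\<close> or only \<open>w\<close>,
on which the form is quadratic.
\<close>

lemma critical_if_zero:
  fixes T :: "real ^ ('m::finite uprod \<times> 'n::finite uprod)"
  assumes T: "T \<in> nonneg_biquad" and zero: "biquad_form T v w = 0"
  shows "critical T v w"
  unfolding critical_def
proof (intro allI)
  fix v' w'
  have nonneg: "0 \<le> pairing T (segre_veronese v w)" for v w
    using T by (simp add: Hom_AC_S_plus_iff biquad_form_pairing)
  have zero': "pairing T (segre_veronese v w) = 0" using zero by (simp add: biquad_form_pairing)
  have "segre_veronese (v + t *s v') w
      = segre_veronese v w + t *s tangent_vector v w v' 0 + t\<^sup>2 *s segre_veronese v' w" for t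
    by (rule vec_eq_uprodI) (simp add: uprod_components power2_eq_square algebra_simps)
  then have "0 \<le> t * pairing T (tangent_vector v w v' 0) + t\<^sup>2 * pairing T (segre_veronese v' w)" for t
    using nonneg[of "v + t *s v'" w] by (simp add: pairing_simps zero')
  then have 1: "pairing T (tangent_vector v w v' 0) = 0" by (rule linear_coefficient_zero)
  have "segre_veronese v (w + t *s w')
      = segre_veronese v w + t *s tangent_vector v w 0 w' + t\<^sup>2 *s segre_veronese v w'" for t
    by (rule vec_eq_uprodI) (simp add: uprod_components power2_eq_square algebra_simps)
  then have "0 \<le> t * pairing T (tangent_vector v w 0 w') + t\<^sup>2 * pairing T (segre_veronese v w')" for t
    using nonneg[of v "w + t *s w'"] by (simp add: pairing_simps zero')
  then have 2: "pairing T (tangent_vector v w 0 w') = 0" by (rule linear_coefficient_zero)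
  have "tangent_vector v w v' w' = tangent_vector v w v' 0 + tangent_vector v w 0 w'"
    using tangent_vector_linear(1)[of v w v' 0 0 w'] by simp
  then show "pairing T (tangent_vector v w v' w') = 0" using 1 2 by (simp add: pairing_simps)
qed

lemma complexify_simps:
  "complexify (x + y) = complexify x + complexify y" "complexify (a *s x) = of_real a *s complexify x"
  "complexify x $ i = of_real (x $ i)" "complexify x = 0 \<longleftrightarrow> x = 0"
  by (simp_all add: complexify_def vec_eq_iff)

lemma critical_complexify:
  fixes T :: "real ^ ('m::finite uprod \<times> 'n::finite uprod)"
  assumes "critical T v w"
  shows "critical (complexify T) (complexify v) (complexify w)"
  unfolding critical_def
proof (intro allI)
  fix v' w'
  have real: "pairing (complexify T) (tangent_vector (complexify v) (complexify w) (complexify a) (complexify b)) = 0" for a b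
  proof -
    have "tangent_vector (complexify v) (complexify w) (complexify a) (complexify b) = complexify (tangent_vector v w a b)"
      by (rule vec_eq_uprodI) (simp add: tangent_vector_Upair complexify_simps)
    moreover have "pairing (complexify T) (complexify x) = of_real (pairing T x)" for x
      by (simp add: pairing_def complexify_simps)
    ultimately show ?thesis using assms by (simp add: critical_def)
  qed
  have split: "z = complexify (\<chi> i. Re (z $ i)) + \<i> *s complexify (\<chi> i. Im (z $ i))" for z :: "complex ^ 'x"
    by (simp add: vec_eq_iff complexify_simps complex_eq_iff)
  have "tangent_vector (complexify v) (complexify w) v' w'
      = tangent_vector (complexify v) (complexify w) (complexify (\<chi> i. Re (v' $ i))) (complexify (\<chi> i. Re (w' $ i)))
      + \<i> *s tangent_vector (complexify v) (complexify w) (complexify (\<chi> i. Im (v' $ i))) (complexify (\<chi> i. Im (w' $ i)))"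
    unfolding tangent_vector_linear[symmetric] by (simp add: split[symmetric])
  then show "pairing (complexify T) (tangent_vector (complexify v) (complexify w) v' w') = 0"
    by (simp add: pairing_simps real)
qed

lemma frontier_has_zero:
  assumes "T \<in> frontier nonneg_biquad"
  shows "\<exists>v w. v \<noteq> 0 \<and> w \<noteq> 0 \<and> biquad_form T v w = 0"
proof -
  have T: "T \<in> nonneg_biquad" "T \<notin> interior nonneg_biquad"
    using assms by (auto simp: frontier_def closure_closed[OF closed_nonneg_biquad])
  then obtain v w where vw: "v \<noteq> 0" "w \<noteq> 0" "\<not> biquad_form T v w > 0"
    using interior_if_positive by blast
  then have "biquad_form T v w = 0" using T(1) by (simp add: Hom_AC_S_plus_iff) (metis antisym_conv2)
  then show ?thesis using vw by blast
qed

text \<open>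
Far out in the direction \<open>e\<close> the line is in the cone, because \<open>e + T/t\<close> is near \<open>e\<close>. Far out in the
direction \<open>-e\<close> it is not, because evaluation at a point \<open>x\<close> is positive on the interior of the cone.
\<close>

lemma translate_meets_frontier:
  fixes e T :: "real ^ ('m::finite uprod \<times> 'n::finite uprod)"
  assumes e: "e \<in> interior nonneg_biquad"
  shows "\<exists>t. T + t *\<^sub>R e \<in> frontier nonneg_biquad"
proof -
  define H where "H = (nonneg_biquad :: (real ^ ('m uprod \<times> 'n uprod)) set)"
  obtain \<epsilon> where \<epsilon>: "\<epsilon> > 0" "ball e \<epsilon> \<subseteq> H" using e unfolding mem_interior H_def by blast
  have cone: "c *\<^sub>R x \<in> H" if "x \<in> H" "c \<ge> 0" for c x
    using that by (simp add: H_def Hom_AC_S_plus_iff biquad_form_pairing pairing_inner)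
  define x :: "real ^ ('m uprod \<times> 'n uprod)" where "x = segre_veronese (axis undefined 1) (axis undefined 1)"
  have x: "norm x > 0"
  proof -
    have "x $ (Upair undefined undefined, Upair undefined undefined) = 1" by (simp add: x_def segre_veronese_Upair)
    then show ?thesis by (metis zero_index zero_neq_one zero_less_norm_iff)
  qed
  have dual: "y \<bullet> x \<ge> 0" if "y \<in> H" for y
    using that by (simp add: H_def x_def Hom_AC_S_plus_iff biquad_form_pairing pairing_inner)
  \<comment> \<open>\<open>e - d x\<close> is still in the cone, which makes the value of \<open>e\<close> at \<open>x\<close> strictly positive\<close>
  define d where "d = \<epsilon> / (2 * norm x)"
  have d: "d > 0" using \<epsilon> x by (simp add: d_def)
  have "e - d *\<^sub>R x \<in> H" using \<epsilon> x d by (intro subsetD[OF \<epsilon>(2)]) (simp add: dist_norm d_def)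
  then have "e \<bullet> x \<ge> d * (x \<bullet> x)" using dual by (fastforce simp: inner_diff_left)
  moreover have "d * (x \<bullet> x) > 0" using d x by simp
  ultimately have ex: "e \<bullet> x > 0" by linarith
  define L where "L = range (\<lambda>t. T + t *\<^sub>R e)"
  have "connected L"
    unfolding L_def by (intro connected_continuous_image continuous_intros) (simp add: connected_UNIV)
  moreover have "L \<inter> H \<noteq> {}"
  proof -
    define t where "t = norm T / \<epsilon> + 1"
    have t: "t > 0" using \<epsilon>(1) by (simp add: t_def add_nonneg_pos)
    have "norm T < t * \<epsilon>" using \<epsilon>(1) by (simp add: t_def field_simps)
    then have "e + (1 / t) *\<^sub>R T \<in> ball e \<epsilon>" using t by (simp add: dist_norm field_simps)
    then have "t *\<^sub>R (e + (1 / t) *\<^sub>R T) \<in> H" using \<epsilon>(2) t by (intro cone) auto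
    then have "T + t *\<^sub>R e \<in> H" using t by (simp add: scaleR_add_right add.commute)
    then show ?thesis by (auto simp: L_def)
  qed
  moreover have "L - H \<noteq> {}"
  proof -
    define t where "t = - (\<bar>T \<bullet> x\<bar> + 1) / (e \<bullet> x)"
    have "(T + t *\<^sub>R e) \<bullet> x < 0" using ex by (simp add: t_def inner_add_left)
    then have "T + t *\<^sub>R e \<notin> H" using dual by fastforce
    then show ?thesis by (auto simp: L_def)
  qed
  ultimately have "L \<inter> frontier H \<noteq> {}" by (rule connected_Int_frontier)
  then show ?thesis by (auto simp: L_def H_def)
qed

text \<open>
A polynomial that is nonzero at a real point \<open>x\<close> has only finitely many zeros on the line from a point of
\<open>S\<close> to \<open>x\<close>.
\<close>

lemma polyfun_nonzero_on_open:
  fixes p :: "complex ^ 'i \<Rightarrow> complex"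
  assumes p: "polyfun p" "\<exists>z. p z \<noteq> 0" and S: "open S" "S \<noteq> {}"
  shows "\<exists>x\<in>S. p (complexify x) \<noteq> 0"
proof -
  obtain r0 where r0: "r0 \<in> S" using S by blast
  obtain x where x: "p (complexify x) \<noteq> 0" using polyfun_zero_if_zero_on_reals[OF p(1)] p(2) by blast
  obtain P where P: "\<And>s. p (complexify r0 + s *s (complexify x - complexify r0)) = poly P s"
    using polyfun_lineE[OF p(1)] by blast
  have "poly P 1 \<noteq> 0" using P[of 1] x by simp
  then have fin: "finite {s. poly P s = 0}" by (intro poly_roots_finite) auto
  have "open ((\<lambda>s. r0 + s *\<^sub>R (x - r0)) -` S)"
    using S(1) by (intro open_vimage continuous_intros) auto
  moreover have "0 \<in> (\<lambda>s. r0 + s *\<^sub>R (x - r0)) -` S" using r0 by simp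
  ultimately have "infinite ((\<lambda>s. r0 + s *\<^sub>R (x - r0)) -` S)"
    using finite_imp_not_open by blast
  then have "infinite (complex_of_real ` ((\<lambda>s. r0 + s *\<^sub>R (x - r0)) -` S))"
    by (simp add: finite_image_iff inj_on_def)
  then have "\<not> complex_of_real ` ((\<lambda>s. r0 + s *\<^sub>R (x - r0)) -` S) \<subseteq> {s. poly P s = 0}"
    using fin finite_subset by blast
  then obtain s where s: "r0 + s *\<^sub>R (x - r0) \<in> S" "poly P (of_real s) \<noteq> 0" by blast
  have "complexify (r0 + s *\<^sub>R (x - r0)) = complexify r0 + of_real s *s (complexify x - complexify r0)"
    by (simp add: vec_eq_iff complexify_simps right_diff_distrib)
  then show ?thesis using s P by metis
qed

lemma sum_of_inner_squares_positive:
  fixes x :: "'a::finite \<Rightarrow> real ^ 'a"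
  assumes x: "inj x" "independent (range x)" and v: "v \<noteq> 0"
  shows "(\<Sum>a\<in>UNIV. (x a \<bullet> v)\<^sup>2) > 0"
proof -
  have "card (range x) = DIM(real ^ 'a)" using x(1) by (simp add: card_image)
  then have span: "UNIV \<subseteq> span (range x)"
    using x(2) card_eq_dim[of "range x" UNIV] by (simp add: dim_UNIV)
  have "(\<Sum>a\<in>UNIV. (x a \<bullet> v)\<^sup>2) \<noteq> 0"
  proof
    assume "(\<Sum>a\<in>UNIV. (x a \<bullet> v)\<^sup>2) = 0"
    then have "\<forall>a. x a \<bullet> v = 0" by (simp add: sum_nonneg_eq_0_iff)
    then have "orthogonal v b" if "b \<in> range x" for b using that by (auto simp: orthogonal_def inner_commute)
    then have "orthogonal v v" using span orthogonal_to_span[of v "range x" v] by auto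
    then show False using v by (simp add: orthogonal_def)
  qed
  then show ?thesis by (simp add: sum_nonneg less_le)
qed

lemma product_of_square_sums_positive:
  assumes "inj x" "independent (range x)" and "inj y" "independent (range y)"
    and "v \<noteq> 0" "w \<noteq> 0"
  shows "biquad_form (product_of_square_sums x y) v w > 0"
  unfolding biquad_form_product_of_square_sums
  using assms by (intro mult_pos_pos sum_of_inner_squares_positive)

text \<open>
Take \<open>p + i q\<close> with \<open>p, q\<close> dual to two of the given independent covectors: the sum of squares is
\<open>1 + i\<^sup>2\<close>.
\<close>

lemma isotropic_vector:
  fixes x :: "'m::finite \<Rightarrow> real ^ 'm"
  assumes m: "CARD('m) \<ge> 2" and x: "inj x" "independent (range x)"
  shows "\<exists>v. v \<noteq> 0 \<and> (\<Sum>a\<in>UNIV. (\<Sum>i\<in>UNIV. complexify (x a) $ i * v $ i)\<^sup>2) = 0"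
proof -
  obtain a b :: 'm where ab: "a \<noteq> b"
    using exists_distinct[OF m] by blast
  have dual: "\<exists>p. \<forall>b. x b \<bullet> p = (if b = a then 1 else 0)" for a
  proof -
    obtain g where g: "linear g" "\<And>b. b \<in> range x \<Longrightarrow> g b = (if b = x a then 1 else 0 :: real)"
      using linear_independent_extend[OF x(2), of "\<lambda>b. if b = x a then 1 else 0"] by blast
    have "x b \<bullet> (\<chi> i. g (axis i 1)) = g (x b)" for b
      by (subst linear_expand[OF g(1), of "x b"]) (simp add: inner_vec_def)
    moreover have "g (x b) = (if b = a then 1 else 0)" for b
      using g(2)[of "x b"] x(1) by (simp add: inj_eq)
    ultimately show ?thesis by metis
  qed
  obtain p q where p: "\<And>c. x c \<bullet> p = (if c = a then 1 else 0)" and q: "\<And>c. x c \<bullet> q = (if c = b then 1 else 0)"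
    using dual[of a] dual[of b] by blast
  define v where "v = complexify p + \<i> *s complexify q"
  have val: "(\<Sum>i\<in>UNIV. complexify (x c) $ i * v $ i) = (if c = a then 1 else 0) + \<i> * (if c = b then 1 else 0)" for c
  proof -
    have "(\<Sum>i\<in>UNIV. complexify (x c) $ i * v $ i) = of_real (x c \<bullet> p) + \<i> * of_real (x c \<bullet> q)"
      by (simp add: v_def complexify_simps inner_vec_def algebra_simps sum.distrib sum_distrib_left)
    then show ?thesis by (simp add: p q)
  qed
  have "(\<Sum>c\<in>UNIV. (\<Sum>i\<in>UNIV. complexify (x c) $ i * v $ i)\<^sup>2)
      = (\<Sum>c\<in>UNIV. (if c = a then 1 else 0) + (if c = b then - 1 else 0))"
    unfolding val using ab by (intro sum.cong) (auto simp: power2_eq_square)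
  also have "\<dots> = 0" by (simp add: sum.distrib)
  finally show ?thesis using val[of a] ab by (intro exI[of _ v]) auto
qed

text \<open>
The value is a product of two quadratic forms, and both vanish at a pair of isotropic vectors. Hence
the value is zero along every line through this pair that moves only one of the two vectors, and the
tangent vectors are combinations of points on such lines.
\<close>

lemma product_of_square_sums_singular:
  fixes x :: "'m::finite \<Rightarrow> real ^ 'm" and y :: "'n::finite \<Rightarrow> real ^ 'n"
  assumes "CARD('m) \<ge> 2" "CARD('n) \<ge> 2" and x: "inj x" "independent (range x)" and y: "inj y" "independent (range y)"
  shows "\<exists>v w. v \<noteq> 0 \<and> w \<noteq> 0 \<and> critical (complexify (product_of_square_sums x y)) v w"
proof -
  define A where "A v = (\<Sum>a\<in>UNIV. (\<Sum>i\<in>UNIV. complexify (x a) $ i * v $ i)\<^sup>2)" for v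
  define B where "B w = (\<Sum>b\<in>UNIV. (\<Sum>i\<in>UNIV. complexify (y b) $ i * w $ i)\<^sup>2)" for w
  obtain v where v: "v \<noteq> 0" "A v = 0" using isotropic_vector[OF assms(1) x] unfolding A_def by blast
  obtain w where w: "w \<noteq> 0" "B w = 0" using isotropic_vector[OF assms(2) y] unfolding B_def by blast
  define c where "c = complexify (product_of_square_sums x y)"
  have c: "c $ (p, q) = (\<Sum>a\<in>UNIV. mono2 (complexify (x a)) p) * (\<Sum>b\<in>UNIV. sym_mult (complexify (y b)) (complexify (y b)) $ q)" for p q
  proof -
    have "mono2 (complexify z) p = of_real (mono2 z p)" for z :: "real ^ 'm"
      by (cases p) (simp add: complexify_simps)
    moreover have "sym_mult (complexify z) (complexify z) $ q = of_real (sym_mult z z $ q)" for z :: "real ^ 'n"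
      by (cases q) (simp add: complexify_simps sym_mult_Upair)
    ultimately show ?thesis by (simp add: c_def complexify_simps product_of_square_sums_def)
  qed
  have factor: "pairing c (segre_veronese v w) = A v * B w" for v w
  proof -
    have "pairing c (segre_veronese v w) = (\<Sum>p\<in>UNIV. \<Sum>q\<in>UNIV. c $ (p, q) * segre_veronese v w $ (p, q))"
      unfolding pairing_def by (simp add: sum.cartesian_product case_prod_unfold flip: UNIV_Times_UNIV)
    also have "\<dots> = (\<Sum>p\<in>UNIV. (\<Sum>a\<in>UNIV. mono2 (complexify (x a)) p) * sym_mult v v $ p) *
        (\<Sum>q\<in>UNIV. (\<Sum>b\<in>UNIV. sym_mult (complexify (y b)) (complexify (y b)) $ q) * mono2 w q)"
      unfolding sum_product by (intro sum.cong refl) (simp add: c segre_veronese_def mult_ac)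
    also have "(\<Sum>p\<in>UNIV. (\<Sum>a\<in>UNIV. mono2 (complexify (x a)) p) * sym_mult v v $ p) = A v"
    proof -
      have "(\<Sum>p\<in>UNIV. (\<Sum>a\<in>UNIV. mono2 (complexify (x a)) p) * sym_mult v v $ p)
          = (\<Sum>a\<in>UNIV. \<Sum>p\<in>UNIV. mono2 (complexify (x a)) p * sym_mult v v $ p)"
        unfolding sum_distrib_right by (rule sum.swap)
      then show ?thesis by (simp add: mono2_sym_mult A_def)
    qed
    also have "(\<Sum>q\<in>UNIV. (\<Sum>b\<in>UNIV. sym_mult (complexify (y b)) (complexify (y b)) $ q) * mono2 w q) = B w"
    proof -
      have "(\<Sum>q\<in>UNIV. (\<Sum>b\<in>UNIV. sym_mult (complexify (y b)) (complexify (y b)) $ q) * mono2 w q)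
          = (\<Sum>b\<in>UNIV. quad_form (sym_mult (complexify (y b)) (complexify (y b))) w)"
        unfolding sum_distrib_right quad_form_def by (rule sum.swap)
      then show ?thesis by (simp add: quad_form_square B_def)
    qed
    finally show ?thesis .
  qed
  have "critical c v w"
    unfolding critical_def
  proof (intro allI)
    fix v' w'
    have "4 *s tangent_vector v w v' w' = 2 *s (segre_veronese (v + v') w - segre_veronese (v - v') w)
        + 2 *s (segre_veronese v (w + w') - segre_veronese v (w - w'))"
      by (rule vec_eq_uprodI) (simp add: uprod_components algebra_simps)
    then have "pairing c (4 *s tangent_vector v w v' w') = pairing c (2 *s (segre_veronese (v + v') w - segre_veronese (v - v') w)
        + 2 *s (segre_veronese v (w + w') - segre_veronese v (w - w')))" by simp
    then show "pairing c (tangent_vector v w v' w') = 0"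
      by (simp add: pairing_simps factor v w)
  qed
  then show ?thesis using v(1) w(1) unfolding c_def by blast
qed


section \<open>A plane slice bounded by a parabola and its tangent\<close>

text \<open>
With \<open>X = v\<^sub>i w\<^sub>k\<close>, \<open>Y = v\<^sub>j w\<^sub>l\<close>, \<open>U = v\<^sub>i w\<^sub>l\<close>, \<open>Z = v\<^sub>j w\<^sub>k\<close> this is the form
\<open>a X\<^sup>2 + 2 X Y + Y\<^sup>2 + b (U\<^sup>2 + Z\<^sup>2)\<close>, where \<open>X Y = U Z\<close>.
\<close>

definition slice :: "'m \<Rightarrow> 'm \<Rightarrow> 'n \<Rightarrow> 'n \<Rightarrow> real \<Rightarrow> real \<Rightarrow> real ^ ('m::finite uprod \<times> 'n::finite uprod)" where
  "slice i j k l a b = axis (Upair j j, Upair l l) 1 + axis (Upair i j, Upair k l) 1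
     + a *\<^sub>R axis (Upair i i, Upair k k) 1
     + b *\<^sub>R (axis (Upair i i, Upair l l) 1 + axis (Upair j j, Upair k k) 1)"

lemma slice_affine:
  "slice i j k l a b = slice i j k l 0 0 + a *\<^sub>R axis (Upair i i, Upair k k) 1
     + b *\<^sub>R (axis (Upair i i, Upair l l) 1 + axis (Upair j j, Upair k k) 1)"
  by (simp add: slice_def)

lemma biquad_form_slice:
  assumes "i \<noteq> j" "k \<noteq> l"
  shows "biquad_form (slice i j k l a b) v w =
    (v $ j * w $ l)\<^sup>2 + 2 * (v $ i * w $ l) * (v $ j * w $ k) + a * (v $ i * w $ k)\<^sup>2
      + b * ((v $ i * w $ l)\<^sup>2 + (v $ j * w $ k)\<^sup>2)"
  using assms
  by (simp add: biquad_form_pairing slice_def pairing_simps segre_veronese_Upair power2_eq_square algebra_simps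
      flip: scalar_mult_eq_scaleR)

text \<open>
As \<open>X Y = U Z\<close>, the mixed term can be distributed over two squares. For \<open>b \<ge> 1\<close> it is absorbed by
\<open>(U + Z)\<^sup>2\<close>. Otherwise its share \<open>b\<close> is absorbed by \<open>b (U + Z)\<^sup>2\<close> and the share \<open>1 - b\<close> by
\<open>(Y + (1 - b) X)\<^sup>2\<close>.
\<close>

lemma slice_in_cone:
  fixes i j :: "'m::finite" and k l :: "'n::finite"
  assumes ij: "i \<noteq> j" "k \<noteq> l" and ab: "b \<ge> 1 \<and> a \<ge> 0 \<or> b \<ge> 0 \<and> a \<ge> (1 - b)\<^sup>2"
  shows "slice i j k l a b \<in> Hom_AC S_plus S_plus"
  unfolding Hom_AC_S_plus_iff
proof (intro allI)
  fix v :: "real ^ 'm" and w :: "real ^ 'n"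
  define X where "X = v $ i * w $ k"
  define Y where "Y = v $ j * w $ l"
  define U where "U = v $ i * w $ l"
  define Z where "Z = v $ j * w $ k"
  have UZ: "U * Z = X * Y" by (simp add: X_def Y_def U_def Z_def mult_ac)
  have F: "biquad_form (slice i j k l a b) v w = Y\<^sup>2 + 2 * U * Z + a * X\<^sup>2 + b * (U\<^sup>2 + Z\<^sup>2)"
    unfolding biquad_form_slice[OF ij] X_def Y_def U_def Z_def by simp
  show "0 \<le> biquad_form (slice i j k l a b) v w"
    using ab
  proof
    assume ab: "b \<ge> 1 \<and> a \<ge> 0"
    have eq: "Y\<^sup>2 + 2 * U * Z + a * X\<^sup>2 + b * (U\<^sup>2 + Z\<^sup>2)
        = Y\<^sup>2 + a * X\<^sup>2 + (b - 1) * (U\<^sup>2 + Z\<^sup>2) + (U + Z)\<^sup>2"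
      by (simp add: power2_eq_square algebra_simps)
    show ?thesis unfolding F eq using ab by simp
  next
    assume ab: "b \<ge> 0 \<and> a \<ge> (1 - b)\<^sup>2"
    have "Y\<^sup>2 + 2 * U * Z + a * X\<^sup>2 + b * (U\<^sup>2 + Z\<^sup>2)
        = (a - (1 - b)\<^sup>2) * X\<^sup>2 + (Y + (1 - b) * X)\<^sup>2 + b * (U + Z)\<^sup>2 + 2 * (1 - b) * (U * Z - X * Y)"
      by (simp add: power2_eq_square algebra_simps)
    also have "\<dots> = (a - (1 - b)\<^sup>2) * X\<^sup>2 + (Y + (1 - b) * X)\<^sup>2 + b * (U + Z)\<^sup>2" using UZ by simp
    finally show ?thesis unfolding F using ab by simp
  qed
qed

text \<open>
The vectors are chosen such that \<open>U + Z = 0\<close>, \<open>Y + (1 - b) X = 0\<close> and \<open>X = 1\<close>, which leaves the value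
\<open>a - (1 - b)\<^sup>2\<close>.
\<close>

lemma slice_notin_cone:
  fixes i j :: "'m::finite" and k l :: "'n::finite"
  assumes ij: "i \<noteq> j" "k \<noteq> l" and ab: "b < 1" "a < (1 - b)\<^sup>2"
  shows "slice i j k l a b \<notin> Hom_AC S_plus S_plus"
proof
  assume "slice i j k l a b \<in> Hom_AC S_plus S_plus"
  then have nonneg: "0 \<le> biquad_form (slice i j k l a b) v w" for v w by (simp add: Hom_AC_S_plus_iff)
  define r where "r = sqrt (1 - b)"
  have r: "r * r = 1 - b" using ab by (simp add: r_def)
  define v :: "real ^ 'm" where "v = axis i 1 - r *\<^sub>R axis j 1"
  define w :: "real ^ 'n" where "w = axis k 1 + r *\<^sub>R axis l 1"
  have v: "v $ i = 1" "v $ j = - r" and w: "w $ k = 1" "w $ l = r"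
    using ij by (auto simp: v_def w_def axis_def)
  have "biquad_form (slice i j k l a b) v w = (r * r)\<^sup>2 - 2 * (r * r) + a + b * (2 * (r * r))"
    unfolding biquad_form_slice[OF ij] v w by (simp add: power2_eq_square algebra_simps)
  also have "\<dots> = a - (1 - b)\<^sup>2" unfolding r by (simp add: power2_eq_square algebra_simps)
  finally show False using nonneg ab by (metis diff_less_0_iff_less not_le)
qed

text \<open>
The coordinate \<open>s = a - (1 - b)\<^sup>2\<close> is the offset from the parabola. It is the outer variable of \<open>P\<close>, so that
the order of vanishing along the parabola is the order of \<open>P\<close> at \<open>0\<close>.
\<close>

lemma real_polynomial_on_parabola:
  assumes "real_polynomial_function g"
  shows "\<exists>P :: real poly poly. \<forall>b s. g (slice i j k l ((1 - b)\<^sup>2 + s) b) = poly (poly P [:s:]) b"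
  using assms
proof induction
  case (linear f)
  interpret bounded_linear f by (rule linear)
  define x where "x = f (slice i j k l 0 0)"
  define y where "y = f (axis (Upair i i, Upair k k) 1)"
  define z where "z = f (axis (Upair i i, Upair l l) 1 + axis (Upair j j, Upair k k) 1)"
  have "f (slice i j k l a b) = x + a * y + b * z" for a b
    unfolding slice_affine[of i j k l a b] add scaleR x_def y_def z_def by (simp add: add scaleR)
  then show ?case
    by (intro exI[of _ "[: [:x:] + smult y ([:1, -1:]\<^sup>2) + [:0, z:], [:y:] :]"])
       (simp add: power2_eq_square algebra_simps)
next
  case (const c)
  show ?case by (rule exI[of _ "[:[:c:]:]"]) simp
next
  case (add f g)
  then obtain P Q :: "real poly poly" where "\<And>b s. f (slice i j k l ((1 - b)\<^sup>2 + s) b) = poly (poly P [:s:]) b"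
    "\<And>b s. g (slice i j k l ((1 - b)\<^sup>2 + s) b) = poly (poly Q [:s:]) b" by metis
  then show ?case by (intro exI[of _ "P + Q"]) simp
next
  case (mult f g)
  then obtain P Q :: "real poly poly" where "\<And>b s. f (slice i j k l ((1 - b)\<^sup>2 + s) b) = poly (poly P [:s:]) b"
    "\<And>b s. g (slice i j k l ((1 - b)\<^sup>2 + s) b) = poly (poly Q [:s:]) b" by metis
  then show ?case by (intro exI[of _ "P * Q"]) simp
qed

lemma poly_poly_tendsto:
  fixes Q :: "real poly poly"
  shows "((\<lambda>s. poly (poly Q [:s:]) b) \<longlongrightarrow> poly (poly Q 0) b) (at 0 within A)"
proof (induction Q)
  case (pCons c Q)
  have "((\<lambda>s. poly c b + s * poly (poly Q [:s:]) b) \<longlongrightarrow> poly c b + 0 * poly (poly Q 0) b) (at 0 within A)"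
    by (intro tendsto_intros pCons.IH)
  then show ?case by simp
qed simp

text \<open>
The exponent \<open>d g\<close> is the order of vanishing of \<open>g\<close> along the parabola \<open>s = 0\<close>, and the factor \<open>q g\<close> is
nonzero at all but finitely many points of it. Near such a point with \<open>0 < b < 1\<close>, even exponents for
all \<open>g\<close> would put both sides of the parabola into the cone. Near such a point with \<open>b > 1\<close> both
sides are in the cone, and an odd exponent is impossible.
\<close>

lemma not_basic_closed_semialgebraic:
  assumes m: "CARD('m) \<ge> 2" and n: "CARD('n) \<ge> 2"
  shows "\<not> basic_closed_semialgebraic (Hom_AC S_plus S_plus :: (real ^ ('m::finite uprod \<times> 'n::finite uprod)) set)"
proof
  define H where "H = (Hom_AC S_plus S_plus :: (real ^ ('m uprod \<times> 'n uprod)) set)"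
  assume "basic_closed_semialgebraic (Hom_AC S_plus S_plus :: (real ^ ('m uprod \<times> 'n uprod)) set)"
  then obtain G where G: "finite G" "\<And>g. g \<in> G \<Longrightarrow> real_polynomial_function g" "H = {x. \<forall>g\<in>G. 0 \<le> g x}"
    unfolding basic_closed_semialgebraic_def H_def by blast
  obtain i j :: 'm where ij: "i \<noteq> j"
    using exists_distinct[OF m] by blast
  obtain k l :: 'n where kl: "k \<noteq> l"
    using exists_distinct[OF n] by blast
  define T where "T b s = slice i j k l ((1 - b)\<^sup>2 + s) b" for b s
  have "\<forall>g\<in>G. \<exists>P :: real poly poly. \<forall>b s. g (T b s) = poly (poly P [:s:]) b"
    using real_polynomial_on_parabola G(2) unfolding T_def by blast
  then obtain P :: "_ \<Rightarrow> real poly poly" where P: "\<And>g b s. g \<in> G \<Longrightarrow> g (T b s) = poly (poly (P g) [:s:]) b"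
    by metis
  define G' where "G' = {g \<in> G. P g \<noteq> 0}"
  have "\<forall>g\<in>G'. \<exists>d Q. P g = [:0, 1:] ^ d * Q \<and> poly Q 0 \<noteq> 0"
    using order_decomp[where a = 0] by (fastforce simp: G'_def poly_eq_0_iff_dvd)
  then obtain d Q where dQ: "\<And>g. g \<in> G' \<Longrightarrow> P g = [:0, 1:] ^ d g * Q g" "\<And>g. g \<in> G' \<Longrightarrow> poly (Q g) 0 \<noteq> 0"
    by metis
  define q where "q g b s = poly (poly (Q g) [:s:]) b" for g b s
  have val: "g (T b s) = s ^ d g * q g b s" if "g \<in> G'" for g b s
  proof -
    have "g (T b s) = poly (poly (P g) [:s:]) b" using that P by (simp add: G'_def)
    also have "\<dots> = s ^ d g * q g b s" unfolding dQ(1)[OF that] by (simp add: q_def poly_power)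
    finally show ?thesis .
  qed
  have q_tendsto: "((\<lambda>s. q g b s) \<longlongrightarrow> q g b 0) (at 0 within A)" for g b A
    unfolding q_def using poly_poly_tendsto[of "Q g" b A] by simp
  \<comment> \<open>the points of the parabola at which a cofactor vanishes\<close>
  define bad where "bad = (\<Union>g\<in>G'. {b. q g b 0 = 0})"
  have "finite {b. q g b 0 = 0}" if "g \<in> G'" for g
    using poly_roots_finite[OF dQ(2)[OF that]] by (simp add: q_def)
  then have "finite bad" unfolding bad_def using G(1) by (auto simp: G'_def)
  then have pick: "\<exists>b. x < b \<and> b < y \<and> b \<notin> bad" if "x < y" for x y :: real
  proof -
    have "\<not> {x<..<y} \<subseteq> bad" using infinite_Ioo[OF that] \<open>finite bad\<close> finite_subset by blast
    then show ?thesis by auto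
  qed
  obtain b0 where b0: "0 < b0" "b0 < 1" "b0 \<notin> bad" using pick[of 0 1] by auto
  obtain b1 where b1: "1 < b1" "b1 \<notin> bad" using pick[of 1 2] by auto
  have right: "\<forall>\<^sub>F s in at_right (0::real). 0 < s" by (simp add: eventually_at_right_less)
  have left: "\<forall>\<^sub>F s in at_left (0::real). s < 0" by (simp add: eventually_at_filter)
  have nonneg: "0 \<le> g (T b s)" if "g \<in> G'" "T b s \<in> H" for g b s
    using that G(3) by (auto simp: G'_def)
  have "\<exists>g\<in>G'. odd (d g)"
  proof (rule ccontr)
    assume "\<not> ?thesis"
    then have even: "even (d g)" if "g \<in> G'" for g using that by blast
    have pos: "q g b0 0 > 0" if g: "g \<in> G'" for g
    proof (rule ccontr)
      assume "\<not> q g b0 0 > 0"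
      then have "q g b0 0 < 0" using b0(3) g by (force simp: bad_def)
      then have "\<forall>\<^sub>F s in at_right 0. q g b0 s < 0" by (rule order_tendstoD(2)[OF q_tendsto])
      then have "\<forall>\<^sub>F s in at_right 0. q g b0 s < 0 \<and> 0 < s" using right by (rule eventually_conj)
      from eventually_happens'[OF trivial_limit_at_right_real this] obtain s where s: "q g b0 s < 0" "0 < s" by blast
      have "T b0 s \<in> H" unfolding T_def H_def by (rule slice_in_cone[OF ij kl]) (use s b0 in auto)
      then have "0 \<le> s ^ d g * q g b0 s" using nonneg[OF g] val[OF g] by metis
      then show False using mult_pos_neg[OF zero_less_power[OF s(2), of "d g"] s(1)] by simp
    qed
    have "\<forall>\<^sub>F s in at_left 0. \<forall>g\<in>G'. 0 < q g b0 s"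
      using G(1) pos by (intro eventually_ball_finite ballI order_tendstoD(1)[OF q_tendsto]) (auto simp: G'_def)
    then have "\<forall>\<^sub>F s in at_left 0. (\<forall>g\<in>G'. 0 < q g b0 s) \<and> s < 0" using left by (rule eventually_conj)
    from eventually_happens'[OF trivial_limit_at_left_real this] obtain s where s: "\<And>g. g \<in> G' \<Longrightarrow> 0 < q g b0 s" "s < 0" by blast
    have "T b0 s \<notin> H" unfolding T_def H_def by (rule slice_notin_cone[OF ij kl]) (use s b0 in auto)
    then obtain g where g: "g \<in> G" "g (T b0 s) < 0" using G(3) by (auto simp: not_le)
    show False
    proof (cases "g \<in> G'")
      case True
      then have "0 \<le> s ^ d g * q g b0 s"
        using s(1) even by (intro mult_nonneg_nonneg zero_le_even_power less_imp_le)
      then show False using g(2) val[OF True] by simp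
    next
      case False
      then show False using g(2) P[OF g(1), of b0 s] g(1) by (simp add: G'_def)
    qed
  qed
  then obtain g where g: "g \<in> G'" "odd (d g)" by blast
  have "q g b1 0 \<noteq> 0" using b1 g by (auto simp: bad_def)
  then consider "q g b1 0 > 0" | "q g b1 0 < 0" by linarith
  then show False
  proof cases
    case 1
    have "\<forall>\<^sub>F s in at_left 0. 0 < q g b1 s" by (rule order_tendstoD(1)[OF q_tendsto 1])
    moreover have "\<forall>\<^sub>F s in at_left 0. - ((1 - b1)\<^sup>2) < s"
      using b1 by (intro order_tendstoD(1)[OF tendsto_ident_at]) simp
    ultimately have "\<forall>\<^sub>F s in at_left 0. 0 < q g b1 s \<and> - ((1 - b1)\<^sup>2) < s \<and> s < 0"
      using left by (intro eventually_conj)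
    from eventually_happens'[OF trivial_limit_at_left_real this] obtain s where s: "0 < q g b1 s" "- ((1 - b1)\<^sup>2) < s" "s < 0" by blast
    have "T b1 s \<in> H" unfolding T_def H_def by (rule slice_in_cone[OF ij kl]) (use s b1 in auto)
    then have "0 \<le> s ^ d g * q g b1 s" using nonneg[OF g(1)] val[OF g(1)] by metis
    moreover have "s ^ d g < 0" using s(3) g(2) by (simp add: power_less_zero_eq)
    ultimately show False using mult_neg_pos[of "s ^ d g" "q g b1 s"] s(1) by linarith
  next
    case 2
    have "\<forall>\<^sub>F s in at_right 0. q g b1 s < 0" by (rule order_tendstoD(2)[OF q_tendsto 2])
    then have "\<forall>\<^sub>F s in at_right 0. q g b1 s < 0 \<and> 0 < s" using right by (rule eventually_conj)
    from eventually_happens'[OF trivial_limit_at_right_real this] obtain s where s: "q g b1 s < 0" "0 < s" by blast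
    have "T b1 s \<in> H" unfolding T_def H_def by (rule slice_in_cone[OF ij kl]) (use s b1 in auto)
    then have "0 \<le> s ^ d g * q g b1 s" using nonneg[OF g(1)] val[OF g(1)] by metis
    then show False using mult_pos_neg[OF zero_less_power[OF s(2), of "d g"] s(1)] by simp
  qed
qed

text \<open>
Let \<open>A\<close>, \<open>E\<^sub>1\<close>, \<open>E\<^sub>2\<close> be the quadratic forms of the pencil at \<open>a = 0, b = 1\<close> and of its two directions. The
edge \<open>a = 0, b \<ge> 1\<close> gives \<open>A, E\<^sub>2 \<ge> 0\<close>. The parabola gives \<open>A - \<sigma> E\<^sub>2 + \<sigma>\<^sup>2 E\<^sub>1 \<ge> 0\<close>, so \<open>E\<^sub>2\<close> vanishes where \<open>A\<close>
does, as \<open>\<sigma>\<close> tends to \<open>0\<close>. Consequently \<open>E\<^sub>2\<close> is dominated by a multiple of \<open>A\<close>, and the pencil stays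
semidefinite a little beyond the end of the edge, outside the cone.
\<close>

lemma not_spectrahedron:
  assumes m: "CARD('m) \<ge> 2" and n: "CARD('n) \<ge> 2"
  shows "\<not> spectrahedron (Hom_AC S_plus S_plus :: (real ^ ('m::finite uprod \<times> 'n::finite uprod)) set)"
proof
  define H where "H = (Hom_AC S_plus S_plus :: (real ^ ('m uprod \<times> 'n uprod)) set)"
  assume "spectrahedron (Hom_AC S_plus S_plus :: (real ^ ('m uprod \<times> 'n uprod)) set)"
  then obtain N :: nat and M0 M where sym0: "symmetric_matrix N M0" and sym: "\<And>i. symmetric_matrix N (M i)"
    and H: "H = {x. psd_matrix N (\<lambda>a b. M0 a b + (\<Sum>p\<in>UNIV. x $ p * M p a b))}"
    unfolding spectrahedron_def H_def by blast
  obtain i j :: 'm where ij: "i \<noteq> j"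
    using exists_distinct[OF m] by blast
  obtain k l :: 'n where kl: "k \<noteq> l"
    using exists_distinct[OF n] by blast
  define E1 :: "real ^ ('m uprod \<times> 'n uprod)" where "E1 = axis (Upair i i, Upair k k) 1"
  define E2 :: "real ^ ('m uprod \<times> 'n uprod)" where "E2 = axis (Upair i i, Upair l l) 1 + axis (Upair j j, Upair k k) 1"
  define x0 where "x0 = slice i j k l 0 1"
  define lin where "lin y a b = (if a < N \<and> b < N then \<Sum>p\<in>UNIV. y $ p * M p a b else 0)"
    for y :: "real ^ ('m uprod \<times> 'n uprod)" and a b
  define MA where "MA a b = (if a < N \<and> b < N then M0 a b else 0) + lin x0 a b" for a b
  define form where "form A u = (\<Sum>a<N. \<Sum>b<N. A a b * u a * u b)" for A :: "nat \<Rightarrow> nat \<Rightarrow> real" and u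
  have H_iff: "slice i j k l \<alpha> \<beta> \<in> H \<longleftrightarrow> (\<forall>u. 0 \<le> form MA u + \<alpha> * form (lin E1) u + (\<beta> - 1) * form (lin E2) u)" for \<alpha> \<beta>
  proof -
    have x: "slice i j k l \<alpha> \<beta> = x0 + \<alpha> *\<^sub>R E1 + (\<beta> - 1) *\<^sub>R E2"
      unfolding slice_affine[of i j k l \<alpha> \<beta>] x0_def slice_affine[of i j k l 0 1] E1_def E2_def
      by (simp add: algebra_simps)
    have "(\<Sum>a<N. \<Sum>b<N. u a * (M0 a b + (\<Sum>p\<in>UNIV. slice i j k l \<alpha> \<beta> $ p * M p a b)) * u b)
        = form MA u + \<alpha> * form (lin E1) u + (\<beta> - 1) * form (lin E2) u" for u
    proof -
      have "form MA u + \<alpha> * form (lin E1) u + (\<beta> - 1) * form (lin E2) u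
          = (\<Sum>a<N. \<Sum>b<N. (MA a b + \<alpha> * lin E1 a b + (\<beta> - 1) * lin E2 a b) * u a * u b)"
        by (simp add: form_def sum_distrib_left sum.distrib distrib_right mult.assoc)
      also have "\<dots> = (\<Sum>a<N. \<Sum>b<N. u a * (M0 a b + (\<Sum>p\<in>UNIV. slice i j k l \<alpha> \<beta> $ p * M p a b)) * u b)"
      proof (intro sum.cong refl)
        fix a b assume "a \<in> {..<N}" "b \<in> {..<N}"
        then have "MA a b + \<alpha> * lin E1 a b + (\<beta> - 1) * lin E2 a b
            = M0 a b + (\<Sum>p\<in>UNIV. slice i j k l \<alpha> \<beta> $ p * M p a b)"
          unfolding x by (simp add: MA_def lin_def distrib_right sum.distrib sum_distrib_left mult.assoc)
        then show "(MA a b + \<alpha> * lin E1 a b + (\<beta> - 1) * lin E2 a b) * u a * u b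
            = u a * (M0 a b + (\<Sum>p\<in>UNIV. slice i j k l \<alpha> \<beta> $ p * M p a b)) * u b"
          by (simp only: mult_ac)
      qed
      finally show ?thesis ..
    qed
    then show ?thesis by (simp add: H psd_matrix_def)
  qed
  have symlin: "lin y a b = lin y b a" for y a b
    using sym by (auto simp: lin_def symmetric_matrix_def intro!: sum.cong)
  have symA: "MA a b = MA b a" for a b
    using sym0 symlin[of x0 a b] by (auto simp: MA_def symmetric_matrix_def)
  have ray: "0 \<le> form MA u + s * form (lin E2) u" if "s \<ge> 0" for u s
  proof -
    have "slice i j k l 0 (1 + s) \<in> H" unfolding H_def by (rule slice_in_cone[OF ij kl]) (use that in auto)
    then have "0 \<le> form MA u + 0 * form (lin E1) u + (1 + s - 1) * form (lin E2) u" unfolding H_iff by blast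
    then show ?thesis by simp
  qed
  have A: "0 \<le> form MA u" for u using ray[of 0 u] by simp
  have D: "0 \<le> form (lin E2) u" for u
  proof (rule ccontr)
    assume neg: "\<not> 0 \<le> form (lin E2) u"
    define s where "s = (form MA u + 1) / (- form (lin E2) u)"
    have "s \<ge> 0" using neg A[of u] by (simp add: s_def divide_nonneg_neg field_simps)
    then show False using ray[of s u] neg by (simp add: s_def field_simps)
  qed
  have kernel: "form (lin E2) u = 0" if "form MA u = 0" for u
  proof -
    have bound: "form (lin E2) u \<le> \<sigma> * form (lin E1) u" if "0 < \<sigma>" "\<sigma> < 1" for \<sigma>
    proof -
      have "slice i j k l (\<sigma>\<^sup>2) (1 - \<sigma>) \<in> H" unfolding H_def by (rule slice_in_cone[OF ij kl]) (use that in auto)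
      then have "0 \<le> form MA u + \<sigma>\<^sup>2 * form (lin E1) u + (1 - \<sigma> - 1) * form (lin E2) u" unfolding H_iff by blast
      then have "\<sigma> * form (lin E2) u \<le> \<sigma> * (\<sigma> * form (lin E1) u)"
        using \<open>form MA u = 0\<close> by (simp add: power2_eq_square algebra_simps)
      then show ?thesis using that by simp
    qed
    have "form (lin E2) u \<le> 0"
    proof (rule ccontr)
      assume "\<not> form (lin E2) u \<le> 0"
      then have pos: "form (lin E2) u > 0" by simp
      define \<sigma> where "\<sigma> = min (1/2) (form (lin E2) u / (2 * (\<bar>form (lin E1) u\<bar> + 1)))"
      have \<sigma>: "0 < \<sigma>" "\<sigma> < 1" using pos by (auto simp: \<sigma>_def)
      have "\<sigma> * form (lin E1) u \<le> \<sigma> * (\<bar>form (lin E1) u\<bar> + 1)" using \<sigma> by (intro mult_left_mono) auto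
      also have "\<dots> \<le> form (lin E2) u / (2 * (\<bar>form (lin E1) u\<bar> + 1)) * (\<bar>form (lin E1) u\<bar> + 1)"
        by (intro mult_right_mono) (auto simp: \<sigma>_def)
      also have "\<dots> = form (lin E2) u / 2"
        by (simp add: field_simps)
      finally show False using bound[OF \<sigma>] pos by simp
    qed
    then show ?thesis using D[of u] by simp
  qed
  obtain K :: nat and h where h: "\<And>u. form (lin E2) u = (\<Sum>r<K. (\<Sum>a<N. h r a * u a)\<^sup>2)"
    using psd_sum_of_squares[of "{..<N}" "lin E2", OF finite_lessThan symlin] D unfolding form_def by blast
  have "\<exists>C\<ge>0. \<forall>u. (\<Sum>a<N. h r a * u a)\<^sup>2 \<le> C * form MA u" if "r < K" for r
    unfolding form_def
  proof (rule psd_dominates_linear_form)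
    fix u assume "(\<Sum>i<N. \<Sum>j<N. MA i j * u i * u j) = 0"
    then have "form MA u = 0" by (simp add: form_def)
    then have "(\<Sum>r<K. (\<Sum>a<N. h r a * u a)\<^sup>2) = 0" using kernel h by metis
    then show "(\<Sum>a<N. h r a * u a) = 0" using that by (simp add: sum_nonneg_eq_0_iff)
  qed (use symA A in \<open>auto simp: form_def\<close>)
  then obtain C where C: "\<And>r. r < K \<Longrightarrow> C r \<ge> 0" "\<And>r u. r < K \<Longrightarrow> (\<Sum>a<N. h r a * u a)\<^sup>2 \<le> C r * form MA u"
    by metis
  define c where "c = (\<Sum>r<K. C r)"
  have c: "c \<ge> 0" unfolding c_def by (rule sum_nonneg) (use C in auto)
  have dom: "form (lin E2) u \<le> c * form MA u" for u
    unfolding h c_def sum_distrib_right by (rule sum_mono) (use C in auto)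
  define \<sigma> where "\<sigma> = 1 / (c + 2)"
  have \<sigma>: "0 < \<sigma>" "\<sigma> < 1" "\<sigma> * c \<le> 1" using c by (auto simp: \<sigma>_def field_simps)
  have "0 \<le> form MA u + 0 * form (lin E1) u + (1 - \<sigma> - 1) * form (lin E2) u" for u
  proof -
    have "\<sigma> * form (lin E2) u \<le> \<sigma> * (c * form MA u)" using dom \<sigma> by (intro mult_left_mono) auto
    also have "\<dots> \<le> 1 * form MA u" unfolding mult.assoc[symmetric] using \<sigma> A by (intro mult_right_mono) auto
    finally show ?thesis by simp
  qed
  then have "slice i j k l 0 (1 - \<sigma>) \<in> H" unfolding H_iff by blast
  moreover have "slice i j k l 0 (1 - \<sigma>) \<notin> H"
    unfolding H_def by (rule slice_notin_cone[OF ij kl]) (use \<sigma> in auto)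
  ultimately show False by blast
qed


section \<open>The algebraic boundary\<close>

lemma independent_axes: "independent (range (\<lambda>i. axis i 1 :: real ^ 'x))"
  by (rule independent_mono[OF independent_Basis]) (auto simp: Basis_vec_def)

text \<open>
The direction \<open>e\<close> has to be interior to the cone, so that all lines along it meet the frontier, and off
the hypersurface of the homogeneous equation \<open>h\<close>, so that the roots of \<open>h\<close> along it stay bounded.
\<close>

lemma nonneg_biquad_algebraic_boundary:
  fixes H :: "(real ^ ('m::finite uprod \<times> 'n::finite uprod)) set"
  assumes H: "H = nonneg_biquad"
  shows "\<exists>p. irreducible_polynomial_function p \<and> algebraic_boundary H = {z. p z = 0} \<and>
    zariski_closure (singular_forms :: (complex ^ ('m uprod \<times> 'n uprod)) set) = {z. p z = 0}"
proof -
  obtain f :: "complex ^ ('m uprod \<times> 'n uprod) \<Rightarrow> complex"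
    where f: "polyfun f" "\<exists>z. f z \<noteq> 0" "\<forall>c\<in>singular_forms. f c = 0"
    using singular_forms_in_hypersurface by blast
  obtain d h where h: "homogeneous d h" "\<exists>z. h z \<noteq> 0"
    "\<forall>c\<in>(singular_forms :: (complex ^ ('m uprod \<times> 'n uprod)) set). h c = 0"
    using homogeneous_equation[OF singular_forms_scale f] by blast
  have h_poly: "polyfun h" using h(1) by (simp add: homogeneous_def)
  have "product_of_square_sums (\<lambda>i. axis i 1) (\<lambda>k. axis k 1) \<in> interior H"
    unfolding H
  proof (intro interior_if_positive product_of_square_sums_positive)
    show "independent (range (\<lambda>i. axis i 1 :: real ^ 'm))" "independent (range (\<lambda>i. axis i 1 :: real ^ 'n))"
      by (rule independent_axes)+
  qed (auto simp: inj_def axis_eq_axis)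
  then obtain e where e: "e \<in> interior H" "h (complexify e) \<noteq> 0"
    using polyfun_nonzero_on_open[OF h_poly h(2), of "interior H"] by blast
  define E where "E = complexify e"
  obtain M where M: "M \<ge> 0" "\<And>z s. h (z + s *s E) = 0 \<Longrightarrow> norm s \<le> M * norm z"
    using homogeneous_root_bound[OF h(1) e(2)] unfolding E_def by blast
  have "E \<noteq> 0"
  proof
    assume "E = 0"
    have "h (0 + 1 *s E) = 0"
    proof -
      obtain c :: "complex ^ ('m uprod \<times> 'n uprod)" where "c \<in> singular_forms"
        using singular_form_at_in_singular_forms by blast
      then have "0 *s c \<in> singular_forms" by (rule singular_forms_scale)
      then show ?thesis using h(3) \<open>E = 0\<close> by simp
    qed
    then show False using M(2)[of 0 1] by simp
  qed
  then obtain i0 where i0: "E $ i0 \<noteq> 0" by (auto simp: vec_eq_iff)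
  interpret direction E i0 by standard (rule i0)
  have frontier_singular: "complexify ` frontier H \<subseteq> singular_forms"
  proof
    fix c assume "c \<in> complexify ` frontier H"
    then obtain T where T: "T \<in> frontier H" "c = complexify T" by blast
    obtain v w where vw: "v \<noteq> 0" "w \<noteq> 0" "biquad_form T v w = 0"
      using frontier_has_zero T(1) unfolding H by blast
    have "T \<in> H" using T(1) closed_nonneg_biquad unfolding H by (metis DiffD1 closure_closed frontier_def)
    then have "critical T v w" using critical_if_zero vw(3) unfolding H by blast
    then have "critical c (complexify v) (complexify w)" unfolding T(2) by (rule critical_complexify)
    moreover have "complexify v \<noteq> 0" "complexify w \<noteq> 0" using vw by (simp_all add: complexify_simps)
    ultimately show "c \<in> singular_forms" unfolding singular_forms_def by blast
  qed
  have "\<exists>p. irreducible_polynomial_function p \<and> zariski_closure singular_forms = {z. p z = 0} \<and>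
      zariski_closure (complexify ` frontier H) = {z. p z = 0}"
  proof (rule irreducible_hypersurface_of_prime_set[OF \<open>E \<noteq> 0\<close> singular_forms_prime h_poly h(3) M(2) M(1)])
    fix g assume g: "invariant_along E g" "\<forall>z\<in>complexify ` frontier H. g z = 0"
    have "g (complexify T) = 0" for T
    proof -
      obtain t where t: "T + t *\<^sub>R e \<in> frontier H"
        using translate_meets_frontier[of e T] e(1) unfolding H by blast
      have "complexify (T + t *\<^sub>R e) = complexify T + of_real t *s E"
        by (simp add: E_def vec_eq_iff complexify_simps)
      then have "g (complexify (T + t *\<^sub>R e)) = g (complexify T)"
        using g(1) by (simp add: invariant_along_def)
      then show ?thesis using g(2) t by auto
    qed
    then show "\<forall>z. g z = 0" using polyfun_zero_if_zero_on_reals g(1) unfolding invariant_along_def by blast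
  next
    fix f :: "complex ^ ('m uprod \<times> 'n uprod) \<Rightarrow> complex"
    assume "\<forall>z\<in>singular_forms. f z = 0"
    then show "\<forall>z\<in>complexify ` frontier H. f z = 0" using frontier_singular by blast
  qed
  then show ?thesis unfolding algebraic_boundary_def by blast
qed

theorem theorem6p4:
  fixes H :: "(real ^ ('m::finite uprod \<times> 'n::finite uprod)) set"
  assumes "CARD('m) \<ge> 2" and "CARD('n) \<ge> 2"
    and "H = Hom_AC S_plus S_plus"
  shows "(algebraic_boundary H = dual_variety segre_veronese_cone \<and>
          irreducible_hypersurface (algebraic_boundary H)) \<and>
         (\<forall>(x :: 'm \<Rightarrow> real ^ 'm) (y :: 'n \<Rightarrow> real ^ 'n).
            inj x \<and> independent (range x) \<and> inj y \<and> independent (range y) \<longrightarrow>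
              (\<forall>v w. v \<noteq> 0 \<and> w \<noteq> 0 \<longrightarrow> biquad_form (product_of_square_sums x y) v w > 0) \<and>
              product_of_square_sums x y \<in> interior H \<and>
              complexify (product_of_square_sums x y) \<in> algebraic_boundary H) \<and>
         (\<not> basic_closed_semialgebraic H \<and> \<not> spectrahedron H)"
proof -
  obtain p where p: "irreducible_polynomial_function p" "algebraic_boundary H = {z. p z = 0}"
    "zariski_closure (singular_forms :: (complex ^ ('m uprod \<times> 'n uprod)) set) = {z. p z = 0}"
    using nonneg_biquad_algebraic_boundary[OF assms(3)] by blast
  have boundary: "algebraic_boundary H = zariski_closure singular_forms" using p by simp
  have dual: "algebraic_boundary H = dual_variety segre_veronese_cone"
    unfolding boundary by (rule dual_variety_segre_veronese[OF assms(1), symmetric])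
  have hypersurface: "irreducible_hypersurface (algebraic_boundary H)"
    unfolding irreducible_hypersurface_def using p by blast
  have squares: "(\<forall>v w. v \<noteq> 0 \<and> w \<noteq> 0 \<longrightarrow> biquad_form (product_of_square_sums x y) v w > 0) \<and>
      product_of_square_sums x y \<in> interior H \<and>
      complexify (product_of_square_sums x y) \<in> algebraic_boundary H"
    if x: "inj x" "independent (range x)" and y: "inj y" "independent (range y)"
    for x :: "'m \<Rightarrow> real ^ 'm" and y :: "'n \<Rightarrow> real ^ 'n"
  proof (intro conjI allI impI)
    show "biquad_form (product_of_square_sums x y) v w > 0" if "v \<noteq> 0 \<and> w \<noteq> 0" for v w
      using product_of_square_sums_positive[OF x y] that by blast
    show "product_of_square_sums x y \<in> interior H"
      unfolding assms(3) by (intro interior_if_positive product_of_square_sums_positive[OF x y])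
    have "complexify (product_of_square_sums x y) \<in> singular_forms"
      unfolding singular_forms_def using product_of_square_sums_singular[OF assms(1,2) x y] by blast
    then show "complexify (product_of_square_sums x y) \<in> algebraic_boundary H"
      unfolding boundary zariski_closure_def by blast
  qed
  show ?thesis
    using dual hypersurface squares not_basic_closed_semialgebraic[OF assms(1,2)]
      not_spectrahedron[OF assms(1,2)] unfolding assms(3) by blast
qed

end
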